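(* Let $d\ge 1$, let $h:E^d\to\mathbb{R}$ be measurable and symmetric under permutations of its $d$ arguments, and let $(\gamma_n)_{n\ge1}$ be a sequence of positive numbers such that, for some constant $C<\infty$, (i) $\gamma_n$ is nondecreasing; (ii) $\gamma_{2n}\le C\gamma_n$ for every $n$; (iii) $\sum_{k\ge l}\frac{2^{dk}}{\gamma_{2^k}^2}\le C\,\frac{2^{dl}}{\gamma_{2^l}^2}$ for every $l=1,2,\ldots$. Let the sets $A_{k,l}\subset E^d$ ($k\ge1$, $1\le l\le d$) be defined as in the context. Then the following six conditions are equivalent: (a) $\frac{1}{\gamma_n}\sum_{\mathbf{i}\in I_n}\varepsilon_{\mathbf{i}}\,h(X_{\mathbf{i}})\to 0$ a.s. as $n\to\infty$; (b) $\frac{1}{\gamma_n}\sum_{\mathbf{i}\in C_n}\tilde\varepsilon_{\mathbf{i}}\,h(\tilde X_{\mathbf{i}})\to 0$ a.s. as $n\to\infty$; (c) $\frac{1}{\gamma_n^2}\sum_{\mathbf{i}\in I_n}h^2(X_{\mathbf{i}})\to 0$ a.s. as $n\to\infty$; (d) $\frac{1}{\gamma_n^2}\sum_{\mathbf{i}\in C_n}h^2(\tilde X_{\mathbf{i}})\to 0$ a.s. as $n\to\infty$; (e) $\sum_{k=1}^\infty P\big(\exists\,\mathbf{i}\in I_{2^k}:\ X_{\mathbf{i}}\notin A_{k,d}\big)<\infty$; (f) $\sum_{k=1}^\infty P\big(\exists\,\mathbf{i}\in C_{2^k}:\ \tilde X_{\mathbf{i}}\notin A_{k,d}\big)<\i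nfty$.
   Context: $(X_j)_{j\ge1}$ is a sequence of i.i.d. random variables with values in a measurable space $E$ and common law $\mu$; $(X^{(k)}_j)_{j\ge1}$, $k=1,\dots,d$, are independent copies of the sequence $(X_j)$. $(\varepsilon_i)_{i\ge1}$ is a Rademacher sequence (i.i.d. symmetric random variables with values $\pm1$) and $(\varepsilon^{(k)}_i)_{i\ge1,\,1\le k\le d}$ is a doubly indexed Rademacher sequence (all entries i.i.d.), each independent of all the other random variables. For a multiindex $\mathbf{i}=(i_1,\dots,i_d)$ of positive integers: $X_{\mathbf{i}}=(X_{i_1},\dots,X_{i_d})$, $\tilde X_{\mathbf{i}}=(X^{(1)}_{i_1},\dots,X^{(d)}_{i_d})$, $\varepsilon_{\mathbf{i}}=\varepsilon_{i_1}\cdots\varepsilon_{i_d}$, $\tilde\varepsilon_{\mathbf{i}}=\varepsilon^{(1)}_{i_1}\cdots\varepsilon^{(d)}_{i_d}$. Index sets: $I_n=\{\mathbf{i}:1\le i_1<i_2<\dots<i_d\le n\}$ and $C_n=\{\mathbf{i}:1\le i_1,\dots,i_d\le n\}$. For $I\subset\{1,\dots,d\}$ and a nonnegative measurable $g$ on $E^d$, $E_I g(x)$ denotes the integral of $g$ over the coordinates with index in $I$, each with respect to $\mu$ (independently), the coordinates $x_k$, $k\notin I$, being kept fixed. $I_A$ for a set $A\subset E^d$ denotes its indicator function. The sets $A_{k,l}$ are defined, for $k=1,2,\dots$, by $$A_{k,1}=\{x\in E^d:\ h^2(x)\le\gamma_{2^k}^2\},$$ and for $l=1,\dots,d-1$,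 $$A_{k,l+1}=\{x\in A_{k,l}:\ 2^{kl}E_I\big(h^2I_{A_{k,l}}\big)(x)\le\gamma_{2^k}^2\ \text{ for all } I\subset\{1,\dots,d\}\text{ with } \mathrm{Card}(I)=l\}.$$ *)

theory Defs
  imports "HOL-Probability.Probability" "HOL-Combinatorics.Permutations"
begin

text \<open>
  Coordinates are numbered \<open>1, \<dots>, d\<close> and sequences start at index \<open>1\<close>.  A point of \<open>E\<^sup>d\<close> and a
  multiindex are extensional functions on \<open>{1..d}\<close>.
\<close>

abbreviation power_space :: "nat \<Rightarrow> 'e measure \<Rightarrow> (nat \<Rightarrow> 'e) measure" where
  "power_space d E \<equiv> Pi\<^sub>M {1..d} (\<lambda>_. E)"

definition incr_idx :: "nat \<Rightarrow> nat \<Rightarrow> (nat \<Rightarrow> nat) set" where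
  "incr_idx d n = {i \<in> {1..d} \<rightarrow>\<^sub>E {1..n}. strict_mono_on {1..d} i}"

definition all_idx :: "nat \<Rightarrow> nat \<Rightarrow> (nat \<Rightarrow> nat) set" where
  "all_idx d n = {1..d} \<rightarrow>\<^sub>E {1..n}"

definition pt :: "nat \<Rightarrow> (nat \<Rightarrow> 'a \<Rightarrow> 'e) \<Rightarrow> (nat \<Rightarrow> nat) \<Rightarrow> 'a \<Rightarrow> (nat \<Rightarrow> 'e)" where
  "pt d X i \<omega> = (\<lambda>r\<in>{1..d}. X (i r) \<omega>)"

definition pt_dec :: "nat \<Rightarrow> (nat \<Rightarrow> nat \<Rightarrow> 'a \<Rightarrow> 'e) \<Rightarrow> (nat \<Rightarrow> nat) \<Rightarrow> 'a \<Rightarrow> (nat \<Rightarrow> 'e)" where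
  "pt_dec d X' i \<omega> = (\<lambda>r\<in>{1..d}. X' r (i r) \<omega>)"

definition sgn_prod :: "nat \<Rightarrow> (nat \<Rightarrow> 'a \<Rightarrow> real) \<Rightarrow> (nat \<Rightarrow> nat) \<Rightarrow> 'a \<Rightarrow> real" where
  "sgn_prod d \<epsilon> i \<omega> = (\<Prod>r\<in>{1..d}. \<epsilon> (i r) \<omega>)"

definition sgn_prod_dec :: "nat \<Rightarrow> (nat \<Rightarrow> nat \<Rightarrow> 'a \<Rightarrow> real) \<Rightarrow> (nat \<Rightarrow> nat) \<Rightarrow> 'a \<Rightarrow> real" where
  "sgn_prod_dec d \<epsilon>' i \<omega> = (\<Prod>r\<in>{1..d}. \<epsilon>' r (i r) \<omega>)"

definition symmetric_on_power :: "nat \<Rightarrow> 'e measure \<Rightarrow> ((nat \<Rightarrow> 'e) \<Rightarrow> real) \<Rightarrow> bool" where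
  "symmetric_on_power d E h \<longleftrightarrow>
     (\<forall>p. p permutes {1..d} \<longrightarrow> (\<forall>x\<in>space (power_space d E). h (x \<circ> p) = h x))"

definition partial_E ::
    "nat \<Rightarrow> 'e measure \<Rightarrow> nat set \<Rightarrow> ((nat \<Rightarrow> 'e) \<Rightarrow> ennreal) \<Rightarrow> (nat \<Rightarrow> 'e) \<Rightarrow> ennreal" where
  "partial_E d \<mu> I g x = (\<integral>\<^sup>+ y. g (merge I ({1..d} - I) (y, x)) \<partial>(Pi\<^sub>M I (\<lambda>_. \<mu>)))"

text \<open>Only the levels \<open>1 \<le> l \<le> d\<close> are meaningful; level \<open>0\<close> is a filler.\<close>

fun trunc_set ::
    "nat \<Rightarrow> 'e measure \<Rightarrow> 'e measure \<Rightarrow> ((nat \<Rightarrow> 'e) \<Rightarrow> real) \<Rightarrow> (nat \<Rightarrow> real)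
      \<Rightarrow> nat \<Rightarrow> nat \<Rightarrow> (nat \<Rightarrow> 'e) set" where
  "trunc_set d E \<mu> h \<gamma> k 0 = space (power_space d E)"
| "trunc_set d E \<mu> h \<gamma> k (Suc 0) =
     {x \<in> space (power_space d E). (h x)\<^sup>2 \<le> (\<gamma> (2 ^ k))\<^sup>2}"
| "trunc_set d E \<mu> h \<gamma> k (Suc (Suc l)) =
     {x \<in> trunc_set d E \<mu> h \<gamma> k (Suc l).
        \<forall>I. I \<subseteq> {1..d} \<and> card I = Suc l \<longrightarrow>
          2 ^ (k * Suc l) *
            partial_E d \<mu> I
              (\<lambda>y. ennreal ((h y)\<^sup>2) * indicator (trunc_set d E \<mu> h \<gamma> k (Suc l)) y) x
          \<le> ennreal ((\<gamma> (2 ^ k))\<^sup>2)}"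

definition joint_rv :: "'i set \<Rightarrow> ('i \<Rightarrow> 'a \<Rightarrow> 'b) \<Rightarrow> 'a \<Rightarrow> ('i \<Rightarrow> 'b)" where
  "joint_rv J Y \<omega> = (\<lambda>j\<in>J. Y j \<omega>)"

definition rademacher_family :: "'a measure \<Rightarrow> 'i set \<Rightarrow> ('i \<Rightarrow> 'a \<Rightarrow> real) \<Rightarrow> bool" where
  "rademacher_family M J \<epsilon> \<longleftrightarrow>
     prob_space.indep_vars M (\<lambda>_. borel) \<epsilon> J \<and>
     (\<forall>j\<in>J. measure M {\<omega> \<in> space M. \<epsilon> j \<omega> = 1} = 1 / 2 \<and>
            measure M {\<omega> \<in> space M. \<epsilon> j \<omega> = - 1} = 1 / 2)"

text \<open>\<^const>\<open>prob_space.indep_var\<close> requires both variables to have the same value type.\<close>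

definition indep_rv ::
    "'a measure \<Rightarrow> 'b measure \<Rightarrow> ('a \<Rightarrow> 'b) \<Rightarrow> 'c measure \<Rightarrow> ('a \<Rightarrow> 'c) \<Rightarrow> bool" where
  "indep_rv M N Y N' Y' \<longleftrightarrow>
     Y \<in> M \<rightarrow>\<^sub>M N \<and> Y' \<in> M \<rightarrow>\<^sub>M N' \<and>
     prob_space.indep_set M {Y -` A \<inter> space M |A. A \<in> sets N} {Y' -` A \<inter> space M |A. A \<in> sets N'}"

end

theory Submission
  imports Defs
begin

text \<open>
  The proof closes the cycle
  (e) \<open>\<Longrightarrow>\<close> (a) \<open>\<Longrightarrow>\<close> (c) \<open>\<Longrightarrow>\<close> (d) \<open>\<Longrightarrow>\<close> (f) \<open>\<Longrightarrow>\<close> (e) together with (f) \<open>\<Longrightarrow>\<close> (b) \<open>\<Longrightarrow>\<close> (d).  All six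
  conditions depend only on the joint laws of the variables, so they are first moved to product spaces,
  where passing between the single sequence and its decoupled copies is an injective renaming of
  coordinates (\<open>PiM_reindex\<close>).

  (e) \<open>\<longleftrightarrow>\<close> (f): a decoupled sample of size \<open>m\<close> sits inside a single sample of size \<open>d * m\<close> as \<open>d\<close>
  consecutive blocks; conversely, a random colouring of the indices with \<open>d\<close> colours gives the \<open>r\<close>-th index of a
  fixed increasing multiindex the colour \<open>r\<close>, for all \<open>r\<close> at once, with probability \<open>d ^ (-d)\<close>, and on
  that event the single sample looks decoupled.

  The sets \<open>A\<^sub>k\<^sub>,\<^sub>l\<close> are made for one purpose.  After truncation to \<open>A\<^sub>k\<^sub>,\<^sub>l\<close>, the average of
  \<open>h\<^sup>2 / \<gamma>\<^sup>2\<close> over any \<open>j < l\<close> coordinates is at most \<open>2 ^ (- k * j)\<close> everywhere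
  (\<open>EI_G_bound\<close>).  This is exactly what bounds the covariances of terms which share coordinates, so
  that a sum of \<open>h\<^sup>2 / \<gamma>\<^sup>2\<close> over \<open>l\<close> coordinates has second moment at most \<open>m * (m + 2 ^ l)\<close>, where \<open>m\<close>
  is its mean (\<open>second_moment_decoupled_sum\<close>).  The Paley-Zygmund inequality then makes the sum
  comparable to \<open>m\<close> with probability bounded below.  This is used twice.

  (d) \<open>\<Longrightarrow>\<close> (f): if a point of the sample leaves the truncation because its average over the coordinates
  \<open>I\<close> is too large, then, given the coordinates outside \<open>I\<close>, the sum of squares is of order \<open>\<gamma>\<^sup>2\<close>
  with probability bounded below (\<open>hit_bad_le_large_sqsum\<close>).  Over disjoint dyadic blocks of indices
  these events are independent, and by (d) only finitely many of them happen, so by the second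
  Borel-Cantelli lemma their probabilities are summable.

  (f) \<open>\<Longrightarrow>\<close> (b) and (e) \<open>\<Longrightarrow>\<close> (a): by the first Borel-Cantelli lemma \<open>h\<close> may be replaced by its
  truncation to \<open>A\<^sub>k\<^sub>,\<^sub>d\<close>.  The truncated signed sums form a martingale, whose maximum is controlled by
  its second moment (\<open>walsh_maximal_inequality\<close>), so it suffices that the normalised truncated second
  moments are summable over \<open>k\<close>.  The tail condition on \<open>\<gamma>\<close> reduces this to the mass that enters the
  truncation at step \<open>k\<close>; that mass was outside the truncation one step before and is bounded, again by
  Paley-Zygmund, by the probabilities in (f) (\<open>truncated_mass_summable\<close>).

  (a) \<open>\<Longrightarrow>\<close> (c) and (b) \<open>\<Longrightarrow>\<close> (d): given the points, the signed sum is a polynomial of degree \<open>d\<close> in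
  independent signs.  Its fourth moment is at most \<open>9 ^ d\<close> times the square of its second moment
  (\<open>walsh_fourth_moment\<close>), so it cannot tend to zero unless its conditional variance does, and the
  conditional variance is the sum of squares.

  (c) \<open>\<Longrightarrow>\<close> (d): the residue classes mod \<open>d\<close> split one sequence into \<open>d\<close> independent ones, and by
  symmetry of \<open>h\<close> the decoupled sum of squares becomes a part of the sum over increasing multiindices
  (\<open>decoupled_sqsum_le\<close>).
\<close>

section \<open>Polynomials in random signs\<close>

definition signs :: "'v set \<Rightarrow> ('v \<Rightarrow> real) set" where
  "signs J = J \<rightarrow>\<^sub>E {-1, 1}"

text \<open>The coefficients are indexed by sets of sites: a product of signs over distinct sites depends only on
  the set of these sites, and different sets give orthogonal characters.\<close>

definition walsh :: "('v set \<Rightarrow> real) \<Rightarrow> 'v set set \<Rightarrow> ('v \<Rightarrow> real) \<Rightarrow> real" where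
  "walsh a \<T> s = (\<Sum>T\<in>\<T>. a T * (\<Prod>j\<in>T. s j))"

lemma finite_signs [simp]: "finite J \<Longrightarrow> finite (signs J)"
  by (simp add: signs_def finite_PiE)

lemma card_signs: "finite J \<Longrightarrow> card (signs J) = 2 ^ card J"
  by (simp add: signs_def card_funcsetE numeral_2_eq_2)

lemma signs_square: "s \<in> signs J \<Longrightarrow> j \<in> J \<Longrightarrow> s j * s j = 1"
  unfolding signs_def by (drule (1) PiE_mem) auto

text \<open>Averaging over fair signs is a plain sum over sign patterns, so a conditional expectation that
  vanishes becomes a sum whose terms cancel in pairs under a change of one sign.\<close>

lemma sum_signs_flip_zero:
  fixes F :: "('v \<Rightarrow> real) \<Rightarrow> real"
  assumes "j \<in> J" and "\<And>s. s \<in> signs J \<Longrightarrow> F (s(j := - s j)) = - F s"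
  shows "sum F (signs J) = 0"
proof -
  have flip: "s(j := - s j) \<in> signs J" if "s \<in> signs J" for s
    using that assms(1) unfolding signs_def by (fastforce simp: PiE_iff extensional_def)
  have "sum F (signs J) = (\<Sum>s\<in>signs J. F (s(j := - s j)))"
    by (rule sum.reindex_bij_witness[of _ "\<lambda>s. s(j := - s j)" "\<lambda>s. s(j := - s j)"])
       (auto simp: flip)
  also have "\<dots> = - sum F (signs J)"
    by (simp add: assms(2) sum_negf)
  finally show ?thesis by simp
qed

lemma prod_flip_in:
  fixes s :: "'v \<Rightarrow> real"
  assumes "finite T" "j \<in> T"
  shows "(\<Prod>i\<in>T. (s(j := - s j)) i) = - (\<Prod>i\<in>T. s i)"
proof -
  have "(\<Prod>i\<in>T - {j}. (s(j := - s j)) i) = (\<Prod>i\<in>T - {j}. s i)"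
    by (rule prod.cong) auto
  then show ?thesis
    using prod.remove[OF assms, of "s(j := - s j)"] prod.remove[OF assms, of s] by simp
qed

lemma prod_flip_notin:
  fixes s :: "'v \<Rightarrow> real"
  assumes "j \<notin> T"
  shows "(\<Prod>i\<in>T. (s(j := - s j)) i) = (\<Prod>i\<in>T. s i)"
  using assms by (intro prod.cong) auto

lemma walsh_flip_notin:
  assumes "\<And>T. T \<in> \<T> \<Longrightarrow> j \<notin> T"
  shows "walsh a \<T> (s(j := - s j)) = walsh a \<T> s"
  unfolding walsh_def using assms by (intro sum.cong refl) (simp add: prod_flip_notin[OF assms] del: fun_upd_apply)

lemma characters_orthogonal:
  assumes "finite J" "T \<subseteq> J" "T' \<subseteq> J"
  shows "(\<Sum>s\<in>signs J. (\<Prod>j\<in>T. s j) * (\<Prod>j\<in>T'. s j)) = (if T = T' then 2 ^ card J else 0)"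
proof (cases "T = T'")
  case True
  have "(\<Prod>j\<in>T. s j) * (\<Prod>j\<in>T. s j) = 1" if "s \<in> signs J" for s
    using that assms by (subst prod.distrib[symmetric]) (auto intro!: prod.neutral simp: signs_square subset_iff)
  then show ?thesis using True assms by (simp add: card_signs)
next
  case False
  have fin: "finite T" "finite T'" using assms finite_subset by blast+
  from False consider j where "j \<in> T" "j \<notin> T'" | j where "j \<notin> T" "j \<in> T'" by blast
  then have "(\<Sum>s\<in>signs J. (\<Prod>j\<in>T. s j) * (\<Prod>j\<in>T'. s j)) = 0"
  proof cases
    case 1
    then show ?thesis using assms fin
      by (intro sum_signs_flip_zero[of j]) (auto simp: prod_flip_in prod_flip_notin simp del: fun_upd_apply)
  next
    case 2
    then show ?thesis using assms fin
      by (intro sum_signs_flip_zero[of j]) (auto simp: prod_flip_in prod_flip_notin simp del: fun_upd_apply)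
  qed
  then show ?thesis using False by simp
qed

lemma walsh_square_sum:
  assumes "finite J" "\<T> \<subseteq> Pow J"
  shows "(\<Sum>s\<in>signs J. (walsh a \<T> s)\<^sup>2) = 2 ^ card J * (\<Sum>T\<in>\<T>. (a T)\<^sup>2)"
proof -
  have fin: "finite \<T>" using assms by (meson finite_Pow_iff finite_subset)
  have "(\<Sum>s\<in>signs J. (walsh a \<T> s)\<^sup>2)
      = (\<Sum>s\<in>signs J. \<Sum>T\<in>\<T>. \<Sum>T'\<in>\<T>. a T * a T' * ((\<Prod>j\<in>T. s j) * (\<Prod>j\<in>T'. s j)))"
    unfolding walsh_def power2_eq_square sum_product by (intro sum.cong refl) (simp add: mult_ac)
  also have "\<dots> = (\<Sum>T\<in>\<T>. \<Sum>T'\<in>\<T>. a T * a T' * (\<Sum>s\<in>signs J. (\<Prod>j\<in>T. s j) * (\<Prod>j\<in>T'. s j)))"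
    by (subst sum.swap, intro sum.cong refl, subst sum.swap) (simp add: sum_distrib_left)
  also have "\<dots> = (\<Sum>T\<in>\<T>. \<Sum>T'\<in>\<T>. if T' = T then a T * a T * 2 ^ card J else 0)"
    using assms by (intro sum.cong refl, subst characters_orthogonal) auto
  also have "\<dots> = 2 ^ card J * (\<Sum>T\<in>\<T>. (a T)\<^sup>2)"
    using fin by (simp add: sum_distrib_left power2_eq_square mult_ac)
  finally show ?thesis .
qed

text \<open>Kolmogorov's inequality for the martingale obtained by revealing the signs on \<open>J 0 \<subseteq> J 1 \<subseteq> \<dots>\<close>.
  The increment after time \<open>n\<close> consists of characters that contain a sign outside \<open>J n\<close>; flipping this
  sign shows that the increment is orthogonal to everything determined by the signs in \<open>J n\<close>.\<close>

lemma walsh_maximal_inequality: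
  fixes J :: "nat \<Rightarrow> 'v set"
  assumes fin: "finite (J N)" and mono: "\<And>m n. m \<le> n \<Longrightarrow> n \<le> N \<Longrightarrow> J m \<subseteq> J n"
    and \<T>: "\<T> \<subseteq> Pow (J N)" and t: "t > 0"
  shows "t\<^sup>2 * real (card {s\<in>signs (J N). \<exists>n\<le>N. \<bar>walsh a {T\<in>\<T>. T \<subseteq> J n} s\<bar> \<ge> t})
      \<le> 2 ^ card (J N) * (\<Sum>T\<in>\<T>. (a T)\<^sup>2)"
proof -
  define W where "W n s = walsh a {T\<in>\<T>. T \<subseteq> J n} s" for n s
  define S where "S = signs (J N)"
  \<comment> \<open>the sign patterns whose first passage above \<open>t\<close> happens at time \<open>n\<close>\<close>
  define A where "A n = {s\<in>S. \<bar>W n s\<bar> \<ge> t \<and> (\<forall>m<n. \<bar>W m s\<bar> < t)}" for n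
  have finS: "finite S" using fin by (simp add: S_def)
  have fin\<T>: "finite \<T>" using \<T> fin by (meson finite_Pow_iff finite_subset)
  have orth: "(\<Sum>s\<in>S. indicator (A n) s * W n s * (W N s - W n s)) = 0" if n: "n \<le> N" for n
  proof -
    have diff: "W N s - W n s = (\<Sum>T\<in>{T\<in>\<T>. \<not> T \<subseteq> J n}. a T * (\<Prod>j\<in>T. s j))" for s
    proof -
      have "{T\<in>\<T>. T \<subseteq> J N} = \<T>" using \<T> by auto
      then have "W N s = (\<Sum>T\<in>\<T>. a T * (\<Prod>j\<in>T. s j))" by (simp add: W_def walsh_def)
      also have "\<dots> = (\<Sum>T\<in>{T\<in>\<T>. T \<subseteq> J n} \<union> {T\<in>\<T>. \<not> T \<subseteq> J n}. a T * (\<Prod>j\<in>T. s j))"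
        by (intro sum.cong) auto
      also have "\<dots> = W n s + (\<Sum>T\<in>{T\<in>\<T>. \<not> T \<subseteq> J n}. a T * (\<Prod>j\<in>T. s j))"
        unfolding W_def walsh_def using fin\<T> by (intro sum.union_disjoint) auto
      finally show ?thesis by simp
    qed
    have "(\<Sum>s\<in>S. indicator (A n) s * W n s * (a T * (\<Prod>j\<in>T. s j))) = 0"
      if T: "T \<in> \<T>" "\<not> T \<subseteq> J n" for T
    proof -
      obtain j where j: "j \<in> T" "j \<notin> J n" using T by blast
      have jN: "j \<in> J N" using T j \<T> by auto
      have finT: "finite T" using T \<T> fin finite_subset by blast
      have Wm: "W m (s(j := - s j)) = W m s" if "m \<le> n" for m s
        unfolding W_def using mono[OF that n] j by (intro walsh_flip_notin) auto
      have SS: "s(j := - s j) \<in> S \<longleftrightarrow> s \<in> S" if "s \<in> S" for s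
        using that jN unfolding S_def signs_def by (fastforce simp: PiE_iff extensional_def)
      have AA: "indicator (A n) (s(j := - s j)) = (indicator (A n) s :: real)" if "s \<in> S" for s
        using SS[OF that] Wm unfolding A_def indicator_def by auto
      show ?thesis
        unfolding S_def
        by (rule sum_signs_flip_zero[OF jN]) (simp add: AA[unfolded S_def] Wm prod_flip_in[OF finT j(1)] del: fun_upd_apply)
    qed
    then have "(\<Sum>T\<in>{T\<in>\<T>. \<not> T \<subseteq> J n}. \<Sum>s\<in>S. indicator (A n) s * W n s * (a T * (\<Prod>j\<in>T. s j))) = 0"
      by (intro sum.neutral) auto
    then show ?thesis
      unfolding diff by (subst (asm) sum.swap) (simp add: sum_distrib_left)
  qed
  have step: "t\<^sup>2 * real (card (A n)) \<le> (\<Sum>s\<in>A n. (W N s)\<^sup>2)" if n: "n \<le> N" for n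
  proof -
    have subA: "A n \<subseteq> S" by (auto simp: A_def)
    have "t\<^sup>2 * real (card (A n)) = (\<Sum>s\<in>A n. t\<^sup>2)" by simp
    also have "\<dots> \<le> (\<Sum>s\<in>A n. (W n s)\<^sup>2)"
    proof (intro sum_mono)
      fix s assume "s \<in> A n"
      then have "t \<le> \<bar>W n s\<bar>" by (auto simp: A_def)
      then show "t\<^sup>2 \<le> (W n s)\<^sup>2" using t by (simp add: abs_le_square_iff[symmetric])
    qed
    also have "\<dots> = (\<Sum>s\<in>A n. (W n s)\<^sup>2) + 2 * (\<Sum>s\<in>S. indicator (A n) s * W n s * (W N s - W n s))"
      using orth[OF n] by simp
    also have "(\<Sum>s\<in>S. indicator (A n) s * W n s * (W N s - W n s)) = (\<Sum>s\<in>A n. W n s * (W N s - W n s))"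
      using finS subA by (intro sum.mono_neutral_cong_right) (auto simp: indicator_def)
    also have "(\<Sum>s\<in>A n. (W n s)\<^sup>2) + 2 * \<dots> = (\<Sum>s\<in>A n. (W n s)\<^sup>2 + 2 * (W n s * (W N s - W n s)))"
      by (simp add: sum.distrib sum_distrib_left)
    also have "\<dots> \<le> (\<Sum>s\<in>A n. (W N s)\<^sup>2)"
    proof (intro sum_mono)
      fix s
      have "0 \<le> (W N s - W n s)\<^sup>2" by simp
      then show "(W n s)\<^sup>2 + 2 * (W n s * (W N s - W n s)) \<le> (W N s)\<^sup>2"
        by (simp add: power2_eq_square algebra_simps)
    qed
    finally show ?thesis .
  qed
  have disj: "A m \<inter> A n = {}" if "m \<noteq> n" for m n
    using that by (auto simp: A_def not_less[symmetric] neq_iff)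
  have Un: "{s\<in>S. \<exists>n\<le>N. \<bar>W n s\<bar> \<ge> t} = (\<Union>n\<in>{..N}. A n)"
  proof (intro equalityI subsetI)
    fix s assume s: "s \<in> {s\<in>S. \<exists>n\<le>N. \<bar>W n s\<bar> \<ge> t}"
    then obtain n where n: "n \<le> N" "\<bar>W n s\<bar> \<ge> t" by blast
    define m where "m = (LEAST m. \<bar>W m s\<bar> \<ge> t)"
    have "\<bar>W m s\<bar> \<ge> t" unfolding m_def using n(2) by (rule LeastI)
    moreover have "m \<le> n" unfolding m_def using n(2) by (rule Least_le)
    moreover have "\<forall>k<m. \<bar>W k s\<bar> < t" using not_less_Least unfolding m_def by fastforce
    ultimately show "s \<in> (\<Union>n\<in>{..N}. A n)" using s n by (auto simp: A_def)
  qed (auto simp: A_def)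
  have finA: "finite (A n)" for n using finS by (auto simp: A_def)
  have "t\<^sup>2 * real (card {s\<in>S. \<exists>n\<le>N. \<bar>W n s\<bar> \<ge> t}) = (\<Sum>n\<le>N. t\<^sup>2 * real (card (A n)))"
    unfolding Un using disj finA by (subst card_UN_disjoint) (auto simp: sum_distrib_left)
  also have "\<dots> \<le> (\<Sum>n\<le>N. \<Sum>s\<in>A n. (W N s)\<^sup>2)"
    using step by (intro sum_mono) auto
  also have "\<dots> = (\<Sum>s\<in>(\<Union>n\<in>{..N}. A n). (W N s)\<^sup>2)"
    using disj finA by (intro sum.UNION_disjoint[symmetric]) auto
  also have "\<dots> \<le> (\<Sum>s\<in>S. (W N s)\<^sup>2)"
    using finS by (intro sum_mono2) (auto simp: A_def)
  also have "\<dots> = (\<Sum>s\<in>S. (walsh a \<T> s)\<^sup>2)"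
  proof -
    have "{T\<in>\<T>. T \<subseteq> J N} = \<T>" using \<T> by auto
    then show ?thesis by (simp add: W_def)
  qed
  also have "\<dots> = 2 ^ card (J N) * (\<Sum>T\<in>\<T>. (a T)\<^sup>2)"
    unfolding S_def using fin \<T> by (rule walsh_square_sum)
  finally show ?thesis unfolding W_def S_def .
qed

lemma sum_signs_insert:
  fixes F :: "('v \<Rightarrow> real) \<Rightarrow> 'b::comm_monoid_add"
  assumes "finite J" "j \<notin> J"
  shows "(\<Sum>s\<in>signs (insert j J). F s) = (\<Sum>s\<in>signs J. F (s(j := 1)) + F (s(j := - 1)))"
proof -
  have eq: "signs (insert j J) = (\<lambda>s. s(j := 1)) ` signs J \<union> (\<lambda>s. s(j := - 1)) ` signs J"
    unfolding signs_def PiE_insert_eq by (auto simp: image_iff)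
  have jJ: "s j = undefined" if "s \<in> signs J" for s
    using that assms(2) by (auto simp: signs_def PiE_def extensional_def)
  have inj: "inj_on (\<lambda>s. s(j := c)) (signs J)" for c
    by (rule inj_onI) (metis fun_upd_triv fun_upd_upd jJ)
  have disj: "(\<lambda>s. s(j := 1)) ` signs J \<inter> (\<lambda>s. s(j := - 1)) ` signs J = {}"
  proof -
    have False if "s(j := 1) = s'(j := (-1::real))" for s s'
      using fun_cong[OF that, of j] by simp
    then show ?thesis by blast
  qed
  show ?thesis
    unfolding eq using assms(1) disj
    by (simp add: sum.union_disjoint sum.reindex[OF inj] sum.distrib)
qed

text \<open>Bonami's inequality, by induction over the signs.  Split off one sign and write the polynomial as
  \<open>A + s * B\<close>, where \<open>B\<close> has one degree less.  Averaging the fourth power over \<open>s\<close> leaves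
  \<open>A ^ 4 + 6 * A\<^sup>2 * B\<^sup>2 + B ^ 4\<close>; the middle term is treated by the Cauchy-Schwarz inequality, and the factor
  \<open>9 = 3\<^sup>2\<close> per degree is what turns the coefficient \<open>6\<close> into the \<open>2\<close> of a perfect square.\<close>

lemma walsh_fourth_moment:
  assumes "finite J" "\<And>T. T \<subseteq> J \<Longrightarrow> card T > d \<Longrightarrow> a T = 0"
  shows "(\<Sum>s\<in>signs J. (walsh a (Pow J) s) ^ 4) \<le> 2 ^ card J * 9 ^ d * (\<Sum>T\<in>Pow J. (a T)\<^sup>2)\<^sup>2"
  using assms
proof (induction J arbitrary: a d rule: finite_induct)
  case empty
  have "(a {}) ^ 4 \<le> 9 ^ d * (a {}) ^ 4"
    using mult_right_mono[of 1 "9 ^ d" "a {} ^ 4"] by simp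
  then show ?case by (simp add: signs_def walsh_def power_mult[symmetric])
next
  case (insert j J)
  define b where "b T = a (insert j T)" for T
  define A where "A = walsh a (Pow J)"
  define B where "B = walsh b (Pow J)"
  define \<alpha> where "\<alpha> = (\<Sum>T\<in>Pow J. (a T)\<^sup>2)"
  define \<beta> where "\<beta> = (\<Sum>T\<in>Pow J. (b T)\<^sup>2)"
  have inj: "inj_on (insert j) (Pow J)" using insert.hyps by (auto intro!: inj_onI)
  have disj: "Pow J \<inter> insert j ` Pow J = {}" using insert.hyps by auto
  have finP: "finite (Pow J)" using insert.hyps by simp
  have split: "walsh a (Pow (insert j J)) (s(j := c)) = A s + c * B s" for s c
  proof -
    have *: "(\<Prod>i\<in>T. (s(j := c)) i) = (\<Prod>i\<in>T. s i)" if "T \<subseteq> J" for T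
      using that insert.hyps by (intro prod.cong) auto
    have **: "(\<Prod>i\<in>insert j T. (s(j := c)) i) = c * (\<Prod>i\<in>T. s i)" if "T \<subseteq> J" for T
      using that insert.hyps by (subst prod.insert) (auto intro: finite_subset simp: *[OF that, simplified])
    have "walsh a (Pow (insert j J)) (s(j := c))
        = (\<Sum>T\<in>Pow J. a T * (\<Prod>i\<in>T. (s(j := c)) i)) + (\<Sum>T\<in>Pow J. b T * (\<Prod>i\<in>insert j T. (s(j := c)) i))"
      unfolding walsh_def Pow_insert b_def using disj finP
      by (subst sum.union_disjoint) (simp_all add: sum.reindex[OF inj] del: fun_upd_apply)
    also have "(\<Sum>T\<in>Pow J. a T * (\<Prod>i\<in>T. (s(j := c)) i)) = A s"
      unfolding A_def walsh_def by (intro sum.cong refl arg_cong2[where f="(*)"] *) auto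
    also have "(\<Sum>T\<in>Pow J. b T * (\<Prod>i\<in>insert j T. (s(j := c)) i)) = (\<Sum>T\<in>Pow J. b T * (c * (\<Prod>i\<in>T. s i)))"
      by (intro sum.cong refl arg_cong2[where f="(*)"] **) auto
    also have "\<dots> = c * B s"
      unfolding B_def walsh_def sum_distrib_left by (simp add: mult_ac)
    finally show ?thesis .
  qed
  have coef: "(\<Sum>T\<in>Pow (insert j J). (a T)\<^sup>2) = \<alpha> + \<beta>"
    unfolding \<alpha>_def \<beta>_def b_def Pow_insert using disj finP
    by (subst sum.union_disjoint) (simp_all add: sum.reindex[OF inj])
  have pos: "\<alpha> \<ge> 0" "\<beta> \<ge> 0" unfolding \<alpha>_def \<beta>_def by (simp_all add: sum_nonneg)
  let ?K = "2 ^ card J :: real"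
  have EA: "(\<Sum>s\<in>signs J. A s ^ 4) \<le> ?K * 9 ^ d * \<alpha>\<^sup>2"
    unfolding A_def \<alpha>_def using insert.prems by (intro insert.IH) auto
  have mixed: "(\<Sum>s\<in>signs J. (A s)\<^sup>2 * (B s)\<^sup>2) \<le> ?K * 9 ^ d * (\<alpha> * \<beta>) / 3"
    and EB: "(\<Sum>s\<in>signs J. B s ^ 4) \<le> ?K * 9 ^ d * \<beta>\<^sup>2"
  proof -
    have "(\<Sum>s\<in>signs J. (A s)\<^sup>2 * (B s)\<^sup>2) \<le> ?K * 9 ^ d * (\<alpha> * \<beta>) / 3 \<and> (\<Sum>s\<in>signs J. B s ^ 4) \<le> ?K * 9 ^ d * \<beta>\<^sup>2"
    proof (cases d)
      case 0
      have "b T = 0" if "T \<subseteq> J" for T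
        unfolding b_def using that insert.hyps insert.prems[of "insert j T"] 0
        by (auto simp: finite_subset card_gt_0_iff)
      then have "B s = 0" for s unfolding B_def walsh_def by (simp add: sum.neutral)
      then show ?thesis using pos by simp
    next
      case (Suc e)
      have *: "(\<Sum>s\<in>signs J. B s ^ 4) \<le> ?K * 9 ^ e * \<beta>\<^sup>2"
        unfolding B_def \<beta>_def
      proof (rule insert.IH)
        fix T assume T: "T \<subseteq> J" "e < card T"
        then have "card (insert j T) > d"
          using Suc insert.hyps by (subst card_insert_disjoint) (auto intro: finite_subset)
        then show "b T = 0" unfolding b_def using T by (intro insert.prems) auto
      qed
      have "(\<Sum>s\<in>signs J. (A s)\<^sup>2 * (B s)\<^sup>2)\<^sup>2 \<le> (\<Sum>s\<in>signs J. ((A s)\<^sup>2)\<^sup>2) * (\<Sum>s\<in>signs J. ((B s)\<^sup>2)\<^sup>2)"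
        by (rule Cauchy_Schwarz_ineq_sum)
      also have "\<dots> = (\<Sum>s\<in>signs J. A s ^ 4) * (\<Sum>s\<in>signs J. B s ^ 4)"
        by simp
      also have "\<dots> \<le> (?K * 9 ^ d * \<alpha>\<^sup>2) * (?K * 9 ^ e * \<beta>\<^sup>2)"
        using EA * by (intro mult_mono) (auto simp: sum_nonneg)
      also have "\<dots> = (?K * 9 ^ d * (\<alpha> * \<beta>) / 3)\<^sup>2"
        using Suc by (simp add: power2_eq_square field_simps)
      finally have "(\<Sum>s\<in>signs J. (A s)\<^sup>2 * (B s)\<^sup>2) \<le> ?K * 9 ^ d * (\<alpha> * \<beta>) / 3"
        using pos by (rule_tac power2_le_imp_le) auto
      moreover have "?K * 9 ^ e * \<beta>\<^sup>2 \<le> ?K * 9 ^ d * \<beta>\<^sup>2"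
        using Suc by (intro mult_right_mono mult_left_mono) auto
      ultimately show ?thesis using * by (intro conjI) linarith+
    qed
    then show "(\<Sum>s\<in>signs J. (A s)\<^sup>2 * (B s)\<^sup>2) \<le> ?K * 9 ^ d * (\<alpha> * \<beta>) / 3"
      "(\<Sum>s\<in>signs J. B s ^ 4) \<le> ?K * 9 ^ d * \<beta>\<^sup>2" by auto
  qed
  have "(\<Sum>s\<in>signs (insert j J). (walsh a (Pow (insert j J)) s) ^ 4)
      = (\<Sum>s\<in>signs J. (A s + B s) ^ 4 + (A s - B s) ^ 4)"
    using insert.hyps by (subst sum_signs_insert) (simp_all add: split)
  also have "\<dots> = (\<Sum>s\<in>signs J. 2 * (A s ^ 4) + 12 * ((A s)\<^sup>2 * (B s)\<^sup>2) + 2 * (B s ^ 4))"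
    by (intro sum.cong refl) (simp add: power2_eq_square power4_eq_xxxx algebra_simps)
  also have "\<dots> = 2 * (\<Sum>s\<in>signs J. A s ^ 4) + 12 * (\<Sum>s\<in>signs J. (A s)\<^sup>2 * (B s)\<^sup>2) + 2 * (\<Sum>s\<in>signs J. B s ^ 4)"
    by (simp add: sum.distrib sum_distrib_left)
  also have "\<dots> \<le> 2 * (?K * 9 ^ d * \<alpha>\<^sup>2) + 12 * (?K * 9 ^ d * (\<alpha> * \<beta>) / 3) + 2 * (?K * 9 ^ d * \<beta>\<^sup>2)"
    using EA EB mixed by linarith
  also have "\<dots> = 2 ^ card (insert j J) * 9 ^ d * (\<alpha> + \<beta>)\<^sup>2"
    using insert.hyps by (simp add: power2_eq_square algebra_simps)
  finally show ?case unfolding coef .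
qed

section \<open>Second moments of decoupled sums\<close>

text \<open>Invariance of an i.i.d. family under injective renaming of its index set.  Marginals, translations of
  blocks and the passage between one sequence and several are all instances.\<close>

lemma PiM_reindex:
  fixes \<mu> :: "'e measure"
  assumes "prob_space \<mu>" "inj_on \<phi> V" "\<phi> ` V \<subseteq> V'"
  shows "distr (Pi\<^sub>M V' (\<lambda>_. \<mu>)) (Pi\<^sub>M V (\<lambda>_. \<mu>)) (\<lambda>x. \<lambda>v\<in>V. x (\<phi> v)) = Pi\<^sub>M V (\<lambda>_. \<mu>)"
  using distr_PiM_reindex[of V' "\<lambda>_. \<mu>" \<phi> V] assms by auto

lemma measurable_reindex:
  assumes "\<phi> ` V \<subseteq> V'"
  shows "(\<lambda>x. \<lambda>v\<in>V. x (\<phi> v)) \<in> Pi\<^sub>M V' (\<lambda>_. \<mu>) \<rightarrow>\<^sub>M Pi\<^sub>M V (\<lambda>_. \<mu>)"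
  using assms by (intro measurable_restrict measurable_component_singleton) auto

lemma nn_integral_reindex:
  fixes \<mu> :: "'e measure"
  assumes "prob_space \<mu>" "inj_on \<phi> V" "\<phi> ` V \<subseteq> V'" "f \<in> borel_measurable (Pi\<^sub>M V (\<lambda>_. \<mu>))"
  shows "(\<integral>\<^sup>+x. f (\<lambda>v\<in>V. x (\<phi> v)) \<partial>Pi\<^sub>M V' (\<lambda>_. \<mu>)) = (\<integral>\<^sup>+x. f x \<partial>Pi\<^sub>M V (\<lambda>_. \<mu>))"
proof -
  have "(\<integral>\<^sup>+x. f x \<partial>Pi\<^sub>M V (\<lambda>_. \<mu>))
      = (\<integral>\<^sup>+x. f x \<partial>distr (Pi\<^sub>M V' (\<lambda>_. \<mu>)) (Pi\<^sub>M V (\<lambda>_. \<mu>)) (\<lambda>x. \<lambda>v\<in>V. x (\<phi> v)))"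
    by (simp only: PiM_reindex[OF assms(1-3)])
  also have "\<dots> = (\<integral>\<^sup>+x. f (\<lambda>v\<in>V. x (\<phi> v)) \<partial>Pi\<^sub>M V' (\<lambda>_. \<mu>))"
    using assms by (intro nn_integral_distr measurable_reindex) simp_all
  finally show ?thesis by simp
qed

text \<open>The factor \<open>A\<close> bounds the second moment by \<open>m * A\<close>.  Instead of Cauchy-Schwarz, integrate the pointwise
  inequality \<open>4 * A * W \<le> 2 * A * m + W\<^sup>2 + 4 * A\<^sup>2 * indicator {m / 2 \<le> W}\<close>: below \<open>m / 2\<close> the first term
  suffices, and above it the inequality is \<open>(W - 2 * A)\<^sup>2 \<ge> 0\<close>.\<close>

lemma paley_zygmund:
  fixes W :: "'a \<Rightarrow> ennreal" and m A :: real
  assumes "prob_space M" and [measurable]: "W \<in> borel_measurable M"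
    and m: "(\<integral>\<^sup>+x. W x \<partial>M) = ennreal m" "m \<ge> 0" and A: "A > 0"
    and sq: "(\<integral>\<^sup>+x. (W x)\<^sup>2 \<partial>M) \<le> ennreal (m * A)"
  shows "m \<le> 4 * A * measure M {x\<in>space M. ennreal (m / 2) \<le> W x}"
proof -
  interpret prob_space M by fact
  let ?S = "{x\<in>space M. ennreal (m / 2) \<le> W x}"
  have pw: "ennreal (4 * A) * W x \<le> ennreal (2 * A * m) + (W x)\<^sup>2 + ennreal (4 * A\<^sup>2) * indicator ?S x"
    if x: "x \<in> space M" for x
  proof (cases "W x")
    case (real w)
    have "4 * A * w \<le> 2 * A * m + w\<^sup>2 + 4 * A\<^sup>2 * indicator ?S x"
    proof (cases "m / 2 \<le> w")
      case True
      then have "indicator ?S x = (1::real)" using real x by (simp add: ennreal_leI)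
      moreover have "0 \<le> (w - 2 * A)\<^sup>2" by simp
      moreover have "0 \<le> 2 * A * m" using A m by simp
      ultimately show ?thesis by (simp add: power2_eq_square algebra_simps)
    next
      case False
      then have "4 * A * w \<le> 4 * A * (m / 2)" using A by (intro mult_left_mono) auto
      moreover have "0 \<le> 4 * A\<^sup>2 * (indicator ?S x :: real)" by simp
      moreover have "0 \<le> w\<^sup>2" by simp
      ultimately show ?thesis by linarith
    qed
    then have "ennreal (4 * A * w) \<le> ennreal (2 * A * m + w\<^sup>2 + 4 * A\<^sup>2 * indicator ?S x)"
      by (rule ennreal_leI)
    also have "\<dots> = ennreal (2 * A * m) + (ennreal w)\<^sup>2 + ennreal (4 * A\<^sup>2) * ennreal (indicator ?S x)"
      using A m real by (simp add: ennreal_power ennreal_mult[symmetric])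
    also have "ennreal (4 * A * w) = ennreal (4 * A) * ennreal w"
      using A real by (simp only: ennreal_mult)
    finally show ?thesis using real by (simp add: ennreal_indicator)
  next
    case top
    then show ?thesis by (simp add: power2_eq_square)
  qed
  have "ennreal (4 * A * m) = (\<integral>\<^sup>+x. ennreal (4 * A) * W x \<partial>M)"
    using A m by (simp add: nn_integral_cmult ennreal_mult)
  also have "\<dots> \<le> (\<integral>\<^sup>+x. ennreal (2 * A * m) + (W x)\<^sup>2 + ennreal (4 * A\<^sup>2) * indicator ?S x \<partial>M)"
    by (intro nn_integral_mono pw)
  also have "\<dots> = ennreal (2 * A * m) + (\<integral>\<^sup>+x. (W x)\<^sup>2 \<partial>M) + ennreal (4 * A\<^sup>2) * emeasure M ?S"
    by (simp add: nn_integral_add nn_integral_cmult emeasure_space_1)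
  also have "\<dots> \<le> ennreal (2 * A * m) + ennreal (m * A) + ennreal (4 * A\<^sup>2) * emeasure M ?S"
    using sq by (intro add_mono) auto
  also have "\<dots> = ennreal (2 * A * m + m * A + 4 * A\<^sup>2 * measure M ?S)"
  proof -
    have plus: "ennreal (a + b + c) = ennreal a + ennreal b + ennreal c" if "a \<ge> 0" "b \<ge> 0" "c \<ge> 0" for a b c
      using that by simp
    show ?thesis
      using A m by (subst plus) (simp_all add: emeasure_eq_measure ennreal_mult')
  qed
  finally have "4 * A * m \<le> 2 * A * m + m * A + 4 * A\<^sup>2 * measure M ?S"
    using A m by (subst (asm) ennreal_le_iff) auto
  then have "A * m \<le> A * (4 * A * measure M ?S)" by (simp add: power2_eq_square algebra_simps)
  then show ?thesis using A by simp
qed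

text \<open>Expand the square into pairs of multiindices and group them by the set \<open>J\<close> of coordinates where they
  agree.  For fixed \<open>i\<close> there are at most \<open>card B ^ card (I - J)\<close> partners, and integrating out the sites
  that only the partner uses replaces its factor by an average over \<open>I - J\<close>, which the hypothesis bounds
  by the inverse of that number.  So each nonempty \<open>J\<close> contributes at most one mean value of \<open>g\<close>, and
  \<open>J = {}\<close> contributes the square of the mean.\<close>

lemma second_moment_decoupled_sum:
  fixes g :: "('i \<Rightarrow> 'e) \<Rightarrow> ennreal" and B :: "'b set"
  assumes "prob_space \<mu>" "finite I" "finite B" "B \<noteq> {}"
    and g: "g \<in> borel_measurable (Pi\<^sub>M I (\<lambda>_. \<mu>))"
    and bound: "\<And>J z. J \<subseteq> I \<Longrightarrow> J \<noteq> {} \<Longrightarrow> z \<in> space (Pi\<^sub>M I (\<lambda>_. \<mu>)) \<Longrightarrow>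
        of_nat (card B ^ card (I - J)) * (\<integral>\<^sup>+y. g (\<lambda>r\<in>I. if r \<in> J then z r else y r) \<partial>Pi\<^sub>M (I - J) (\<lambda>_. \<mu>)) \<le> 1"
  defines "m \<equiv> of_nat (card B ^ card I) * (\<integral>\<^sup>+y. g y \<partial>Pi\<^sub>M I (\<lambda>_. \<mu>))"
  shows "(\<integral>\<^sup>+x. (\<Sum>i\<in>I \<rightarrow>\<^sub>E B. g (\<lambda>r\<in>I. x (r, i r))) \<partial>Pi\<^sub>M (I \<times> B) (\<lambda>_. \<mu>)) = m" (is "?E1 = m")
    and "(\<integral>\<^sup>+x. (\<Sum>i\<in>I \<rightarrow>\<^sub>E B. g (\<lambda>r\<in>I. x (r, i r)))\<^sup>2 \<partial>Pi\<^sub>M (I \<times> B) (\<lambda>_. \<mu>)) \<le> m * (m + 2 ^ card I)" (is "?E2 \<le> _")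
proof -
  interpret prob_space \<mu> by fact
  interpret product_prob_space "\<lambda>_. \<mu>" UNIV by unfold_locales
  let ?P = "\<lambda>V. Pi\<^sub>M V (\<lambda>_. \<mu>)" and ?Q = "Pi\<^sub>M (I \<times> B) (\<lambda>_. \<mu>)" and ?N = "card B"
  define e where "e = (\<integral>\<^sup>+y. g y \<partial>?P I)"
  define G where "G i x = g (\<lambda>r\<in>I. x (r, i r))" for i :: "'i \<Rightarrow> 'b" and x
  have G_meas: "G i \<in> borel_measurable (?P V)" if "(\<lambda>r. (r, i r)) ` I \<subseteq> V" for i V
    unfolding G_def using that by (intro measurable_compose[OF measurable_reindex g])
  have fin: "finite (I \<rightarrow>\<^sub>E B)" using assms by (intro finite_PiE) auto
  have cardF: "card (I \<rightarrow>\<^sub>E B) = ?N ^ card I" using assms by (simp add: card_funcsetE)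
  have N0: "?N > 0" using assms by (simp add: card_gt_0_iff)
  have Gint: "(\<integral>\<^sup>+x. G i x \<partial>?P V) = e" if "(\<lambda>r. (r, i r)) ` I \<subseteq> V" for i V
    unfolding G_def e_def using that by (intro nn_integral_reindex assms(1) g) (auto intro: inj_onI)
  have sub: "(\<lambda>r. (r, i r)) ` I \<subseteq> I \<times> B" if "i \<in> I \<rightarrow>\<^sub>E B" for i
    using that by auto
  show "?E1 = m"
  proof -
    have "?E1 = (\<Sum>i\<in>I \<rightarrow>\<^sub>E B. \<integral>\<^sup>+x. G i x \<partial>?Q)"
      unfolding G_def[symmetric] by (intro nn_integral_sum G_meas sub)
    also have "\<dots> = (\<Sum>i\<in>I \<rightarrow>\<^sub>E B. e)" by (intro sum.cong refl Gint sub)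
    finally show ?thesis by (simp add: cardF m_def e_def)
  qed
  define co where "co i i' = {r\<in>I. i r = i' r}" for i i' :: "'i \<Rightarrow> 'b"
  \<comment> \<open>integrate out the sites that occur in \<open>i'\<close> only\<close>
  have pair: "(\<integral>\<^sup>+x. G i x * G i' x \<partial>?Q)
      = (\<integral>\<^sup>+x. G i x * (\<integral>\<^sup>+y. g (\<lambda>r\<in>I. if r \<in> J then x (r, i r) else y r) \<partial>?P (I - J)) \<partial>?P (I \<times> B - (\<lambda>r. (r, i' r)) ` (I - J)))"
    if i: "i \<in> I \<rightarrow>\<^sub>E B" "i' \<in> I \<rightarrow>\<^sub>E B" and J: "J = co i i'" for i i' J
  proof -
    define K where "K = (\<lambda>r. (r, i' r)) ` (I - J)"
    define L where "L = I \<times> B - K"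
    have KL: "K \<inter> L = {}" "L \<inter> K = {}" "L \<union> K = I \<times> B" "finite K" "finite L"
      using i assms(2,3) by (auto simp: K_def L_def)
    have merge: "G i (merge L K (x, y)) * G i' (merge L K (x, y))
        = G i x * g (\<lambda>r\<in>I. if r \<in> J then x (r, i r) else y (r, i' r))" for x y
    proof -
      have a: "(r, i r) \<in> L" if "r \<in> I" for r
        using that i J by (auto simp: L_def K_def co_def)
      have b: "(r, i' r) \<in> K \<longleftrightarrow> r \<notin> J" if "r \<in> I" for r
        using that by (auto simp: K_def)
      have c: "i' r = i r" if "r \<in> J" for r using that J by (simp add: co_def)
      have "(\<lambda>r\<in>I. merge L K (x, y) (r, i r)) = (\<lambda>r\<in>I. x (r, i r))"
        using a by (auto simp: merge_def fun_eq_iff)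
      moreover have "(\<lambda>r\<in>I. merge L K (x, y) (r, i' r)) = (\<lambda>r\<in>I. if r \<in> J then x (r, i r) else y (r, i' r))"
        using a b c KL(1) by (auto simp: merge_def fun_eq_iff)
      ultimately show ?thesis by (simp add: G_def)
    qed
    have [measurable]: "(\<lambda>x. G i x * G i' x) \<in> borel_measurable ?Q"
      using G_meas[OF sub[OF i(1)]] G_meas[OF sub[OF i(2)]] by measurable
    have "(\<integral>\<^sup>+x. G i x * G i' x \<partial>?Q) = (\<integral>\<^sup>+x. G i x * G i' x \<partial>?P (L \<union> K))"
      by (simp add: KL)
    also have "\<dots> = (\<integral>\<^sup>+x. \<integral>\<^sup>+y. G i (merge L K (x, y)) * G i' (merge L K (x, y)) \<partial>?P K \<partial>?P L)"
      using KL by (intro product_nn_integral_fold) auto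
    also have "\<dots> = (\<integral>\<^sup>+x. G i x * (\<integral>\<^sup>+y. g (\<lambda>r\<in>I. if r \<in> J then x (r, i r) else y r) \<partial>?P (I - J)) \<partial>?P L)"
    proof (intro nn_integral_cong)
      fix x assume x: "x \<in> space (?P L)"
      let ?h = "\<lambda>y. g (\<lambda>r\<in>I. if r \<in> J then x (r, i r) else y r)"
      have aL: "(r, i r) \<in> L" if "r \<in> I" for r
        using that i J by (auto simp: L_def K_def co_def)
      have h: "?h \<in> borel_measurable (?P (I - J))"
      proof (rule measurable_compose[OF _ g], rule measurable_restrict)
        fix r assume r: "r \<in> I"
        have "x (r, i r) \<in> space \<mu>" using x aL[OF r] by (auto simp: space_PiM)
        then show "(\<lambda>y. if r \<in> J then x (r, i r) else y r) \<in> ?P (I - J) \<rightarrow>\<^sub>M \<mu>"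
          using r by (cases "r \<in> J") (auto intro!: measurable_component_singleton)
      qed
      have "(\<integral>\<^sup>+y. G i (merge L K (x, y)) * G i' (merge L K (x, y)) \<partial>?P K)
          = (\<integral>\<^sup>+y. G i x * ?h (\<lambda>r\<in>I - J. y (r, i' r)) \<partial>?P K)"
        unfolding merge by (intro nn_integral_cong arg_cong2[where f="(*)"] arg_cong[where f=g] refl) (auto simp: fun_eq_iff)
      also have "\<dots> = G i x * (\<integral>\<^sup>+y. ?h (\<lambda>r\<in>I - J. y (r, i' r)) \<partial>?P K)"
        by (intro nn_integral_cmult measurable_compose[OF measurable_reindex h]) (auto simp: K_def)
      also have "(\<integral>\<^sup>+y. ?h (\<lambda>r\<in>I - J. y (r, i' r)) \<partial>?P K) = (\<integral>\<^sup>+y. ?h y \<partial>?P (I - J))"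
        by (intro nn_integral_reindex assms(1) h) (auto simp: K_def intro: inj_onI)
      finally show "(\<integral>\<^sup>+y. G i (merge L K (x, y)) * G i' (merge L K (x, y)) \<partial>?P K)
          = G i x * (\<integral>\<^sup>+y. ?h y \<partial>?P (I - J))" .
    qed
    finally show ?thesis unfolding K_def L_def .
  qed
  have far: "(\<integral>\<^sup>+x. G i x * G i' x \<partial>?Q) = e * e"
    if i: "i \<in> I \<rightarrow>\<^sub>E B" "i' \<in> I \<rightarrow>\<^sub>E B" and J: "co i i' = {}" for i i'
  proof -
    have sub': "(\<lambda>r. (r, i r)) ` I \<subseteq> I \<times> B - (\<lambda>r. (r, i' r)) ` I"
      using i J by (auto simp: co_def)
    have "(\<integral>\<^sup>+y. g (\<lambda>r\<in>I. y r) \<partial>?P I) = e"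
      unfolding e_def by (intro nn_integral_cong) (auto simp: space_PiM intro!: arg_cong[where f=g] extensional_restrict)
    then show ?thesis
      using pair[OF i J[symmetric]] Gint[OF sub'] G_meas[OF sub']
      by (simp add: nn_integral_multc)
  qed
  have near: "of_nat (?N ^ card (I - J)) * (\<integral>\<^sup>+x. G i x * G i' x \<partial>?Q) \<le> e"
    if i: "i \<in> I \<rightarrow>\<^sub>E B" "i' \<in> I \<rightarrow>\<^sub>E B" and J: "co i i' = J" "J \<noteq> {}" for i i' J
  proof -
    let ?L = "I \<times> B - (\<lambda>r. (r, i' r)) ` (I - J)"
    let ?c = "of_nat (?N ^ card (I - J)) :: ennreal"
    have sub': "(\<lambda>r. (r, i r)) ` I \<subseteq> ?L"
      using i J by (auto simp: co_def)
    have "?c * (\<integral>\<^sup>+x. G i x * G i' x \<partial>?Q)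
       \<le> (\<integral>\<^sup>+x. ?c * (G i x * (\<integral>\<^sup>+y. g (\<lambda>r\<in>I. if r \<in> J then x (r, i r) else y r) \<partial>?P (I - J))) \<partial>?P ?L)"
    proof -
      have "?c * (\<integral>\<^sup>+x. f x \<partial>?P ?L) \<le> (\<integral>\<^sup>+x. ?c * f x \<partial>?P ?L)" for f
        unfolding nn_integral_def SUP_mult_left_ennreal[OF ]
      proof (intro SUP_least)
        fix s assume s: "s \<in> {s. simple_function (?P ?L) s \<and> s \<le> f}"
        have "?c * integral\<^sup>S (?P ?L) s = integral\<^sup>S (?P ?L) (\<lambda>x. ?c * s x)"
          using s by (simp add: simple_integral_mult)
        also have "\<dots> \<le> (SUP s\<in>{s. simple_function (?P ?L) s \<and> s \<le> (\<lambda>x. ?c * f x)}. integral\<^sup>S (?P ?L) s)"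
          using s by (intro SUP_upper) (auto simp: le_fun_def intro!: mult_left_mono simple_function_mult)
        finally show "?c * integral\<^sup>S (?P ?L) s \<le> \<dots>" .
      qed
      then show ?thesis unfolding pair[OF i J(1)[symmetric]] .
    qed
    also have "\<dots> \<le> (\<integral>\<^sup>+x. G i x \<partial>?P ?L)"
    proof (intro nn_integral_mono)
      fix x assume x: "x \<in> space (?P ?L)"
      define z where "z = (\<lambda>r\<in>I. x (r, i r))"
      have z: "z \<in> space (?P I)" using measurable_space[OF measurable_reindex[OF sub'] x] by (simp add: z_def)
      have "?c * (\<integral>\<^sup>+y. g (\<lambda>r\<in>I. if r \<in> J then z r else y r) \<partial>?P (I - J)) \<le> 1"
        using J by (intro bound z) (auto simp: co_def)
      moreover have "(\<lambda>r\<in>I. if r \<in> J then z r else y r) = (\<lambda>r\<in>I. if r \<in> J then x (r, i r) else y r)" for y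
        by (auto simp: z_def)
      ultimately have "G i x * (?c * (\<integral>\<^sup>+y. g (\<lambda>r\<in>I. if r \<in> J then x (r, i r) else y r) \<partial>?P (I - J))) \<le> G i x * 1"
        by (intro mult_left_mono) auto
      then show "?c * (G i x * (\<integral>\<^sup>+y. g (\<lambda>r\<in>I. if r \<in> J then x (r, i r) else y r) \<partial>?P (I - J))) \<le> G i x"
        by (simp add: mult_ac)
    qed
    also have "\<dots> = e" by (rule Gint[OF sub'])
    finally show ?thesis .
  qed
  have row: "(\<Sum>i'\<in>I \<rightarrow>\<^sub>E B. \<integral>\<^sup>+x. G i x * G i' x \<partial>?Q) \<le> of_nat (?N ^ card I) * (e * e) + 2 ^ card I * e"
    if i: "i \<in> I \<rightarrow>\<^sub>E B" for i
  proof -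
    let ?t = "\<lambda>i'. \<integral>\<^sup>+x. G i x * G i' x \<partial>?Q"
    let ?S = "\<lambda>J. {i'\<in>I \<rightarrow>\<^sub>E B. co i i' = J}"
    have cardS: "card (?S J) \<le> ?N ^ card (I - J)" if J: "J \<subseteq> I" for J
    proof -
      have "card (?S J) \<le> card ((I - J) \<rightarrow>\<^sub>E B)"
      proof (rule card_inj_on_le[where f="\<lambda>i'. restrict i' (I - J)"])
        show "inj_on (\<lambda>i'. restrict i' (I - J)) (?S J)"
        proof (rule inj_onI)
          fix a b assume a: "a \<in> ?S J" and b: "b \<in> ?S J" and eq: "restrict a (I - J) = restrict b (I - J)"
          show "a = b"
          proof
            fix r
            consider "r \<notin> I" | "r \<in> J" | "r \<in> I - J" by blast
            then show "a r = b r"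
            proof cases
              case 1 then show ?thesis using a b by (auto simp: PiE_def extensional_def)
            next
              case 2
              then have "r \<in> co i a" "r \<in> co i b" using a b by auto
              then show ?thesis by (simp add: co_def)
            next
              case 3 then show ?thesis using fun_cong[OF eq, of r] by simp
            qed
          qed
        qed
        show "finite ((I - J) \<rightarrow>\<^sub>E B)" using assms by (intro finite_PiE) auto
      qed auto
      also have "\<dots> = ?N ^ card (I - J)" using assms(2) by (simp add: card_funcsetE)
      finally show ?thesis .
    qed
    have blk: "(\<Sum>i'\<in>?S J. ?t i') \<le> (if J = {} then of_nat (?N ^ card I) * (e * e) else e)" if J: "J \<subseteq> I" for J
    proof (cases "J = {}")
      case True
      have "(\<Sum>i'\<in>?S J. ?t i') = of_nat (card (?S J)) * (e * e)"
        using True i by (subst sum.cong[OF refl far]) auto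
      also have "\<dots> \<le> of_nat (?N ^ card I) * (e * e)"
        using cardS[OF J] True by (intro mult_right_mono of_nat_mono) auto
      finally show ?thesis using True by simp
    next
      case False
      let ?c = "of_nat (?N ^ card (I - J)) :: ennreal"
      have "?c * (\<Sum>i'\<in>?S J. ?t i') = (\<Sum>i'\<in>?S J. ?c * ?t i')" by (simp add: sum_distrib_left)
      also have "\<dots> \<le> (\<Sum>i'\<in>?S J. e)" using i False by (intro sum_mono near) auto
      also have "\<dots> = of_nat (card (?S J)) * e" by simp
      also have "\<dots> \<le> ?c * e" using cardS[OF J] by (intro mult_right_mono of_nat_mono) auto
      finally have "?c * (\<Sum>i'\<in>?S J. ?t i') \<le> ?c * e" .
      then have "(\<Sum>i'\<in>?S J. ?t i') \<le> e"
        using N0 by (subst (asm) ennreal_mult_le_mult_iff) (auto simp del: of_nat_power)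
      then show ?thesis using False by simp
    qed
    have "(\<Sum>i'\<in>I \<rightarrow>\<^sub>E B. ?t i') = (\<Sum>J\<in>Pow I. \<Sum>i'\<in>?S J. ?t i')"
      using fin assms(2) by (intro sum.group[symmetric]) (auto simp: co_def)
    also have "\<dots> \<le> (\<Sum>J\<in>Pow I. if J = {} then of_nat (?N ^ card I) * (e * e) else e)"
      by (intro sum_mono blk) auto
    also have "\<dots> \<le> (\<Sum>J\<in>Pow I. (if J = {} then of_nat (?N ^ card I) * (e * e) else 0) + e)"
      by (intro sum_mono) auto
    also have "\<dots> = of_nat (?N ^ card I) * (e * e) + 2 ^ card I * e"
      using assms(2) by (simp add: sum.distrib card_Pow)
    finally show ?thesis .
  qed
  have "?E2 = (\<integral>\<^sup>+x. (\<Sum>i\<in>I \<rightarrow>\<^sub>E B. \<Sum>i'\<in>I \<rightarrow>\<^sub>E B. G i x * G i' x) \<partial>?Q)"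
    by (simp add: G_def power2_eq_square sum_product)
  also have "\<dots> = (\<Sum>i\<in>I \<rightarrow>\<^sub>E B. \<Sum>i'\<in>I \<rightarrow>\<^sub>E B. \<integral>\<^sup>+x. G i x * G i' x \<partial>?Q)"
  proof -
    have [measurable]: "G i \<in> borel_measurable ?Q" if "i \<in> I \<rightarrow>\<^sub>E B" for i
      using that by (intro G_meas sub)
    show ?thesis by (simp add: nn_integral_sum)
  qed
  also have "\<dots> \<le> (\<Sum>i\<in>I \<rightarrow>\<^sub>E B. of_nat (?N ^ card I) * (e * e) + 2 ^ card I * e)"
    by (intro sum_mono row)
  also have "\<dots> = m * (m + 2 ^ card I)"
    by (simp add: cardF m_def e_def algebra_simps)
  finally show "?E2 \<le> m * (m + 2 ^ card I)" .
qed

section \<open>The truncation sets\<close>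

text \<open>Indices start at \<open>1\<close>, so \<open>1\<close> is kept as it is instead of being rewritten to \<open>Suc 0\<close>.\<close>

declare One_nat_def [simp del]

text \<open>The kernel \<open>h\<close> and the norming sequence \<open>\<gamma>\<close> over one probability law \<open>\<mu>\<close>.  Symmetry of \<open>h\<close> enters
  only when multiindices are sorted, so it is assumed there and not here.\<close>

locale kernel =
  fixes \<mu> :: "'e measure" and d :: nat and h :: "(nat \<Rightarrow> 'e) \<Rightarrow> real" and \<gamma> :: "nat \<Rightarrow> real" and C :: real
  assumes prob_\<mu>: "prob_space \<mu>"
    and d_pos: "d \<ge> 1"
    and h_meas [measurable]: "h \<in> borel_measurable (power_space d \<mu>)"
    and \<gamma>_pos: "\<And>n. n \<ge> 1 \<Longrightarrow> \<gamma> n > 0"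
    and \<gamma>_mono: "mono_on {1..} \<gamma>"
    and \<gamma>_doubling: "\<And>n. n \<ge> 1 \<Longrightarrow> \<gamma> (2 * n) \<le> C * \<gamma> n"
    and \<gamma>_tail: "\<And>l. l \<ge> 1 \<Longrightarrow>
          summable (\<lambda>k. 2 ^ (d * (l + k)) / (\<gamma> (2 ^ (l + k)))\<^sup>2) \<and>
          (\<Sum>k. 2 ^ (d * (l + k)) / (\<gamma> (2 ^ (l + k)))\<^sup>2) \<le> C * (2 ^ (d * l) / (\<gamma> (2 ^ l))\<^sup>2)"
begin

abbreviation D :: "nat set" where "D \<equiv> {1..d}"

abbreviation P :: "'v set \<Rightarrow> ('v \<Rightarrow> 'e) measure" where "P V \<equiv> Pi\<^sub>M V (\<lambda>_. \<mu>)"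

abbreviation A :: "nat \<Rightarrow> nat \<Rightarrow> (nat \<Rightarrow> 'e) set" where "A k l \<equiv> trunc_set d \<mu> \<mu> h \<gamma> k l"

abbreviation \<Gamma> :: "nat \<Rightarrow> real" where "\<Gamma> k \<equiv> \<gamma> (2 ^ k)"

text \<open>Squares are normalised by \<open>\<gamma>\<^sup>2\<close> from the start, so that all the truncation conditions read \<open>\<le> 1\<close>.\<close>

definition G :: "nat \<Rightarrow> (nat \<Rightarrow> 'e) set \<Rightarrow> (nat \<Rightarrow> 'e) \<Rightarrow> ennreal" where
  "G k S y = ennreal ((h y)\<^sup>2 / (\<Gamma> k)\<^sup>2) * indicator S y"

abbreviation EI :: "nat set \<Rightarrow> ((nat \<Rightarrow> 'e) \<Rightarrow> ennreal) \<Rightarrow> (nat \<Rightarrow> 'e) \<Rightarrow> ennreal" where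
  "EI \<equiv> partial_E d \<mu>"

lemma \<Gamma>_pos: "\<Gamma> k > 0"
  by (rule \<gamma>_pos) simp

lemma product_prob: "product_prob_space (\<lambda>_. \<mu>)"
proof -
  interpret prob_space \<mu> by (rule prob_\<mu>)
  show ?thesis by unfold_locales
qed

lemma prob_P: "prob_space (P V)"
  by (rule prob_space_PiM) (rule prob_\<mu>)

lemma measurable_merge_slice:
  assumes "I \<subseteq> D" "x \<in> space (P D)"
  shows "(\<lambda>y. merge I (D - I) (y, x)) \<in> P I \<rightarrow>\<^sub>M P D"
proof -
  have "(\<lambda>y. \<lambda>r\<in>D. if r \<in> I then y r else x r) \<in> P I \<rightarrow>\<^sub>M P D"
  proof (rule measurable_restrict)
    fix r assume "r \<in> D"
    then have "x r \<in> space \<mu>" using assms(2) by (auto simp: space_PiM)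
    then show "(\<lambda>y. if r \<in> I then y r else x r) \<in> P I \<rightarrow>\<^sub>M \<mu>"
      by (cases "r \<in> I") simp_all
  qed
  also have "(\<lambda>y. \<lambda>r\<in>D. if r \<in> I then y r else x r) = (\<lambda>y. merge I (D - I) (y, x))"
    using assms by (auto simp: merge_def fun_eq_iff)
  finally show ?thesis .
qed

lemma measurable_merge_pair:
  assumes "I \<subseteq> D"
  shows "(\<lambda>p. merge I (D - I) (snd p, fst p)) \<in> P D \<Otimes>\<^sub>M P I \<rightarrow>\<^sub>M P D"
proof -
  have "(\<lambda>p. \<lambda>r\<in>D. if r \<in> I then snd p r else fst p r) \<in> P D \<Otimes>\<^sub>M P I \<rightarrow>\<^sub>M P D"
  proof (rule measurable_restrict)
    fix r assume "r \<in> D"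
    then show "(\<lambda>p. if r \<in> I then snd p r else fst p r) \<in> P D \<Otimes>\<^sub>M P I \<rightarrow>\<^sub>M \<mu>"
      by (cases "r \<in> I") simp_all
  qed
  also have "(\<lambda>p. \<lambda>r\<in>D. if r \<in> I then snd p r else fst p r) = (\<lambda>p. merge I (D - I) (snd p, fst p))"
    using assms by (auto simp: merge_def fun_eq_iff)
  finally show ?thesis .
qed

lemma measurable_EI:
  assumes "I \<subseteq> D" "g \<in> borel_measurable (P D)"
  shows "EI I g \<in> borel_measurable (P D)"
proof -
  interpret prob_space "P I" by (rule prob_P)
  have "(\<lambda>p. g (merge I (D - I) (snd p, fst p))) \<in> borel_measurable (P D \<Otimes>\<^sub>M P I)"
    by (rule measurable_compose[OF measurable_merge_pair assms(2)]) (rule assms)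
  then have "(\<lambda>(x, y). g (merge I (D - I) (y, x))) \<in> borel_measurable (P D \<Otimes>\<^sub>M P I)"
    by (simp add: case_prod_unfold)
  then show ?thesis
    unfolding partial_E_def[abs_def] by (rule borel_measurable_nn_integral)
qed

lemma measurable_G [measurable (raw)]:
  "S \<in> sets (P D) \<Longrightarrow> G k S \<in> borel_measurable (P D)"
  unfolding G_def[abs_def]
  by (intro borel_measurable_times_ennreal borel_measurable_indicator) measurable

lemma EI_cmult:
  assumes "I \<subseteq> D" "x \<in> space (P D)" "g \<in> borel_measurable (P D)"
  shows "EI I (\<lambda>y. c * g y) x = c * EI I g x"
  unfolding partial_E_def
  by (rule nn_integral_cmult) (rule measurable_compose[OF measurable_merge_slice[OF assms(1,2)] assms(3)])

lemma EI_mono: "(\<And>y. g y \<le> g' y) \<Longrightarrow> EI I g x \<le> EI I g' x"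
  unfolding partial_E_def by (intro nn_integral_mono) auto

lemma merge_space:
  assumes "I \<subseteq> D" "y \<in> space (P I)" "x \<in> space (P D)"
  shows "merge I (D - I) (y, x) \<in> space (P D)"
  using measurable_space[OF measurable_merge_slice[OF assms(1,3)] assms(2)] .

lemma EI_cong_outside:
  assumes "\<And>r. r \<in> D - I \<Longrightarrow> x r = x' r"
  shows "EI I g x = EI I g x'"
proof -
  have "merge I (D - I) (y, x) = merge I (D - I) (y, x')" for y
    using assms by (auto simp: merge_def fun_eq_iff)
  then show ?thesis by (simp add: partial_E_def)
qed

lemma EI_empty:
  assumes "x \<in> space (P D)"
  shows "EI {} g x = g x"
proof -
  have "merge {} (D - {}) (y, x) = x" for y
    using assms by (auto simp: merge_def fun_eq_iff space_PiM PiE_def extensional_def)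
  then show ?thesis
    using prob_space.emeasure_space_1[OF prob_P[of "{} :: nat set"]] by (simp add: partial_E_def)
qed

lemma A_subset_space: "A k l \<subseteq> space (P D)"
proof (induction l)
  case (Suc l)
  then show ?case by (cases l) auto
qed simp

lemma G_cmult: "ennreal ((h y)\<^sup>2) * indicator S y = ennreal ((\<Gamma> k)\<^sup>2) * G k S y"
  using \<Gamma>_pos[of k] by (simp add: G_def mult.assoc[symmetric] ennreal_mult[symmetric])

text \<open>The level-zero filler of the truncation sets is the whole space, and averaging over no coordinate is
  evaluation.  The condition \<open>h\<^sup>2 \<le> \<gamma>\<^sup>2\<close> of level one is therefore the case \<open>l = 0\<close> of the general recursion,
  which removes a case distinction from everything below.\<close>

lemma A_Suc_sets:
  assumes "A k l \<in> sets (P D)"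
  shows "A k (Suc l) = {x\<in>A k l. \<forall>I. I \<subseteq> D \<and> card I = l \<longrightarrow> 2 ^ (k * l) * EI I (G k (A k l)) x \<le> 1}"
proof -
  have scale: "2 ^ (k * n) * EI I (\<lambda>y. ennreal ((h y)\<^sup>2) * indicator (A k l) y) x \<le> ennreal ((\<Gamma> k)\<^sup>2)
      \<longleftrightarrow> 2 ^ (k * n) * EI I (G k (A k l)) x \<le> 1" if "I \<subseteq> D" "x \<in> space (P D)" for I x n
  proof -
    have "2 ^ (k * n) * EI I (\<lambda>y. ennreal ((h y)\<^sup>2) * indicator (A k l) y) x
        = ennreal ((\<Gamma> k)\<^sup>2) * (2 ^ (k * n) * EI I (G k (A k l)) x)"
      unfolding G_cmult[of _ _ k] using that assms by (subst EI_cmult) (auto simp: mult_ac)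
    then show ?thesis
      using ennreal_mult_le_mult_iff[of "ennreal ((\<Gamma> k)\<^sup>2)" "2 ^ (k * n) * EI I (G k (A k l)) x" 1] \<Gamma>_pos[of k]
      by simp
  qed
  show ?thesis
  proof (cases l)
    case 0
    have "(\<forall>I. I \<subseteq> D \<and> card I = 0 \<longrightarrow> 2 ^ (k * 0) * EI I (G k (A k 0)) x \<le> 1) \<longleftrightarrow> (h x)\<^sup>2 \<le> (\<Gamma> k)\<^sup>2"
      if x: "x \<in> space (P D)" for x
    proof -
      have "(\<forall>I. I \<subseteq> D \<and> card I = 0 \<longrightarrow> 2 ^ (k * 0) * EI I (G k (A k 0)) x \<le> 1)
          \<longleftrightarrow> 2 ^ (k * 0) * EI {} (G k (A k 0)) x \<le> 1"
        by (auto simp: card_eq_0_iff dest: finite_subset[of _ D])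
      also have "\<dots> \<longleftrightarrow> 2 ^ (k * 0) * EI {} (\<lambda>y. ennreal ((h y)\<^sup>2) * indicator (A k 0) y) x \<le> ennreal ((\<Gamma> k)\<^sup>2)"
        using scale[of "{}" x 0] x 0 by simp
      also have "\<dots> \<longleftrightarrow> (h x)\<^sup>2 \<le> (\<Gamma> k)\<^sup>2"
        unfolding EI_empty[OF x] using x by simp
      finally show ?thesis .
    qed
    then show ?thesis using 0 by auto
  next
    case (Suc m)
    have "x \<in> space (P D)" if "x \<in> A k l" for x using that A_subset_space by auto
    then show ?thesis
      unfolding Suc trunc_set.simps(3)[of d \<mu> \<mu> h \<gamma> k m]
      using scale[of _ _ "Suc m"] Suc by (intro Collect_cong) auto
  qed
qed

lemma sets_A [measurable]: "A k l \<in> sets (P D)"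
proof (induction l)
  case (Suc l)
  note [measurable] = Suc
  have fin: "finite {I. I \<subseteq> D \<and> card I = l}" by (rule finite_subset[of _ "Pow D"]) auto
  have [measurable]: "EI I (G k (A k l)) \<in> borel_measurable (P D)" if "I \<in> {I. I \<subseteq> D \<and> card I = l}" for I
    using that Suc by (intro measurable_EI) auto
  have "A k (Suc l) = A k l \<inter> {x\<in>space (P D). \<forall>I\<in>{I. I \<subseteq> D \<and> card I = l}. 2 ^ (k * l) * EI I (G k (A k l)) x \<le> 1}"
    unfolding A_Suc_sets[OF Suc] using A_subset_space[of k l] by auto
  also have "\<dots> \<in> sets (P D)"
    using fin by (intro sets.Int Suc sets.sets_Collect_finite_All) auto
  finally show ?case .
qed simp

lemmas A_Suc = A_Suc_sets[OF sets_A]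

lemma A_antimono: "l \<le> m \<Longrightarrow> A k m \<subseteq> A k l"
proof (induction m rule: dec_induct)
  case (step m)
  then show ?case unfolding A_Suc[of k m] by auto
qed simp

text \<open>The condition defining the sets \<open>A k l\<close> is imposed at points of the set, but the bound holds
  everywhere: if the fibre over \<open>x\<close> meets \<open>S\<close>, evaluate at a point of the fibre, since the average does not see
  the coordinates in \<open>I\<close>; otherwise the average is zero.\<close>

lemma EI_G_bound:
  assumes S: "S \<subseteq> A k m" and I: "I \<subseteq> D" "card I < m" and x: "x \<in> space (P D)"
  shows "2 ^ (k * card I) * EI I (G k S) x \<le> 1"
proof (cases "\<exists>y\<in>space (P I). merge I (D - I) (y, x) \<in> S")
  case True
  then obtain y where y: "y \<in> space (P I)" "merge I (D - I) (y, x) \<in> S" by blast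
  let ?z = "merge I (D - I) (y, x)"
  have z: "?z \<in> A k (Suc (card I))" using y S A_antimono[of "Suc (card I)" m k] I by auto
  have mono: "G k S u \<le> G k (A k (card I)) u" for u
    using S A_antimono[of "card I" m k] I by (auto simp: G_def indicator_def intro!: mult_left_mono)
  have "2 ^ (k * card I) * EI I (G k S) x \<le> 2 ^ (k * card I) * EI I (G k (A k (card I))) x"
    by (intro mult_left_mono EI_mono mono) auto
  also have "EI I (G k (A k (card I))) x = EI I (G k (A k (card I))) ?z"
    by (intro EI_cong_outside) (auto simp: merge_def)
  also have "2 ^ (k * card I) * \<dots> \<le> 1"
    using z I unfolding A_Suc by auto
  finally show ?thesis .
next
  case False
  then have "EI I (G k S) x = (\<integral>\<^sup>+y. 0 \<partial>P I)"
    unfolding partial_E_def by (intro nn_integral_cong) (auto simp: G_def)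
  then show ?thesis by simp
qed

text \<open>The points at which truncation fails because the average over the coordinates \<open>I\<close> is too large.\<close>

definition bad :: "nat \<Rightarrow> nat set \<Rightarrow> (nat \<Rightarrow> 'e) set" where
  "bad k I = {x\<in>space (P D). 1 < 2 ^ (k * card I) * EI I (G k (A k (card I))) x}"

lemma not_A_imp_bad:
  assumes "x \<in> space (P D)" "x \<notin> A k d"
  shows "\<exists>I\<subseteq>D. card I < d \<and> x \<in> bad k I"
proof -
  have "\<exists>I\<subseteq>D. card I < l \<and> x \<in> bad k I" if "x \<notin> A k l" for l
    using that
  proof (induction l)
    case 0 then show ?case using assms(1) by simp
  next
    case (Suc l)
    show ?case
    proof (cases "x \<in> A k l")
      case True
      then obtain I where "I \<subseteq> D" "card I = l" "\<not> 2 ^ (k * l) * EI I (G k (A k l)) x \<le> 1"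
        using Suc.prems unfolding A_Suc[of k l] by blast
      then have "x \<in> bad k I" using assms(1) by (auto simp: bad_def not_le)
      then show ?thesis using \<open>I \<subseteq> D\<close> \<open>card I = l\<close> by blast
    next
      case False
      then show ?thesis using Suc.IH less_SucI by blast
    qed
  qed
  then show ?thesis using assms by blast
qed

text \<open>Freeze the coordinates outside \<open>I\<close> at those of \<open>z\<close>.  The remaining function of the coordinates in \<open>I\<close>
  satisfies the hypothesis of the second moment bound, because only averages over fewer than
  \<open>card I\<close> coordinates occur there.\<close>

lemma slice_sum_lower_tail:
  fixes B :: "'b set"
  assumes k: "B \<noteq> {}" "finite B" "card B \<le> 2 ^ k" and I: "I \<subseteq> D" and S: "S \<in> sets (P D)" "S \<subseteq> A k (card I)"
    and z: "z \<in> space (P D)"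
    and m: "ennreal m = of_nat (card B ^ card I) * EI I (G k S) z" "m \<ge> 0"
  shows "m \<le> 4 * (m + 2 ^ card I) * measure (P (I \<times> B))
      {x\<in>space (P (I \<times> B)). ennreal (m / 2) \<le> (\<Sum>i\<in>I \<rightarrow>\<^sub>E B. G k S (merge I (D - I) (\<lambda>r\<in>I. x (r, i r), z)))}"
proof -
  let ?g = "\<lambda>y. G k S (merge I (D - I) (y, z))"
  have fI: "finite I" using I finite_subset by blast
  have g: "?g \<in> borel_measurable (P I)"
    by (rule measurable_compose[OF measurable_merge_slice[OF I z] measurable_G[OF S(1)]])
  have bound: "of_nat (card B ^ card (I - J)) * (\<integral>\<^sup>+y. ?g (\<lambda>r\<in>I. if r \<in> J then w r else y r) \<partial>P (I - J)) \<le> 1"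
    if J: "J \<subseteq> I" "J \<noteq> {}" and w: "w \<in> space (P I)" for J w
  proof -
    have less: "card (I - J) < card I" using J fI by (intro psubset_card_mono) auto
    have eq: "merge I (D - I) (\<lambda>r\<in>I. if r \<in> J then w r else y r, z)
        = merge (I - J) (D - (I - J)) (y, merge I (D - I) (w, z))" for y
      using J I by (auto simp: merge_def fun_eq_iff)
    have "of_nat (card B ^ card (I - J)) \<le> (2 ^ (k * card (I - J)) :: ennreal)"
    proof -
      have "card B ^ card (I - J) \<le> (2 ^ k) ^ card (I - J)" using k by (intro power_mono) auto
      then have "(of_nat (card B ^ card (I - J)) :: ennreal) \<le> of_nat ((2 ^ k) ^ card (I - J))"
        by (rule of_nat_mono)
      then show ?thesis by (simp add: power_mult)
    qed
    then have "of_nat (card B ^ card (I - J)) * (\<integral>\<^sup>+y. ?g (\<lambda>r\<in>I. if r \<in> J then w r else y r) \<partial>P (I - J))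
        \<le> 2 ^ (k * card (I - J)) * EI (I - J) (G k S) (merge I (D - I) (w, z))"
      unfolding eq partial_E_def by (intro mult_right_mono) auto
    also have "\<dots> \<le> 1"
      using I less w z by (intro EI_G_bound[OF S(2)] merge_space) auto
    finally show ?thesis .
  qed
  have W: "(\<lambda>x. \<Sum>i\<in>I \<rightarrow>\<^sub>E B. ?g (\<lambda>r\<in>I. x (r, i r))) \<in> borel_measurable (P (I \<times> B))"
  proof (intro borel_measurable_sum)
    fix i assume i: "i \<in> I \<rightarrow>\<^sub>E B"
    then have "(\<lambda>r. (r, i r)) ` I \<subseteq> I \<times> B" by auto
    from measurable_compose[OF measurable_reindex[OF this] g]
    show "(\<lambda>x. ?g (\<lambda>r\<in>I. x (r, i r))) \<in> borel_measurable (P (I \<times> B))" .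
  qed
  note sm = second_moment_decoupled_sum[OF prob_\<mu> fI k(2) k(1) g bound]
  have mm: "of_nat (card B ^ card I) * (\<integral>\<^sup>+y. ?g y \<partial>P I) = ennreal m"
    using m by (simp add: partial_E_def)
  have pw: "ennreal m * (ennreal m + 2 ^ card I) = ennreal (m * (m + 2 ^ card I))"
  proof -
    have "(2::ennreal) ^ card I = ennreal (2 ^ card I)" using ennreal_power[of 2 "card I"] by simp
    moreover have "ennreal (m * (m + 2 ^ card I)) = ennreal m * ennreal (m + 2 ^ card I)"
      using m by (intro ennreal_mult) auto
    moreover have "ennreal (m + 2 ^ card I) = ennreal m + ennreal (2 ^ card I)"
      using m by (intro ennreal_plus) auto
    ultimately show ?thesis by (simp only:)
  qed
  show ?thesis
    by (rule paley_zygmund[OF prob_P W sm(1)[unfolded mm] m(2) _ sm(2)[unfolded mm pw]])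
       (use m(2) in \<open>auto intro: add_nonneg_pos\<close>)
qed

end

section \<open>Comparing coupled and decoupled hitting probabilities\<close>

context kernel
begin

definition pick :: "(nat \<Rightarrow> 'v) \<Rightarrow> ('v \<Rightarrow> 'e) \<Rightarrow> nat \<Rightarrow> 'e" where
  "pick u x = (\<lambda>r\<in>D. x (u r))"

text \<open>The sites \<open>V\<close> carry i.i.d. points and a multiindex is a map from coordinates to sites.  The single
  sequence is \<open>V = {1..}\<close>; the decoupled copies are \<open>V = D \<times> {1..}\<close>, where coordinate \<open>r\<close> only
  uses sites of the form \<open>(r, j)\<close>.\<close>

definition hit :: "'v set \<Rightarrow> (nat \<Rightarrow> 'v) set \<Rightarrow> (nat \<Rightarrow> 'e) set \<Rightarrow> real" where
  "hit V U S = measure (P V) {x\<in>space (P V). \<exists>u\<in>U. pick u x \<in> S}"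

definition dec :: "nat \<Rightarrow> (nat \<Rightarrow> nat \<times> nat) set" where
  "dec n = (\<lambda>i r. (r, i r)) ` all_idx d n"

lemma pick_measurable:
  "u ` D \<subseteq> V \<Longrightarrow> pick u \<in> P V \<rightarrow>\<^sub>M P D"
  unfolding pick_def[abs_def] by (rule measurable_reindex)

lemma pick_space:
  "u ` D \<subseteq> V \<Longrightarrow> x \<in> space (P V) \<Longrightarrow> pick u x \<in> space (P D)"
  using measurable_space[OF pick_measurable] .

lemma hit_event:
  assumes "finite U" "\<And>u. u \<in> U \<Longrightarrow> u ` D \<subseteq> V" "S \<in> sets (P D)"
  shows "{x\<in>space (P V). \<exists>u\<in>U. pick u x \<in> S} \<in> sets (P V)"
proof (intro sets.sets_Collect_finite_Ex assms(1))
  fix u assume "u \<in> U"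
  then have [measurable]: "pick u \<in> P V \<rightarrow>\<^sub>M P D" using assms(2) by (intro pick_measurable) auto
  show "{x\<in>space (P V). pick u x \<in> S} \<in> sets (P V)" using assms(3) by measurable
qed

lemma hit_nonneg: "hit V U S \<ge> 0"
  by (simp add: hit_def)

lemma hit_mono:
  assumes "\<And>u. u \<in> U \<Longrightarrow> \<exists>u'\<in>U'. \<forall>r\<in>D. u r = u' r"
    and "finite U'" "\<And>u. u \<in> U' \<Longrightarrow> u ` D \<subseteq> V" "S \<in> sets (P D)" "S \<subseteq> S'" "S' \<in> sets (P D)"
  shows "hit V U S \<le> hit V U' S'"
proof -
  interpret prob_space "P V" by (rule prob_P)
  show ?thesis unfolding hit_def
  proof (intro finite_measure_mono hit_event assms)
    show "{x\<in>space (P V). \<exists>u\<in>U. pick u x \<in> S} \<subseteq> {x\<in>space (P V). \<exists>u\<in>U'. pick u x \<in> S'}"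
    proof safe
      fix x u assume x: "x \<in> space (P V)" and u: "u \<in> U" "pick u x \<in> S"
      then obtain u' where u': "u' \<in> U'" "\<forall>r\<in>D. u r = u' r" using assms(1) by blast
      then have "pick u x = pick u' x" by (auto simp: pick_def)
      then show "\<exists>u\<in>U'. pick u x \<in> S'" using u u' assms(5) by auto
    qed
  qed
qed

lemma hit_image:
  assumes "inj_on \<phi> V" "\<phi> ` V \<subseteq> V'" "finite U" "\<And>u. u \<in> U \<Longrightarrow> u ` D \<subseteq> V" "S \<in> sets (P D)"
  shows "hit V' ((\<circ>) \<phi> ` U) S = hit V U S"
proof -
  let ?\<pi> = "\<lambda>x. \<lambda>v\<in>V. x (\<phi> v)"
  have pick: "pick u (?\<pi> x) = pick (\<phi> \<circ> u) x" if "u \<in> U" for u x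
    using assms(4)[OF that] by (auto simp: pick_def fun_eq_iff image_subset_iff)
  have sp: "?\<pi> x \<in> space (P V)" if "x \<in> space (P V')" for x
    using measurable_space[OF measurable_reindex[OF assms(2)] that] .
  have "hit V U S = measure (distr (P V') (P V) ?\<pi>) {x\<in>space (P V). \<exists>u\<in>U. pick u x \<in> S}"
    unfolding hit_def PiM_reindex[OF prob_\<mu> assms(1,2)] ..
  also have "\<dots> = measure (P V') (?\<pi> -` {x\<in>space (P V). \<exists>u\<in>U. pick u x \<in> S} \<inter> space (P V'))"
    using assms by (intro measure_distr measurable_reindex hit_event) auto
  also have "?\<pi> -` {x\<in>space (P V). \<exists>u\<in>U. pick u x \<in> S} \<inter> space (P V')
      = {x\<in>space (P V'). \<exists>u\<in>(\<circ>) \<phi> ` U. pick u x \<in> S}"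
    using sp pick by auto
  finally show ?thesis by (simp add: hit_def)
qed

lemma hit_sub:
  assumes "V \<subseteq> V'" "finite U" "\<And>u. u \<in> U \<Longrightarrow> u ` D \<subseteq> V" "S \<in> sets (P D)"
  shows "hit V' U S = hit V U S"
proof -
  have "(\<circ>) id ` U = U" by auto
  then show ?thesis using hit_image[of id V V' U S] assms by auto
qed

lemma hit_UN_le:
  assumes "finite K" "\<And>t. t \<in> K \<Longrightarrow> finite (U t)" "\<And>t u. t \<in> K \<Longrightarrow> u \<in> U t \<Longrightarrow> u ` D \<subseteq> V" "S \<in> sets (P D)"
  shows "hit V (\<Union>t\<in>K. U t) S \<le> (\<Sum>t\<in>K. hit V (U t) S)"
proof -
  interpret prob_space "P V" by (rule prob_P)
  have eq: "{x\<in>space (P V). \<exists>u\<in>(\<Union>t\<in>K. U t). pick u x \<in> S} = (\<Union>t\<in>K. {x\<in>space (P V). \<exists>u\<in>U t. pick u x \<in> S})"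
    by auto
  show ?thesis unfolding hit_def eq
    using hit_event[OF assms(2) assms(3) assms(4)] assms(1) by (intro finite_measure_subadditive_finite) auto
qed

lemma finite_all_idx [simp]: "finite (all_idx d n)"
  by (simp add: all_idx_def finite_PiE)

lemma finite_incr_idx [simp]: "finite (incr_idx d n)"
  by (rule finite_subset[OF _ finite_all_idx[of n]]) (auto simp: incr_idx_def all_idx_def)

lemma finite_dec [simp]: "finite (dec n)"
  by (simp add: dec_def)

lemma dec_sites: "u \<in> dec n \<Longrightarrow> u ` D \<subseteq> D \<times> {1..n}"
  by (auto simp: dec_def all_idx_def PiE_iff)

lemma dec_sites': "u \<in> dec n \<Longrightarrow> u ` D \<subseteq> D \<times> {1..}"
  by (auto simp: dec_def all_idx_def PiE_iff)

lemma incr_sites: "i \<in> incr_idx d n \<Longrightarrow> i ` D \<subseteq> {1..n}"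
  by (auto simp: incr_idx_def PiE_iff)

lemma incr_sites': "i \<in> incr_idx d n \<Longrightarrow> i ` D \<subseteq> {1..}"
  using incr_sites by fastforce

lemma incr_inj: "i \<in> incr_idx d n \<Longrightarrow> inj_on i D"
  by (auto simp: incr_idx_def intro: strict_mono_on_imp_inj_on)

text \<open>Cut the cube of side \<open>L * m\<close> into \<open>L ^ d\<close> translates of the cube of side \<open>m\<close>; each of them has the
  same hitting probability.\<close>

lemma hit_dec_scale:
  assumes "m \<ge> 1" and S: "S \<in> sets (P D)"
  shows "hit (D \<times> {1..}) (dec (L * m)) S \<le> real L ^ d * hit (D \<times> {1..}) (dec m) S"
proof -
  let ?K = "D \<rightarrow>\<^sub>E {..<L}"
  define \<phi> where "\<phi> t = (\<lambda>(r, j). (r, t r * m + j))" for t :: "nat \<Rightarrow> nat"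
  let ?U = "\<lambda>t. (\<circ>) (\<phi> t) ` dec m"
  have finK: "finite ?K" by (simp add: finite_PiE)
  have same: "hit (D \<times> {1..}) (?U t) S = hit (D \<times> {1..}) (dec m) S" for t
  proof (rule hit_image)
    show "\<phi> t ` (D \<times> {1..}) \<subseteq> D \<times> {1..}" by (auto simp: \<phi>_def)
    show "inj_on (\<phi> t) (D \<times> {1..})" by (auto simp: \<phi>_def inj_on_def)
  qed (use S dec_sites' in auto)
  have "hit (D \<times> {1..}) (dec (L * m)) S \<le> hit (D \<times> {1..}) (\<Union>t\<in>?K. ?U t) S"
  proof (rule hit_mono)
    fix u assume "u \<in> dec (L * m)"
    then obtain i where u: "u = (\<lambda>r. (r, i r))" and i: "i \<in> all_idx d (L * m)" by (auto simp: dec_def)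
    define t where "t = (\<lambda>r\<in>D. (i r - 1) div m)"
    define j where "j = (\<lambda>r\<in>D. (i r - 1) mod m + 1)"
    have ir: "1 \<le> i r \<and> i r \<le> L * m" if "r \<in> D" for r using i that by (auto simp: all_idx_def PiE_iff)
    have "t \<in> ?K"
    proof -
      have "(i r - 1) div m < L" if "r \<in> D" for r
        using ir[OF that] assms(1) by (auto simp: less_mult_imp_div_less)
      then show ?thesis by (auto simp: t_def)
    qed
    moreover have "j \<in> all_idx d m"
    proof -
      have "a mod m + 1 \<le> m" for a using assms(1) mod_less_divisor[of m a] by linarith
      then show ?thesis by (auto simp: j_def all_idx_def)
    qed
    moreover have "\<forall>r\<in>D. u r = (\<phi> t \<circ> (\<lambda>r. (r, j r))) r"
    proof
      fix r assume r: "r \<in> D"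
      have "t r * m + j r = i r" using ir[OF r] r by (simp add: t_def j_def)
      then show "u r = (\<phi> t \<circ> (\<lambda>r. (r, j r))) r" by (simp add: u \<phi>_def)
    qed
    ultimately show "\<exists>u'\<in>(\<Union>t\<in>?K. ?U t). \<forall>r\<in>D. u r = u' r"
      unfolding dec_def by blast
  next
    fix u assume "u \<in> (\<Union>t\<in>?K. ?U t)"
    then show "u ` D \<subseteq> D \<times> {1..}" using dec_sites' by (fastforce simp: \<phi>_def)
  qed (use S finK in auto)
  also have "\<dots> \<le> (\<Sum>t\<in>?K. hit (D \<times> {1..}) (?U t) S)"
  proof (rule hit_UN_le)
    fix t u assume "u \<in> ?U t"
    then show "u ` D \<subseteq> D \<times> {1..}" using dec_sites' by (fastforce simp: \<phi>_def)
  qed (use S finK in auto)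
  also have "\<dots> = real L ^ d * hit (D \<times> {1..}) (dec m) S"
    unfolding same by (simp add: card_funcsetE)
  finally show ?thesis .
qed

text \<open>Lay the \<open>d\<close> copies of length \<open>m\<close> side by side as consecutive blocks of one sequence.  Picking one index
  from each block, in order, gives an increasing multiindex.\<close>

lemma hit_dec_le_incr:
  assumes S: "S \<in> sets (P D)"
  shows "hit (D \<times> {1..}) (dec m) S \<le> hit {1..} (incr_idx d (d * m)) S"
proof -
  define \<phi> where "\<phi> = (\<lambda>(r, j). (r - 1) * m + j)"
  have val: "1 \<le> \<phi> (r, j) \<and> \<phi> (r, j) \<le> d * m" if "r \<in> D" "j \<in> {1..m}" for r j
  proof -
    have "r - 1 \<le> d - 1" using that by auto
    then have "(r - 1) * m + j \<le> (d - 1) * m + m" using that by (intro add_mono mult_right_mono) auto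
    also have "\<dots> = d * m" using d_pos by (simp add: algebra_simps)
    finally show ?thesis using that by (auto simp: \<phi>_def)
  qed
  have less: "\<phi> (r, j) < \<phi> (r', j')" if "r \<in> D" "r' \<in> D" "r < r'" "j \<in> {1..m}" "j' \<in> {1..m}" for r r' j j'
  proof -
    have "(r - 1) * m + j \<le> (r - 1) * m + m" using that by auto
    also have "\<dots> = r * m" using that by (cases r) auto
    also have "\<dots> \<le> (r' - 1) * m" using that by (intro mult_right_mono) auto
    finally show ?thesis using that by (auto simp: \<phi>_def)
  qed
  have inj: "inj_on \<phi> (D \<times> {1..m})"
  proof (rule inj_onI, clarify)
    fix r j r' j' assume a: "r \<in> D" "r' \<in> D" "j \<in> {1..m}" "j' \<in> {1..m}" and eq: "\<phi> (r, j) = \<phi> (r', j')"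
    have "r = r'" using less[of r r' j j'] less[of r' r j' j] a eq by (metis less_irrefl nat_neq_iff)
    then show "r = r' \<and> j = j'" using eq by (auto simp: \<phi>_def)
  qed
  have "hit (D \<times> {1..}) (dec m) S = hit (D \<times> {1..m}) (dec m) S"
    using S dec_sites by (intro hit_sub) auto
  also have "\<dots> = hit {1..} ((\<circ>) \<phi> ` dec m) S"
    using S dec_sites val inj by (intro hit_image[symmetric]) auto
  also have "\<dots> \<le> hit {1..} (incr_idx d (d * m)) S"
  proof (rule hit_mono)
    fix u assume "u \<in> (\<circ>) \<phi> ` dec m"
    then obtain i where i: "i \<in> all_idx d m" and u: "u = (\<lambda>r. \<phi> (r, i r))" by (auto simp: dec_def fun_eq_iff)
    have ir: "i r \<in> {1..m}" if "r \<in> D" for r using i that by (auto simp: all_idx_def PiE_iff)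
    have "restrict u D \<in> incr_idx d (d * m)"
      unfolding incr_idx_def using val ir less by (auto simp: u strict_mono_on_def)
    then show "\<exists>u'\<in>incr_idx d (d * m). \<forall>r\<in>D. u r = u' r" by (intro bexI[of _ "restrict u D"]) auto
  next
    fix u assume "u \<in> incr_idx d (d * m)"
    then show "u ` D \<subseteq> {1..}" using incr_sites by fastforce
  qed (use S in auto)
  finally show ?thesis .
qed

lemma card_compatible_colourings:
  assumes "i \<in> incr_idx d n"
  shows "d ^ (n - d) \<le> card {c\<in>{1..n} \<rightarrow>\<^sub>E D. \<forall>r\<in>D. c (i r) = r}" (is "_ \<le> card ?R")
proof -
  let ?F = "\<lambda>c. \<lambda>j\<in>{1..n}. if j \<in> i ` D then inv_into D i j else c j"
  let ?Q = "({1..n} - i ` D) \<rightarrow>\<^sub>E D"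
  have "card (i ` D) = d" using card_image[OF incr_inj[OF assms]] by simp
  then have "card ({1..n} - i ` D) = n - d"
    using incr_sites[OF assms] by (subst card_Diff_subset) auto
  then have "d ^ (n - d) = card ?Q" by (simp add: card_funcsetE)
  also have "\<dots> \<le> card ?R"
  proof (rule card_inj_on_le)
    show "inj_on ?F ?Q"
    proof (rule inj_onI, rule ext)
      fix a b j assume ab: "a \<in> ?Q" "b \<in> ?Q" "?F a = ?F b"
      show "a j = b j"
      proof (cases "j \<in> {1..n} - i ` D")
        case True then show ?thesis using fun_cong[OF ab(3), of j] by auto
      next
        case False then show ?thesis using ab PiE_arb by metis
      qed
    qed
    show "?F ` ?Q \<subseteq> ?R"
      using incr_sites[OF assms] incr_inj[OF assms] by (auto simp: PiE_iff inv_into_into image_subset_iff)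
    show "finite ?R" by (rule finite_subset[of _ "{1..n} \<rightarrow>\<^sub>E D"]) (auto intro: finite_PiE)
  qed
  finally show ?thesis .
qed

text \<open>Colour the indices with \<open>d\<close> colours and keep only the multiindices whose \<open>r\<close>-th index has colour \<open>r\<close>;
  placing index \<open>j\<close> at site \<open>(c j, j)\<close> turns them into decoupled ones.  A fixed increasing multiindex
  survives at least a fraction \<open>d ^ (-d)\<close> of all colourings, so summing over the colourings loses
  only the constant \<open>d ^ d\<close>.\<close>

lemma hit_incr_le_dec:
  assumes S: "S \<in> sets (P D)"
  shows "hit {1..} (incr_idx d n) S \<le> d ^ d * hit (D \<times> {1..}) (dec n) S"
proof (cases "incr_idx d n = {}")
  case True
  then show ?thesis using hit_nonneg[of "D \<times> {1..}" "dec n" S] by (simp add: hit_def)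
next
  case False
  then obtain i0 where i0: "i0 \<in> incr_idx d n" by blast
  have nd: "d \<le> n" using card_inj_on_le[OF incr_inj[OF i0] incr_sites[OF i0]] by simp
  let ?Col = "{1..n} \<rightarrow>\<^sub>E D"
  let ?V = "{1..n}"
  interpret prob_space "P ?V" by (rule prob_P)
  define U where "U c = {i\<in>incr_idx d n. \<forall>r\<in>D. c (i r) = r}" for c
  define ev where "ev W = {x\<in>space (P ?V). \<exists>u\<in>W. pick u x \<in> S}" for W
  have finU: "finite (U c)" for c by (simp add: U_def)
  have ev_sets: "ev W \<in> sets (P ?V)" if W: "W \<subseteq> incr_idx d n" for W
    unfolding ev_def
  proof (rule hit_event[OF _ _ S])
    show "finite W" using W by (rule finite_subset) simp
    show "u ` D \<subseteq> ?V" if "u \<in> W" for u using subsetD[OF W that] by (rule incr_sites)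
  qed
  have ev_U: "ev (U c) \<in> sets (P ?V)" for c by (intro ev_sets) (auto simp: U_def)
  have colour: "hit ?V (U c) S \<le> hit (D \<times> {1..}) (dec n) S" if c: "c \<in> ?Col" for c
  proof -
    define \<phi> where "\<phi> j = (c j, j)" for j
    have "hit ?V (U c) S = hit (D \<times> {1..}) ((\<circ>) \<phi> ` U c) S"
      using S incr_sites c finU by (intro hit_image[symmetric]) (auto simp: \<phi>_def inj_on_def U_def PiE_iff)
    also have "\<dots> \<le> hit (D \<times> {1..}) (dec n) S"
    proof (rule hit_mono)
      fix u assume "u \<in> (\<circ>) \<phi> ` U c"
      then obtain i where i: "i \<in> U c" "u = \<phi> \<circ> i" by auto
      have "i \<in> all_idx d n" using i by (auto simp: U_def incr_idx_def all_idx_def)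
      moreover have "\<forall>r\<in>D. u r = (r, i r)" using i by (auto simp: \<phi>_def U_def)
      ultimately show "\<exists>u'\<in>dec n. \<forall>r\<in>D. u r = u' r" unfolding dec_def by (intro bexI[of _ "\<lambda>r. (r, i r)"]) auto
    qed (use S dec_sites' in auto)
    finally show ?thesis .
  qed
  have count: "of_nat (d ^ (n - d)) * indicator (ev (incr_idx d n)) x \<le> (\<Sum>c\<in>?Col. indicator (ev (U c)) x :: ennreal)" for x
  proof (cases "x \<in> ev (incr_idx d n)")
    case True
    then obtain i where i: "i \<in> incr_idx d n" "pick i x \<in> S" "x \<in> space (P ?V)" by (auto simp: ev_def)
    let ?R = "{c\<in>?Col. \<forall>r\<in>D. c (i r) = r}"
    have "(of_nat (d ^ (n - d)) :: ennreal) \<le> of_nat (card ?R)"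
      by (intro of_nat_mono card_compatible_colourings i)
    also have "\<dots> = (\<Sum>c\<in>?R. 1)" by simp
    also have "\<dots> = (\<Sum>c\<in>?R. indicator (ev (U c)) x)"
      using i by (intro sum.cong refl) (auto simp: ev_def U_def indicator_def)
    also have "\<dots> \<le> (\<Sum>c\<in>?Col. indicator (ev (U c)) x)"
      by (intro sum_mono2) (auto intro: finite_PiE)
    finally show ?thesis using True by simp
  qed simp
  have "of_nat (d ^ (n - d)) * emeasure (P ?V) (ev (incr_idx d n))
      = (\<integral>\<^sup>+x. of_nat (d ^ (n - d)) * indicator (ev (incr_idx d n)) x \<partial>P ?V)"
    using ev_sets by (simp add: nn_integral_cmult)
  also have "\<dots> \<le> (\<integral>\<^sup>+x. (\<Sum>c\<in>?Col. indicator (ev (U c)) x) \<partial>P ?V)"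
    by (intro nn_integral_mono count)
  also have "\<dots> = (\<Sum>c\<in>?Col. emeasure (P ?V) (ev (U c)))"
    using ev_U by (simp add: nn_integral_sum)
  also have "\<dots> \<le> (\<Sum>c\<in>?Col. ennreal (hit (D \<times> {1..}) (dec n) S))"
    using colour by (intro sum_mono) (simp add: emeasure_eq_measure ev_def hit_def)
  also have "\<dots> = of_nat (d ^ n) * ennreal (hit (D \<times> {1..}) (dec n) S)"
    by (simp add: card_funcsetE)
  finally have "ennreal (real (d ^ (n - d)) * hit ?V (incr_idx d n) S)
      \<le> ennreal (real (d ^ n) * hit (D \<times> {1..}) (dec n) S)"
    by (simp add: emeasure_eq_measure ev_def hit_def ennreal_mult' ennreal_of_nat_eq_real_of_nat del: of_nat_power)
  then have "real (d ^ (n - d)) * hit ?V (incr_idx d n) S \<le> real (d ^ n) * hit (D \<times> {1..}) (dec n) S"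
    by (subst (asm) ennreal_le_iff) (auto intro: mult_nonneg_nonneg hit_nonneg)
  also have "d ^ n = d ^ (n - d) * d ^ d" using nd by (simp flip: power_add)
  finally have "hit ?V (incr_idx d n) S \<le> real (d ^ d) * hit (D \<times> {1..}) (dec n) S"
    using d_pos by (simp add: mult.assoc)
  moreover have "hit {1..} (incr_idx d n) S = hit ?V (incr_idx d n) S"
    using S incr_sites by (intro hit_sub) auto
  ultimately show ?thesis by simp
qed

lemma summable_hit_iff:
  assumes S: "\<And>k. S k \<in> sets (P D)"
  shows "summable (\<lambda>k. hit {1..} (incr_idx d (2 ^ Suc k)) (S k)) \<longleftrightarrow> summable (\<lambda>k. hit (D \<times> {1..}) (dec (2 ^ Suc k)) (S k))"
proof
  assume inc: "summable (\<lambda>k. hit {1..} (incr_idx d (2 ^ Suc k)) (S k))"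
  have d_le: "d \<le> 2 ^ d" by (simp add: less_imp_le)
  have bound: "hit (D \<times> {1..}) (dec (2 ^ Suc k)) (S k) \<le> (2 ^ d) ^ d * hit {1..} (incr_idx d (2 ^ Suc k)) (S k)"
    if "k \<ge> d" for k
  proof -
    define m :: nat where "m = 2 ^ (Suc k - d)"
    have split: "(2::nat) ^ Suc k = 2 ^ d * m" using that by (simp add: m_def flip: power_add)
    have "hit (D \<times> {1..}) (dec (2 ^ Suc k)) (S k) \<le> (2 ^ d) ^ d * hit (D \<times> {1..}) (dec m) (S k)"
      unfolding split using hit_dec_scale[OF _ S, of m "2 ^ d" k] by (simp add: m_def)
    also have "\<dots> \<le> (2 ^ d) ^ d * hit {1..} (incr_idx d (d * m)) (S k)"
      by (intro mult_left_mono hit_dec_le_incr[OF S]) auto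
    also have "\<dots> \<le> (2 ^ d) ^ d * hit {1..} (incr_idx d (2 ^ Suc k)) (S k)"
    proof (intro mult_left_mono hit_mono)
      fix u assume "u \<in> incr_idx d (d * m)"
      moreover have "d * m \<le> 2 ^ Suc k" unfolding split using d_le by (intro mult_right_mono) auto
      ultimately have "u \<in> incr_idx d (2 ^ Suc k)"
        unfolding incr_idx_def by (auto simp: PiE_iff intro: order_trans)
      then show "\<exists>u'\<in>incr_idx d (2 ^ Suc k). \<forall>r\<in>D. u r = u' r" by blast
    next
      fix u assume "u \<in> incr_idx d (2 ^ Suc k)"
      then show "u ` D \<subseteq> {1..}" using incr_sites by fastforce
    qed (use S in auto)
    finally show ?thesis .
  qed
  show "summable (\<lambda>k. hit (D \<times> {1..}) (dec (2 ^ Suc k)) (S k))"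
    by (rule summable_comparison_test'[OF summable_mult[OF inc, of "(2 ^ d) ^ d"], of d])
       (use bound in \<open>simp add: hit_nonneg\<close>)
next
  assume dc: "summable (\<lambda>k. hit (D \<times> {1..}) (dec (2 ^ Suc k)) (S k))"
  show "summable (\<lambda>k. hit {1..} (incr_idx d (2 ^ Suc k)) (S k))"
    by (rule summable_comparison_test'[OF summable_mult[OF dc, of "real (d ^ d)"], of 0])
       (use hit_incr_le_dec[OF S] in \<open>simp add: hit_nonneg\<close>)
qed

end

section \<open>Summability of the truncated second moments\<close>

text \<open>If the probabilities were not summable, then \<open>1 - p \<le> exp (-p)\<close> would make the probability that no event
  happens after time \<open>n\<close> zero for every \<open>n\<close>.\<close>

lemma borel_cantelli_converse:
  assumes "prob_space M" and E: "\<And>k. E k \<in> sets M"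
    and indep: "\<And>J. finite J \<Longrightarrow> J \<noteq> {} \<Longrightarrow>
        measure M (\<Inter>k\<in>J. space M - E k) = (\<Prod>k\<in>J. 1 - measure M (E k))"
    and fin: "AE x in M. eventually (\<lambda>k. x \<notin> E k) sequentially"
  shows "summable (\<lambda>k::nat. measure M (E k))"
proof (rule ccontr)
  interpret prob_space M by fact
  assume not: "\<not> summable (\<lambda>k. prob (E k))"
  define T where "T n = (\<Inter>k\<in>{n..}. space M - E k)" for n
  have T_sets [measurable]: "T n \<in> sets M" for n
    unfolding T_def using E by (intro sets.countable_INT') auto
  have T0: "prob (T n) = 0" for n
  proof (rule antisym[OF _ measure_nonneg], rule field_le_epsilon)
    fix e :: real assume e: "e > 0"
    have tail: "\<not> summable (\<lambda>k. prob (E (k + n)))" using not summable_iff_shift by blast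
    have "\<exists>m. (\<Sum>k<m. prob (E (k + n))) > - ln e"
    proof (rule ccontr)
      assume "\<not> ?thesis"
      then have "\<And>m. (\<Sum>k<m. prob (E (k + n))) \<le> - ln e" by (auto simp: not_less)
      then have "summable (\<lambda>k. prob (E (k + n)))" by (intro summableI_nonneg_bounded[where x="- ln e"]) auto
      then show False using tail by blast
    qed
    then obtain m where m: "(\<Sum>k<m. prob (E (k + n))) > - ln e" by blast
    let ?J = "{n..n + m}"
    have "prob (T n) \<le> prob (\<Inter>k\<in>?J. space M - E k)"
      using E by (intro finite_measure_mono sets.finite_INT) (auto simp: T_def)
    also have "\<dots> = (\<Prod>k\<in>?J. 1 - prob (E k))" by (intro indep) auto
    also have "\<dots> \<le> (\<Prod>k\<in>?J. exp (- prob (E k)))"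
      using exp_ge_add_one_self[of "- prob (E k)" for k] by (intro prod_mono) auto
    also have "\<dots> = exp (- (\<Sum>k\<in>?J. prob (E k)))" by (simp add: exp_sum sum_negf[symmetric])
    also have "\<dots> \<le> exp (- (\<Sum>k<m. prob (E (k + n))))"
    proof -
      have "(\<Sum>k<m. prob (E (k + n))) = (\<Sum>k\<in>(\<lambda>k. k + n) ` {..<m}. prob (E k))"
        by (subst sum.reindex) auto
      also have "\<dots> \<le> (\<Sum>k\<in>?J. prob (E k))" by (intro sum_mono2) auto
      finally show ?thesis by simp
    qed
    also have "\<dots> \<le> exp (ln e)" using m by simp
    also have "\<dots> = e" using e by simp
    finally show "prob (T n) \<le> 0 + e" by simp
  qed
  have "AE x in M. x \<notin> T n" for n
    using T0[of n] by (simp add: prob_eq_0 T_sets)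
  then have "AE x in M. \<forall>n. x \<notin> T n" by (simp add: AE_all_countable)
  with fin AE_space have "AE x in M. False"
  proof eventually_elim
    case (elim x)
    then obtain n where n: "\<And>k. k \<ge> n \<Longrightarrow> x \<notin> E k" by (auto simp: eventually_sequentially)
    then have "x \<in> T n" using elim by (auto simp: T_def)
    then show ?case using elim by blast
  qed
  then show False by simp
qed

lemma ennreal_two_power: "(2::ennreal) ^ n = ennreal (2 ^ n)"
  using ennreal_power[of 2 n] by simp

context kernel
begin

lemma space_P_nonempty: "space (P V) \<noteq> {}"
  using prob_space.not_empty[OF prob_P] .

lemma G_le_1:
  assumes "S \<subseteq> A k m" "m \<ge> 1" "x \<in> space (P D)"
  shows "G k S x \<le> 1"
  using EI_G_bound[OF assms(1), of "{}" x] assms by (simp add: EI_empty)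

lemma EI_G_finite:
  assumes "S \<subseteq> A k (card I)" "I \<subseteq> D" "z \<in> space (P D)"
  shows "EI I (G k S) z < \<top>"
proof (cases "I = {}")
  case True
  then show ?thesis using assms by (simp add: EI_empty G_def ennreal_mult_less_top indicator_def)
next
  case False
  then have "card I \<ge> 1" using assms finite_subset[of I D] by (simp add: Suc_le_eq card_gt_0_iff One_nat_def)
  then have "EI I (G k S) z \<le> (\<integral>\<^sup>+y. 1 \<partial>P I)"
    unfolding partial_E_def using assms by (intro nn_integral_mono G_le_1[OF assms(1)] merge_space) auto
  also have "\<dots> = 1" using prob_space.emeasure_space_1[OF prob_P[of I]] by simp
  finally show ?thesis by (simp add: order_le_less_trans)
qed

definition blk :: "nat set \<Rightarrow> (nat \<Rightarrow> nat \<times> nat) set" where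
  "blk B = (\<lambda>i r. (r, i r)) ` (D \<rightarrow>\<^sub>E B)"

lemma finite_blk [simp]: "finite B \<Longrightarrow> finite (blk B)"
  by (simp add: blk_def finite_PiE)

lemma blk_sites: "u \<in> blk B \<Longrightarrow> u ` D \<subseteq> D \<times> B"
  by (auto simp: blk_def PiE_iff)

lemma dec_eq_blk: "dec n = blk {1..n}"
  by (simp add: dec_def blk_def all_idx_def)

text \<open>If the normalised sum of squares over \<open>S\<close> is at least half its positive mean \<open>m\<close>, then some point of the
  sample lies in \<open>S\<close>; so the lower tail bound with \<open>I = D\<close> bounds the hitting probability from below.\<close>

lemma mass_le_hit:
  assumes S: "S \<in> sets (P D)" "S \<subseteq> A k d"
    and m: "ennreal m = 2 ^ (d * k) * (\<integral>\<^sup>+x. G k S x \<partial>P D)" "m \<ge> 0"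
  shows "m \<le> 4 * (m + 2 ^ d) * hit (D \<times> {1..}) (dec (2 ^ k)) S"
proof (cases "m = 0")
  case True
  then show ?thesis by (simp add: hit_nonneg)
next
  case False
  obtain z where z: "z \<in> space (P D)" using space_P_nonempty by blast
  let ?B = "{1..2 ^ k} :: nat set"
  have mrg: "merge D (D - D) (y, z) = restrict y D" for y by (auto simp: merge_def fun_eq_iff)
  have EI: "EI D (G k S) z = (\<integral>\<^sup>+x. G k S x \<partial>P D)"
    unfolding partial_E_def mrg by (intro nn_integral_cong) (auto simp: space_PiM intro!: arg_cong[where f="G k S"] extensional_restrict)
  have pw: "of_nat (card ?B ^ card D) = (2 ^ (d * k) :: ennreal)"
    by (simp add: power_mult[symmetric] mult.commute)
  let ?W = "\<lambda>x. \<Sum>i\<in>D \<rightarrow>\<^sub>E ?B. G k S (merge D (D - D) (\<lambda>r\<in>D. x (r, i r), z))"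
  have "m \<le> 4 * (m + 2 ^ card D) * measure (P (D \<times> ?B)) {x\<in>space (P (D \<times> ?B)). ennreal (m / 2) \<le> ?W x}"
    using S z m by (intro slice_sum_lower_tail) (auto simp: pw[simplified] EI)
  also have "\<dots> \<le> 4 * (m + 2 ^ d) * hit (D \<times> ?B) (blk ?B) S"
  proof -
    interpret prob_space "P (D \<times> ?B)" by (rule prob_P)
    have "{x\<in>space (P (D \<times> ?B)). ennreal (m / 2) \<le> ?W x} \<subseteq> {x\<in>space (P (D \<times> ?B)). \<exists>u\<in>blk ?B. pick u x \<in> S}"
    proof safe
      fix x assume x: "x \<in> space (P (D \<times> ?B))" "ennreal (m / 2) \<le> ?W x"
      have "?W x \<noteq> 0" using x(2) False m(2) by auto
      then obtain i where i: "i \<in> D \<rightarrow>\<^sub>E ?B" "G k S (restrict (\<lambda>r\<in>D. x (r, i r)) D) \<noteq> 0"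
        unfolding mrg by (meson sum.not_neutral_contains_not_neutral)
      then have "pick (\<lambda>r. (r, i r)) x \<in> S" by (auto simp: G_def pick_def indicator_def split: if_splits)
      then show "\<exists>u\<in>blk ?B. pick u x \<in> S" using i by (auto simp: blk_def)
    qed
    then show ?thesis unfolding hit_def using m blk_sites S
      by (intro mult_mono finite_measure_mono hit_event) auto
  qed
  also have "hit (D \<times> ?B) (blk ?B) S = hit (D \<times> {1..}) (dec (2 ^ k)) S"
    unfolding dec_eq_blk using S blk_sites by (intro hit_sub[symmetric]) auto
  finally show ?thesis .
qed

text \<open>This is where the tail condition on \<open>\<gamma>\<close> is used.\<close>

lemma geometric_entrance_sum:
  assumes "s \<ge> 0"
  shows "(\<Sum>k. 2 ^ (d * (l + 1 + k)) * ennreal (s / (\<Gamma> (l + 1 + k))\<^sup>2)) \<le> ennreal C * (2 ^ (d * (l + 1)) * ennreal (s / (\<Gamma> (l + 1))\<^sup>2))"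
proof -
  define q where "q n = 2 ^ (d * n) / (\<Gamma> n)\<^sup>2" for n
  have q: "summable (\<lambda>k. q (l + 1 + k))" "(\<Sum>k. q (l + 1 + k)) \<le> C * q (l + 1)"
    using \<gamma>_tail[of "l + 1"] by (auto simp: q_def)
  have q0: "q n > 0" for n using \<Gamma>_pos[of n] by (simp add: q_def)
  have scale: "2 ^ (d * n) * ennreal (s / (\<Gamma> n)\<^sup>2) = ennreal (s * q n)" for n
  proof -
    have "2 ^ (d * n) * ennreal (s / (\<Gamma> n)\<^sup>2) = ennreal (2 ^ (d * n) * (s / (\<Gamma> n)\<^sup>2))"
      unfolding ennreal_two_power using assms by (intro ennreal_mult[symmetric]) auto
    then show ?thesis by (simp add: q_def mult_ac)
  qed
  have C0: "C \<ge> 0"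
  proof -
    have "0 \<le> (\<Sum>k. q (l + 1 + k))" using q0 by (intro suminf_nonneg q) (auto intro: less_imp_le)
    then show ?thesis using q(2) q0[of "l + 1"] by (meson mult_less_0_iff not_le order_trans)
  qed
  have "(\<Sum>k. ennreal (s * q (l + 1 + k))) = ennreal (\<Sum>k. s * q (l + 1 + k))"
    using assms q(1) less_imp_le[OF q0] by (intro suminf_ennreal2 summable_mult) auto
  also have "(\<Sum>k. s * q (l + 1 + k)) = s * (\<Sum>k. q (l + 1 + k))" using q(1) by (rule suminf_mult)
  also have "ennreal \<dots> \<le> ennreal (C * (s * q (l + 1)))"
    using mult_left_mono[OF q(2) assms] by (intro ennreal_leI) (simp add: mult_ac)
  also have "\<dots> = ennreal C * ennreal (s * q (l + 1))" using C0 by (simp add: ennreal_mult')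
  finally show ?thesis unfolding scale .
qed

text \<open>Assign each point \<open>x\<close> to the first step at which it belongs to the truncation.  By the tail condition the
  whole series at \<open>x\<close> is at most a constant times its first nonzero term, so only the mass on the entrance
  sets \<open>R k\<close> matters.  Points of \<open>R (Suc k)\<close> are outside the truncation of the step before, so hitting
  \<open>R (Suc k)\<close> is no more likely than the event of (f), up to a change of scale, and by \<open>mass_le_hit\<close> this
  controls the mass as soon as the hitting probability is small.\<close>

lemma truncated_mass_summable:
  assumes f: "summable (\<lambda>k. hit (D \<times> {1..}) (dec (2 ^ Suc k)) (space (P D) - A (Suc k) d))"
  shows "(\<Sum>k. 2 ^ (d * Suc k) * (\<integral>\<^sup>+x. G (Suc k) (A (Suc k) d) x \<partial>P D)) < \<top>"
proof -
  define R where "R k = A (Suc k) d - (\<Union>j<k. A (Suc j) d)" for k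
  have R_sets [measurable]: "R k \<in> sets (P D)" for k
    unfolding R_def by (intro sets.Diff sets.finite_UN) auto
  have R_sub: "R k \<subseteq> A (Suc k) d" for k by (auto simp: R_def)
  have pw: "(\<Sum>k. 2 ^ (d * Suc k) * G (Suc k) (A (Suc k) d) x)
      \<le> (\<Sum>k. ennreal C * (2 ^ (d * Suc k) * G (Suc k) (R k) x))" for x
  proof (cases "\<exists>k. x \<in> A (Suc k) d")
    case False
    then show ?thesis by (simp add: G_def)
  next
    case True
    define l where "l = (LEAST k. x \<in> A (Suc k) d)"
    have l: "x \<in> A (Suc l) d" using True unfolding l_def by (rule LeastI_ex)
    have less: "x \<notin> A (Suc j) d" if "j < l" for j using that not_less_Least unfolding l_def by blast
    let ?f = "\<lambda>k. 2 ^ (d * Suc k) * G (Suc k) (A (Suc k) d) x"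
    have "(\<Sum>k<l. ?f k) = 0" using less by (intro sum.neutral) (auto simp: G_def)
    then have "(\<Sum>k. ?f k) = (\<Sum>k. ?f (k + l))"
      using suminf_offset[of ?f l] by simp
    also have "\<dots> \<le> (\<Sum>k. 2 ^ (d * (l + 1 + k)) * ennreal ((h x)\<^sup>2 / (\<Gamma> (l + 1 + k))\<^sup>2))"
    proof (rule suminf_le)
      fix k
      have eq: "Suc (k + l) = l + 1 + k" by simp
      have "G (l + 1 + k) S x \<le> ennreal ((h x)\<^sup>2 / (\<Gamma> (l + 1 + k))\<^sup>2)" for S
        by (cases "x \<in> S") (simp_all add: G_def)
      then show "?f (k + l) \<le> 2 ^ (d * (l + 1 + k)) * ennreal ((h x)\<^sup>2 / (\<Gamma> (l + 1 + k))\<^sup>2)"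
        unfolding eq by (rule mult_left_mono) simp
    qed auto
    also have "\<dots> \<le> ennreal C * (2 ^ (d * (l + 1)) * ennreal ((h x)\<^sup>2 / (\<Gamma> (l + 1))\<^sup>2))"
      by (rule geometric_entrance_sum) simp
    also have "\<dots> = ennreal C * (2 ^ (d * Suc l) * G (Suc l) (R l) x)"
    proof -
      have "x \<in> R l" using l less by (auto simp: R_def)
      then show ?thesis by (simp only: G_def indicator_simps mult_1_right Suc_eq_plus1)
    qed
    also have "\<dots> \<le> (\<Sum>k. ennreal C * (2 ^ (d * Suc k) * G (Suc k) (R k) x))"
      using sum_le_suminf[of "\<lambda>k. ennreal C * (2 ^ (d * Suc k) * G (Suc k) (R k) x)" "{l}"] by simp
    finally show ?thesis by simp
  qed
  define e where "e k = (\<integral>\<^sup>+x. G (Suc k) (R k) x \<partial>P D)" for k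
  define m where "m k = enn2real (2 ^ (d * Suc k) * e k)" for k
  have e1: "e k \<le> 1" for k
  proof -
    have "e k \<le> (\<integral>\<^sup>+x. 1 \<partial>P D)"
      unfolding e_def using d_pos by (intro nn_integral_mono G_le_1[OF R_sub])
    then show ?thesis using prob_space.emeasure_space_1[OF prob_P[of D]] by simp
  qed
  have m: "ennreal (m k) = 2 ^ (d * Suc k) * e k" for k
  proof -
    have "2 ^ (d * Suc k) * e k \<le> 2 ^ (d * Suc k) * 1" using e1 by (intro mult_left_mono) auto
    also have "\<dots> < \<top>" by (simp only: ennreal_two_power mult_1_right ennreal_less_top)
    finally show ?thesis unfolding m_def by (rule ennreal_enn2real)
  qed
  define p where "p k = hit (D \<times> {1..}) (dec (2 ^ Suc k)) (R k)" for k
  have p_le: "p (Suc k) \<le> 2 ^ d * hit (D \<times> {1..}) (dec (2 ^ Suc k)) (space (P D) - A (Suc k) d)" for k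
  proof -
    have "p (Suc k) \<le> hit (D \<times> {1..}) (dec (2 ^ Suc (Suc k))) (space (P D) - A (Suc k) d)"
      unfolding p_def using dec_sites' A_subset_space[of "Suc (Suc k)" d] by (intro hit_mono) (auto simp: R_def)
    also have "\<dots> \<le> real 2 ^ d * hit (D \<times> {1..}) (dec (2 ^ Suc k)) (space (P D) - A (Suc k) d)"
      using hit_dec_scale[of "2 ^ Suc k" "space (P D) - A (Suc k) d" 2, OF one_le_power] by simp
    finally show ?thesis by simp
  qed
  have p0: "p k \<ge> 0" for k by (simp add: p_def hit_nonneg)
  have p_sum: "summable p"
  proof -
    have "summable (\<lambda>k. p (Suc k))"
      by (rule summable_comparison_test'[OF summable_mult[OF f, of "2 ^ d"], where N=0]) (simp only: real_norm_def abs_of_nonneg[OF p0] p_le)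
    then show ?thesis by (simp add: summable_Suc_iff)
  qed
  have m_le: "m k \<le> 4 * (m k + 2 ^ d) * p k" for k
    unfolding p_def using m[of k] R_sub by (intro mass_le_hit) (auto simp: e_def m_def)
  have "eventually (\<lambda>k. p k < 1 / 8) sequentially"
    using summable_LIMSEQ_zero[OF p_sum] by (rule order_tendstoD) simp
  then have "eventually (\<lambda>k. norm (m k) \<le> 8 * 2 ^ d * p k) sequentially"
  proof eventually_elim
    case (elim k)
    have "m k * p k \<le> m k * (1 / 8)" using elim by (intro mult_left_mono) (auto simp: m_def)
    then have "m k \<le> 8 * 2 ^ d * p k" using m_le[of k] by (simp add: algebra_simps)
    then show ?case by (simp add: m_def)
  qed
  then have m_sum: "summable m"
    by (rule summable_comparison_test_ev) (intro summable_mult p_sum)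
  have [measurable]: "G k S \<in> borel_measurable (P D)" if "S \<in> sets (P D)" for k S
    using that by (rule measurable_G)
  have "(\<Sum>k. 2 ^ (d * Suc k) * (\<integral>\<^sup>+x. G (Suc k) (A (Suc k) d) x \<partial>P D))
      = (\<integral>\<^sup>+x. (\<Sum>k. 2 ^ (d * Suc k) * G (Suc k) (A (Suc k) d) x) \<partial>P D)"
    by (subst nn_integral_suminf) (simp_all add: nn_integral_cmult)
  also have "\<dots> \<le> (\<integral>\<^sup>+x. (\<Sum>k. ennreal C * (2 ^ (d * Suc k) * G (Suc k) (R k) x)) \<partial>P D)"
    by (intro nn_integral_mono pw)
  also have "\<dots> = (\<Sum>k. ennreal C * ennreal (m k))"
    unfolding m by (subst nn_integral_suminf) (simp_all add: nn_integral_cmult e_def)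
  also have "\<dots> = ennreal C * (\<Sum>k. ennreal (m k))" by simp
  also have "(\<Sum>k. ennreal (m k)) = ennreal (\<Sum>k. m k)"
    by (intro suminf_ennreal2 m_sum) (simp add: m_def)
  also have "ennreal C * ennreal (\<Sum>k. m k) < \<top>" by (simp add: ennreal_mult_less_top)
  finally show ?thesis .
qed

end

section \<open>From sums of squares to hitting probabilities\<close>

context kernel
begin

definition sqsum :: "(nat \<Rightarrow> 'v) set \<Rightarrow> ('v \<Rightarrow> 'e) \<Rightarrow> real" where
  "sqsum U x = (\<Sum>u\<in>U. (h (pick u x))\<^sup>2)"

lemma sqsum_measurable:
  assumes "\<And>u. u \<in> U \<Longrightarrow> u ` D \<subseteq> V"
  shows "sqsum U \<in> borel_measurable (P V)"
  unfolding sqsum_def[abs_def]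
proof (intro borel_measurable_sum borel_measurable_power)
  fix u assume "u \<in> U"
  then show "(\<lambda>x. h (pick u x)) \<in> borel_measurable (P V)"
    using assms by (intro measurable_compose[OF pick_measurable h_meas]) auto
qed

lemma bad_sets: "I \<subseteq> D \<Longrightarrow> bad k I \<in> sets (P D)"
  unfolding bad_def using measurable_EI[OF _ measurable_G[OF sets_A]] by measurable

text \<open>Integrate first over the sites of the coordinates in \<open>I\<close> and then over the others.  Whether some point
  lies in \<open>bad k I\<close> depends only on the outer sites.  If one does, fix such a multiindex: the part of the sum
  of squares that keeps its outer coordinates has conditional mean at least \<open>2 ^ (- card I)\<close>, and the
  lower tail bound applies to it.  No measurable choice of the multiindex is involved, because
  the comparison is made separately at every outer point.\<close>

lemma hit_bad_le_large_sqsum: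
  fixes B :: "nat set"
  assumes I: "I \<subseteq> D" "card I < d" and B: "finite B" "2 ^ k \<le> 2 * card B" "card B \<le> 2 ^ k"
  shows "hit (D \<times> B) (blk B) (bad k I)
    \<le> 4 * (1 + 4 ^ d) * measure (P (D \<times> B)) {x\<in>space (P (D \<times> B)). 1 / 2 ^ d \<le> sqsum (blk B) x / (\<Gamma> k)\<^sup>2}"
proof -
  let ?l = "card I" and ?N = "card B"
  define L where "L = (D - I) \<times> B"
  define K where "K = I \<times> B"
  have LK: "L \<inter> K = {}" "finite L" "finite K" "L \<union> K = D \<times> B"
    using I B finite_subset[OF I(1)] by (auto simp: L_def K_def)
  have B0: "B \<noteq> {}" using B(2) by (auto intro: ccontr)
  define Hi where "Hi = {x\<in>space (P (D \<times> B)). \<exists>u\<in>blk B. pick u x \<in> bad k I}"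
  define Ev where "Ev = {x\<in>space (P (D \<times> B)). 1 / 2 ^ d \<le> sqsum (blk B) x / (\<Gamma> k)\<^sup>2}"
  have [measurable]: "Hi \<in> sets (P (D \<times> B))"
    unfolding Hi_def using B blk_sites by (intro hit_event bad_sets I) auto
  have [measurable]: "sqsum (blk B) \<in> borel_measurable (P (D \<times> B))"
    by (intro sqsum_measurable blk_sites)
  have [measurable]: "Ev \<in> sets (P (D \<times> B))"
    unfolding Ev_def by measurable
  interpret Q: prob_space "P (D \<times> B)" by (rule prob_P)
  interpret K: prob_space "P K" by (rule prob_P)
  interpret pp: product_prob_space "\<lambda>_. \<mu>" "UNIV :: (nat \<times> nat) set" by (rule product_prob)
  define c where "c = 4 * (1 + 4 ^ d :: real)"
  have c0: "c > 0" by (simp add: c_def add_pos_pos)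
  have inner: "(\<integral>\<^sup>+y. indicator Hi (merge L K (x, y)) \<partial>P K)
      \<le> ennreal c * (\<integral>\<^sup>+y. indicator Ev (merge L K (x, y)) \<partial>P K)" if x: "x \<in> space (P L)" for x
  proof (cases "\<exists>y\<in>space (P K). merge L K (x, y) \<in> Hi")
    case False
    then have "(\<integral>\<^sup>+y. indicator Hi (merge L K (x, y)) \<partial>P K) = (\<integral>\<^sup>+y. 0 \<partial>P K)"
      by (intro nn_integral_cong) auto
    then show ?thesis by simp
  next
    case True
    then obtain y0 where y0: "y0 \<in> space (P K)" "merge L K (x, y0) \<in> Hi" by blast
    then obtain i0 where i0: "i0 \<in> D \<rightarrow>\<^sub>E B" "pick (\<lambda>r. (r, i0 r)) (merge L K (x, y0)) \<in> bad k I"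
      by (auto simp: Hi_def blk_def)
    define z where "z = pick (\<lambda>r. (r, i0 r)) (merge L K (x, y0))"
    have z: "z \<in> space (P D)" "1 < 2 ^ (k * ?l) * EI I (G k (A k ?l)) z"
      using i0 by (auto simp: z_def bad_def)
    define m where "m = enn2real (of_nat (?N ^ ?l) * EI I (G k (A k ?l)) z)"
    have m: "ennreal m = of_nat (?N ^ ?l) * EI I (G k (A k ?l)) z" "m \<ge> 0"
      unfolding m_def using EI_G_finite[OF order_refl I(1) z(1), of k]
      by (auto intro!: ennreal_enn2real simp: ennreal_mult_less_top of_nat_less_top simp del: of_nat_power)
    \<comment> \<open>badness refers to \<open>2 ^ k\<close> indices per coordinate, the block has at least half as many\<close>
    have m_big: "1 \<le> 2 ^ ?l * m"
    proof -
      have "2 ^ (k * ?l) \<le> 2 ^ ?l * ?N ^ ?l"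
      proof -
        have "(2 ^ k) ^ ?l \<le> (2 * ?N) ^ ?l" using B(2) by (intro power_mono) auto
        then show ?thesis by (simp add: power_mult power_mult_distrib)
      qed
      then have "(of_nat (2 ^ (k * ?l)) :: ennreal) \<le> of_nat (2 ^ ?l * ?N ^ ?l)" by (rule of_nat_mono)
      then have "(2 ^ (k * ?l) :: ennreal) \<le> 2 ^ ?l * of_nat (?N ^ ?l)" by simp
      then have "2 ^ (k * ?l) * EI I (G k (A k ?l)) z \<le> 2 ^ ?l * of_nat (?N ^ ?l) * EI I (G k (A k ?l)) z"
        by (rule mult_right_mono) simp
      then have "1 \<le> 2 ^ ?l * ennreal m" using z(2) by (simp add: m(1) mult.assoc del: of_nat_power)
      also have "\<dots> = ennreal (2 ^ ?l * m)"
        unfolding ennreal_two_power using m(2) by (simp add: ennreal_mult)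
      finally show ?thesis by simp
    qed
    let ?W = "\<lambda>y. \<Sum>i\<in>I \<rightarrow>\<^sub>E B. G k (A k ?l) (merge I (D - I) (\<lambda>r\<in>I. y (r, i r), z))"
    let ?T = "{y\<in>space (P K). ennreal (m / 2) \<le> ?W y}"
    have tail: "m \<le> 4 * (m + 2 ^ ?l) * measure (P K) ?T"
      unfolding K_def by (rule slice_sum_lower_tail[OF B0 B(1,3) I(1) sets_A order_refl z(1) m])
    have prob_T: "1 \<le> c * measure (P K) ?T"
    proof -
      have m0: "m > 0" using m_big m(2) by (cases "m = 0") auto
      have "2 ^ ?l \<le> 4 ^ ?l * m"
      proof -
        have "2 ^ ?l * 1 \<le> 2 ^ ?l * (2 ^ ?l * m)" using m_big by (intro mult_left_mono) auto
        then show ?thesis by (simp add: power_mult_distrib[symmetric] flip: mult.assoc)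
      qed
      also have "\<dots> \<le> 4 ^ d * m" using m(2) I(2) by (intro mult_right_mono power_increasing) auto
      finally have "m + 2 ^ ?l \<le> (1 + 4 ^ d) * m" by (simp add: algebra_simps)
      then have "4 * (m + 2 ^ ?l) * measure (P K) ?T \<le> 4 * ((1 + 4 ^ d) * m) * measure (P K) ?T"
        by (intro mult_right_mono) auto
      then have "m * 1 \<le> m * (c * measure (P K) ?T)" using tail by (simp add: c_def mult_ac)
      then show ?thesis using m0 by (subst (asm) mult_le_cancel_left_pos) auto
    qed
    have sub: "indicator ?T y \<le> (indicator Ev (merge L K (x, y)) :: ennreal)" if y: "y \<in> space (P K)" for y
    proof (cases "y \<in> ?T")
      case True
      have sp: "merge L K (x, y) \<in> space (P (D \<times> B))"
        using x y LK(1) by (auto simp: LK(4)[symmetric] space_PiM PiE_def)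
      define ext where "ext i = (\<lambda>r\<in>D. if r \<in> I then i r else i0 r)" for i :: "nat \<Rightarrow> nat"
      have ext: "ext ` (I \<rightarrow>\<^sub>E B) \<subseteq> D \<rightarrow>\<^sub>E B" using i0(1) by (auto simp: ext_def PiE_iff)
      have ext_inj: "inj_on ext (I \<rightarrow>\<^sub>E B)"
      proof (rule inj_onI, rule PiE_ext)
        fix i i' r assume "i \<in> I \<rightarrow>\<^sub>E B" "i' \<in> I \<rightarrow>\<^sub>E B" "ext i = ext i'" "r \<in> I"
        then have "ext i r = ext i' r" "r \<in> D" "r \<in> I" using I(1) by auto
        then show "i r = i' r" by (simp add: ext_def)
      qed auto
      have pick_ext: "pick (\<lambda>r. (r, ext i r)) (merge L K (x, y)) = merge I (D - I) (\<lambda>r\<in>I. y (r, i r), z)"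
        if i: "i \<in> I \<rightarrow>\<^sub>E B" for i
      proof
        fix r
        consider "r \<in> I" | "r \<in> D - I" | "r \<notin> D" by blast
        then show "pick (\<lambda>r. (r, ext i r)) (merge L K (x, y)) r = merge I (D - I) (\<lambda>r\<in>I. y (r, i r), z) r"
          using I(1) i i0(1)
          by cases (auto simp: pick_def ext_def merge_def L_def K_def z_def PiE_iff)
      qed
      have "ennreal (m / 2) \<le> ?W y" using True by simp
      also have "\<dots> \<le> (\<Sum>i\<in>I \<rightarrow>\<^sub>E B. ennreal ((h (pick (\<lambda>r. (r, ext i r)) (merge L K (x, y))))\<^sup>2 / (\<Gamma> k)\<^sup>2))"
      proof (rule sum_mono)
        fix i assume i: "i \<in> I \<rightarrow>\<^sub>E B"
        show "G k (A k ?l) (merge I (D - I) (\<lambda>r\<in>I. y (r, i r), z))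
            \<le> ennreal ((h (pick (\<lambda>r. (r, ext i r)) (merge L K (x, y))))\<^sup>2 / (\<Gamma> k)\<^sup>2)"
          unfolding pick_ext[OF i] G_def by (auto simp: indicator_def)
      qed
      also have "\<dots> = ennreal (\<Sum>i\<in>I \<rightarrow>\<^sub>E B. (h (pick (\<lambda>r. (r, ext i r)) (merge L K (x, y))))\<^sup>2 / (\<Gamma> k)\<^sup>2)"
        by (intro sum_ennreal) auto
      finally have "m / 2 \<le> (\<Sum>i\<in>I \<rightarrow>\<^sub>E B. (h (pick (\<lambda>r. (r, ext i r)) (merge L K (x, y))))\<^sup>2 / (\<Gamma> k)\<^sup>2)"
        by (subst (asm) ennreal_le_iff) (auto intro: sum_nonneg)
      also have "\<dots> = (\<Sum>u\<in>(\<lambda>i r. (r, ext i r)) ` (I \<rightarrow>\<^sub>E B). (h (pick u (merge L K (x, y))))\<^sup>2 / (\<Gamma> k)\<^sup>2)"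
      proof -
        have "inj_on (\<lambda>i r. (r, ext i r)) (I \<rightarrow>\<^sub>E B)"
        proof (rule inj_onI)
          fix i i' assume a: "i \<in> I \<rightarrow>\<^sub>E B" "i' \<in> I \<rightarrow>\<^sub>E B" "(\<lambda>r. (r, ext i r)) = (\<lambda>r. (r, ext i' r))"
          then have "ext i = ext i'" by (auto simp: fun_eq_iff)
          then show "i = i'" using ext_inj a by (auto dest: inj_onD)
        qed
        then show ?thesis by (simp add: sum.reindex)
      qed
      also have "\<dots> \<le> (\<Sum>u\<in>blk B. (h (pick u (merge L K (x, y))))\<^sup>2 / (\<Gamma> k)\<^sup>2)"
      proof (rule sum_mono2)
        show "(\<lambda>i r. (r, ext i r)) ` (I \<rightarrow>\<^sub>E B) \<subseteq> blk B"
          using ext by (auto simp: blk_def)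
      qed (use B in auto)
      also have "\<dots> = sqsum (blk B) (merge L K (x, y)) / (\<Gamma> k)\<^sup>2"
        by (simp add: sqsum_def sum_divide_distrib)
      finally have "m / 2 \<le> sqsum (blk B) (merge L K (x, y)) / (\<Gamma> k)\<^sup>2" .
      moreover have "1 / 2 ^ d \<le> m / 2"
      proof -
        have "2 ^ Suc ?l \<le> (2 ^ d :: real)" using I(2) by (intro power_increasing) auto
        then have "1 / 2 ^ d \<le> 1 / (2 ^ Suc ?l :: real)" by (intro divide_left_mono) auto
        also have "\<dots> \<le> m / 2" using m_big by (simp add: field_simps)
        finally show ?thesis .
      qed
      ultimately have "1 / 2 ^ d \<le> sqsum (blk B) (merge L K (x, y)) / (\<Gamma> k)\<^sup>2"
        by (rule order_trans[rotated])
      then have "merge L K (x, y) \<in> Ev" using sp by (simp add: Ev_def)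
      then show ?thesis by (simp add: indicator_def)
    qed simp
    have [measurable]: "?W \<in> borel_measurable (P K)"
    proof (intro borel_measurable_sum)
      fix i assume i: "i \<in> I \<rightarrow>\<^sub>E B"
      then have "(\<lambda>r. (r, i r)) ` I \<subseteq> K" by (auto simp: K_def)
      from measurable_compose[OF measurable_reindex[OF this] measurable_compose[OF measurable_merge_slice[OF I(1) z(1)] measurable_G[OF sets_A]]]
      show "(\<lambda>y. G k (A k ?l) (merge I (D - I) (\<lambda>r\<in>I. y (r, i r), z))) \<in> borel_measurable (P K)" .
    qed
    have "(\<integral>\<^sup>+y. indicator Hi (merge L K (x, y)) \<partial>P K) \<le> (\<integral>\<^sup>+y. 1 \<partial>P K)"
      by (intro nn_integral_mono) (simp add: indicator_def)
    also have "\<dots> = ennreal 1" by (simp add: K.emeasure_space_1)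
    also have "\<dots> \<le> ennreal (c * measure (P K) ?T)" by (intro ennreal_leI prob_T)
    also have "\<dots> = ennreal c * (\<integral>\<^sup>+y. indicator ?T y \<partial>P K)"
    proof -
      have "?T \<in> sets (P K)" by measurable
      then have "(\<integral>\<^sup>+y. indicator ?T y \<partial>P K) = ennreal (measure (P K) ?T)"
        by (simp only: nn_integral_indicator K.emeasure_eq_measure)
      then show ?thesis using c0 by (simp only: ennreal_mult measure_nonneg less_imp_le)
    qed
    also have "\<dots> \<le> ennreal c * (\<integral>\<^sup>+y. indicator Ev (merge L K (x, y)) \<partial>P K)"
      by (intro mult_left_mono nn_integral_mono sub) auto
    finally show ?thesis .
  qed
  have fold: "emeasure (P (D \<times> B)) T = (\<integral>\<^sup>+x. \<integral>\<^sup>+y. indicator T (merge L K (x, y)) \<partial>P K \<partial>P L)"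
    if "T \<in> sets (P (D \<times> B))" for T
    using that LK pp.product_nn_integral_fold[of L K "indicator T"] by simp
  have "emeasure (P (D \<times> B)) Hi \<le> (\<integral>\<^sup>+x. ennreal c * (\<integral>\<^sup>+y. indicator Ev (merge L K (x, y)) \<partial>P K) \<partial>P L)"
    unfolding fold[OF \<open>Hi \<in> sets _\<close>] by (intro nn_integral_mono inner)
  also have "\<dots> = ennreal c * emeasure (P (D \<times> B)) Ev"
  proof -
    have "(\<lambda>p. indicator Ev (merge L K p) :: ennreal) \<in> borel_measurable (P L \<Otimes>\<^sub>M P K)"
      by (rule measurable_compose[OF measurable_merge]) (use LK(4) \<open>Ev \<in> sets _\<close> in simp)
    then have "(\<lambda>(x, y). indicator Ev (merge L K (x, y)) :: ennreal) \<in> borel_measurable (P L \<Otimes>\<^sub>M P K)"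
      by (simp add: case_prod_unfold)
    then have "(\<lambda>x. \<integral>\<^sup>+y. indicator Ev (merge L K (x, y)) \<partial>P K) \<in> borel_measurable (P L)"
      by (rule K.borel_measurable_nn_integral)
    then show ?thesis unfolding fold[OF \<open>Ev \<in> sets _\<close>] by (rule nn_integral_cmult)
  qed
  finally have "ennreal (Q.prob Hi) \<le> ennreal (c * Q.prob Ev)"
    using c0 by (simp add: Q.emeasure_eq_measure ennreal_mult)
  then have "Q.prob Hi \<le> c * Q.prob Ev" using c0 by (subst (asm) ennreal_le_iff) auto
  then show ?thesis by (simp add: hit_def Hi_def Ev_def c_def)
qed

lemma prob_disjoint_blocks:
  fixes K :: "nat \<Rightarrow> 'v set"
  assumes K: "\<And>j. K j \<subseteq> V" "disjoint_family K" and T: "\<And>j. T j \<in> sets (P (K j))"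
    and J: "finite J" "J \<noteq> {}" and V: "V \<noteq> {}"
  shows "measure (P V) (\<Inter>j\<in>J. {x\<in>space (P V). restrict x (K j) \<in> T j})
      = (\<Prod>j\<in>J. measure (P V) {x\<in>space (P V). restrict x (K j) \<in> T j})"
proof -
  interpret prob_space "P V" by (rule prob_P)
  interpret pp: product_prob_space "\<lambda>_. \<mu>" "V" by (rule product_prob)
  have "indep_vars (\<lambda>_. \<mu>) (\<lambda>i x. x i) V"
  proof (subst indep_vars_iff_distr_eq_PiM'[OF V])
    have "distr (P V) (P V) (\<lambda>x. \<lambda>i\<in>V. x i) = distr (P V) (P V) (\<lambda>x. x)"
      by (intro distr_cong) (auto simp: space_PiM intro: extensional_restrict)
    also have "\<dots> = P V" by (rule distr_id2) simp
    also have "\<dots> = Pi\<^sub>M V (\<lambda>i. distr (P V) \<mu> (\<lambda>x. x i))"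
      by (intro PiM_cong refl pp.PiM_component[symmetric]) auto
    finally show "distr (P V) (P V) (\<lambda>x. \<lambda>i\<in>V. x i) = Pi\<^sub>M V (\<lambda>i. distr (P V) \<mu> (\<lambda>x. x i))" .
  qed auto
  then have "indep_vars (\<lambda>j. P (K j)) (\<lambda>j x. restrict (\<lambda>i. x i) (K j)) J"
    using K by (intro indep_vars_restrict) (auto simp: disjoint_family_on_def)
  from indep_varsD[OF this J(2,1) order_refl, of T] T
  show ?thesis by (simp add: vimage_def Int_def conj_commute)
qed

text \<open>The dyadic blocks \<open>(2 ^ k, 2 ^ (k + 1)]\<close> involve disjoint sets of sites, which makes the events of a
  large block sum independent.  Each block sum is a part of the full sum, so only finitely many of these
  events occur.\<close>

lemma squares_imp_summable_hit:
  assumes conv: "AE x in P (D \<times> {1..}). (\<lambda>n. 1 / (\<gamma> n)\<^sup>2 * sqsum (dec n) x) \<longlonglongrightarrow> 0"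
  shows "summable (\<lambda>k. hit (D \<times> {1..}) (dec (2 ^ Suc k)) (space (P D) - A (Suc k) d))"
proof -
  let ?V = "D \<times> {1::nat..}"
  interpret prob_space "P ?V" by (rule prob_P)
  define B :: "nat \<Rightarrow> nat set" where "B k = {2 ^ k + 1..2 ^ Suc k}" for k
  have B: "finite (B k)" "card (B k) = 2 ^ k" "B k \<subseteq> {1..2 ^ Suc k}" for k by (auto simp: B_def)
  have BV: "D \<times> B k \<subseteq> ?V" for k by (auto simp: B_def)
  have disj: "disjoint_family (\<lambda>k. D \<times> B k)"
  proof -
    have "B j \<inter> B k = {}" if "j < k" for j k
    proof -
      have "(2::nat) ^ Suc j \<le> 2 ^ k" using that by (intro power_increasing) auto
      then show ?thesis by (auto simp: B_def)
    qed
    then have "B j \<inter> B k = {}" if "j \<noteq> k" for j k using that by (metis Int_commute nat_neq_iff)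
    then show ?thesis unfolding disjoint_family_on_def by auto
  qed
  define Ev where "Ev k = {x\<in>space (P (D \<times> B k)). 1 / 2 ^ d \<le> sqsum (blk (B k)) x / (\<Gamma> (Suc k))\<^sup>2}" for k
  define E where "E k = {x\<in>space (P ?V). restrict x (D \<times> B k) \<in> Ev k}" for k
  have Ev_sets: "Ev k \<in> sets (P (D \<times> B k))" for k
  proof -
    have [measurable]: "sqsum (blk (B k)) \<in> borel_measurable (P (D \<times> B k))"
      by (intro sqsum_measurable blk_sites)
    show ?thesis unfolding Ev_def by measurable
  qed
  have restr: "(\<lambda>x. restrict x (D \<times> B k)) \<in> P ?V \<rightarrow>\<^sub>M P (D \<times> B k)" for k
    by (intro measurable_restrict_subset BV)
  have E_sets: "E k \<in> sets (P ?V)" for k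
    unfolding E_def using measurable_sets[OF restr Ev_sets] by (simp add: vimage_def Int_def conj_commute)
  have E_prob: "prob (E k) = measure (P (D \<times> B k)) (Ev k)" for k
  proof -
    have "measure (P (D \<times> B k)) (Ev k) = measure (distr (P ?V) (P (D \<times> B k)) (\<lambda>x. \<lambda>v\<in>D \<times> B k. x (id v))) (Ev k)"
      using BV by (subst PiM_reindex[OF prob_\<mu>]) auto
    also have "\<dots> = prob (E k)"
      using restr Ev_sets by (subst measure_distr) (auto simp: E_def vimage_def Int_def conj_commute)
    finally show ?thesis by simp
  qed
  have E_iff: "x \<in> E k \<longleftrightarrow> 1 / 2 ^ d \<le> sqsum (blk (B k)) x / (\<Gamma> (Suc k))\<^sup>2" if x: "x \<in> space (P ?V)" for x k
  proof -
    have "pick u (restrict x (D \<times> B k)) = pick u x" if "u \<in> blk (B k)" for u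
      using blk_sites[OF that] by (simp add: pick_def fun_eq_iff image_subset_iff)
    then have "sqsum (blk (B k)) (restrict x (D \<times> B k)) = sqsum (blk (B k)) x"
      unfolding sqsum_def by (intro sum.cong) auto
    then show ?thesis using x measurable_space[OF restr x, of k] by (simp add: E_def Ev_def)
  qed
  have "AE x in P ?V. eventually (\<lambda>k. x \<notin> E k) sequentially"
    using conv AE_space
  proof eventually_elim
    case (elim x)
    have "strict_mono (\<lambda>k. 2 ^ Suc k :: nat)" by (intro strict_monoI power_strict_increasing) auto
    from LIMSEQ_subseq_LIMSEQ[OF elim(1) this]
    have "(\<lambda>k. 1 / (\<Gamma> (Suc k))\<^sup>2 * sqsum (dec (2 ^ Suc k)) x) \<longlonglongrightarrow> 0" by (simp add: o_def)
    then have "eventually (\<lambda>k. 1 / (\<Gamma> (Suc k))\<^sup>2 * sqsum (dec (2 ^ Suc k)) x < 1 / 2 ^ d) sequentially"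
      by (rule order_tendstoD) simp
    then show ?case
    proof eventually_elim
      case (elim k)
      have "sqsum (blk (B k)) x \<le> sqsum (dec (2 ^ Suc k)) x"
        unfolding sqsum_def dec_eq_blk
      proof (rule sum_mono2)
        show "blk (B k) \<subseteq> blk {1..2 ^ Suc k}"
          using B(3)[of k] unfolding blk_def by (intro image_mono PiE_mono) auto
      qed auto
      then have "sqsum (blk (B k)) x / (\<Gamma> (Suc k))\<^sup>2 \<le> 1 / (\<Gamma> (Suc k))\<^sup>2 * sqsum (dec (2 ^ Suc k)) x"
        by (simp add: divide_right_mono)
      then show ?case using elim E_iff[OF \<open>x \<in> space _\<close>, of k] by linarith
    qed
  qed
  moreover have "prob (\<Inter>k\<in>J. space (P ?V) - E k) = (\<Prod>k\<in>J. 1 - prob (E k))" if J: "finite J" "J \<noteq> {}" for J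
  proof -
    have compl: "space (P ?V) - E k = {x\<in>space (P ?V). restrict x (D \<times> B k) \<in> space (P (D \<times> B k)) - Ev k}" for k
      using measurable_space[OF restr] by (auto simp: E_def)
    have "(1, 1) \<in> ?V" using d_pos by simp
    then have "prob (\<Inter>k\<in>J. space (P ?V) - E k) = (\<Prod>k\<in>J. prob (space (P ?V) - E k))"
      unfolding compl using Ev_sets by (intro prob_disjoint_blocks BV disj J) auto
    then show ?thesis using E_sets by (simp add: prob_compl)
  qed
  ultimately have E_sum: "summable (\<lambda>k. prob (E k))"
    by (intro borel_cantelli_converse[OF prob_P E_sets]) auto
  define c where "c = (2 ^ d * (2 ^ d * (4 * (1 + 4 ^ d))) :: real)"
  have "hit ?V (dec (2 ^ Suc k)) (space (P D) - A (Suc k) d) \<le> c * prob (E k)" for k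
  proof -
    let ?S = "space (P D) - A (Suc k) d"
    let ?Is = "{I. I \<subseteq> D \<and> card I < d}"
    have finI: "finite ?Is" by (rule finite_subset[of _ "Pow D"]) auto
    have cardI: "card ?Is \<le> 2 ^ d"
      using card_mono[of "Pow D" ?Is] by (auto simp: card_Pow)
    define \<phi> where "\<phi> = (\<lambda>(r::nat, j). (r, j + 2 ^ k :: nat))"
    have "hit ?V (dec (2 ^ Suc k)) ?S \<le> real 2 ^ d * hit ?V (dec (2 ^ k)) ?S"
      using hit_dec_scale[of "2 ^ k" ?S 2, OF one_le_power] by simp
    moreover have "hit ?V (dec (2 ^ k)) ?S \<le> hit (D \<times> B k) (blk (B k)) ?S"
    proof -
      have "hit ?V (dec (2 ^ k)) ?S = hit (D \<times> {1..2 ^ k}) (dec (2 ^ k)) ?S"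
        using dec_sites by (intro hit_sub) auto
      also have "\<dots> = hit (D \<times> B k) ((\<circ>) \<phi> ` dec (2 ^ k)) ?S"
        using dec_sites by (intro hit_image[symmetric]) (auto simp: \<phi>_def inj_on_def B_def)
      also have "\<dots> \<le> hit (D \<times> B k) (blk (B k)) ?S"
      proof (rule hit_mono)
        fix u assume "u \<in> (\<circ>) \<phi> ` dec (2 ^ k)"
        then obtain i where i: "i \<in> D \<rightarrow>\<^sub>E {1..2 ^ k}" and u: "u = (\<lambda>r. (r, i r + 2 ^ k))"
          by (auto simp: dec_eq_blk blk_def \<phi>_def fun_eq_iff)
        have "(\<lambda>r\<in>D. i r + 2 ^ k) \<in> D \<rightarrow>\<^sub>E B k" using i by (fastforce simp: B_def PiE_iff)
        then have "(\<lambda>r. (r, (\<lambda>r\<in>D. i r + 2 ^ k) r)) \<in> blk (B k)" unfolding blk_def by (rule imageI)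
        then show "\<exists>u'\<in>blk (B k). \<forall>r\<in>D. u r = u' r" by (rule bexI[rotated]) (simp add: u)
      qed (use B blk_sites in auto)
      finally show ?thesis .
    qed
    moreover have "hit (D \<times> B k) (blk (B k)) ?S \<le> (\<Sum>I\<in>?Is. hit (D \<times> B k) (blk (B k)) (bad (Suc k) I))"
    proof -
      interpret Q: prob_space "P (D \<times> B k)" by (rule prob_P)
      have evs: "{x\<in>space (P (D \<times> B k)). \<exists>u\<in>blk (B k). pick u x \<in> bad (Suc k) I} \<in> sets (P (D \<times> B k))"
        if "I \<in> ?Is" for I
        by (rule hit_event[OF finite_blk[OF B(1)] blk_sites bad_sets]) (use that in auto)
      have "hit (D \<times> B k) (blk (B k)) ?S
          \<le> Q.prob (\<Union>I\<in>?Is. {x\<in>space (P (D \<times> B k)). \<exists>u\<in>blk (B k). pick u x \<in> bad (Suc k) I})"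
        unfolding hit_def
      proof (rule Q.finite_measure_mono)
        show "{x\<in>space (P (D \<times> B k)). \<exists>u\<in>blk (B k). pick u x \<in> ?S}
            \<subseteq> (\<Union>I\<in>?Is. {x\<in>space (P (D \<times> B k)). \<exists>u\<in>blk (B k). pick u x \<in> bad (Suc k) I})"
        proof
          fix x assume "x \<in> {x\<in>space (P (D \<times> B k)). \<exists>u\<in>blk (B k). pick u x \<in> ?S}"
          then obtain u where u: "x \<in> space (P (D \<times> B k))" "u \<in> blk (B k)" "pick u x \<in> ?S" by blast
          then obtain I where "I \<subseteq> D" "card I < d" "pick u x \<in> bad (Suc k) I"
            using not_A_imp_bad[of "pick u x" "Suc k"] by blast
          then show "x \<in> (\<Union>I\<in>?Is. {x\<in>space (P (D \<times> B k)). \<exists>u\<in>blk (B k). pick u x \<in> bad (Suc k) I})"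
            using u by blast
        qed
        show "(\<Union>I\<in>?Is. {x\<in>space (P (D \<times> B k)). \<exists>u\<in>blk (B k). pick u x \<in> bad (Suc k) I}) \<in> sets (P (D \<times> B k))"
          by (rule sets.finite_UN[OF finI evs])
      qed
      also have "\<dots> \<le> (\<Sum>I\<in>?Is. hit (D \<times> B k) (blk (B k)) (bad (Suc k) I))"
        unfolding hit_def using evs by (intro Q.finite_measure_subadditive_finite finI) blast
      finally show ?thesis .
    qed
    moreover have "\<dots> \<le> (\<Sum>I\<in>?Is. 4 * (1 + 4 ^ d) * prob (E k))"
      unfolding E_prob Ev_def using B by (intro sum_mono hit_bad_le_large_sqsum) auto
    moreover have "\<dots> \<le> 2 ^ d * (4 * (1 + 4 ^ d) * prob (E k))"
    proof -
      have "real (card ?Is) \<le> 2 ^ d" using cardI by (metis of_nat_le_iff of_nat_numeral of_nat_power)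
      then show ?thesis by (simp only: sum_constant, intro mult_right_mono) auto
    qed
    ultimately have "hit ?V (dec (2 ^ k)) ?S \<le> 2 ^ d * (4 * (1 + 4 ^ d) * prob (E k))"
      and "hit ?V (dec (2 ^ Suc k)) ?S \<le> 2 ^ d * hit ?V (dec (2 ^ k)) ?S" by auto
    then have "hit ?V (dec (2 ^ Suc k)) ?S \<le> 2 ^ d * (2 ^ d * (4 * (1 + 4 ^ d) * prob (E k)))"
      by (meson mult_left_mono order_trans zero_le_numeral zero_le_power)
    then show ?thesis by (simp only: c_def mult.assoc)
  qed
  then show ?thesis
    by (intro summable_comparison_test'[OF summable_mult[OF E_sum, of c], where N=0])
       (simp only: real_norm_def abs_of_nonneg[OF hit_nonneg])
qed

end

section \<open>Signed sums over random points\<close>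

definition fair_sign :: "real measure" where
  "fair_sign = distr (measure_pmf (pmf_of_set {-1, 1})) borel (\<lambda>x. x)"

lemma sets_fair_sign [simp, measurable_cong]: "sets fair_sign = sets borel"
  by (simp add: fair_sign_def)

lemma space_fair_sign [simp]: "space fair_sign = UNIV"
  by (simp add: fair_sign_def)

lemma prob_space_fair_sign: "prob_space fair_sign"
  unfolding fair_sign_def by (intro prob_space.prob_space_distr prob_space_measure_pmf) simp

lemma nn_integral_fair_sign:
  assumes "f \<in> borel_measurable borel"
  shows "(\<integral>\<^sup>+x. f x \<partial>fair_sign) = (f 1 + f (- 1)) / 2"
  unfolding fair_sign_def using assms
  by (subst nn_integral_distr) (simp_all add: nn_integral_pmf_of_set add.commute)

text \<open>The two atoms carry the total mass \<open>1\<close>, which determines the law.\<close>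

lemma distr_eq_fair_sign:
  assumes "prob_space M" and X [measurable]: "X \<in> borel_measurable M"
    and "measure M {\<omega>\<in>space M. X \<omega> = 1} = 1 / 2" "measure M {\<omega>\<in>space M. X \<omega> = - 1} = 1 / 2"
  shows "distr M borel X = fair_sign"
proof (rule measure_eqI)
  interpret prob_space M by fact
  fix S assume "S \<in> sets (distr M borel X)"
  then have S [measurable]: "S \<in> sets borel" by simp
  let ?p = "{\<omega>\<in>space M. X \<omega> = 1}" and ?n = "{\<omega>\<in>space M. X \<omega> = - 1}"
  have "prob (?p \<union> ?n) = prob ?p + prob ?n"
    by (intro finite_measure_Union) auto
  then have "AE \<omega> in M. \<omega> \<in> ?p \<union> ?n"
    using assms by (intro AE_in_set_eq_1[THEN iffD2]) auto
  then have "AE \<omega> in M. indicator S (X \<omega>) = indicator S 1 * indicator ?p \<omega> + indicator S (- 1) * (indicator ?n \<omega> :: ennreal)"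
    by eventually_elim (auto simp: indicator_def)
  then have "(\<integral>\<^sup>+\<omega>. indicator S (X \<omega>) \<partial>M)
      = (\<integral>\<^sup>+\<omega>. indicator S 1 * indicator ?p \<omega> + indicator S (- 1) * indicator ?n \<omega> \<partial>M)"
    by (rule nn_integral_cong_AE)
  also have "\<dots> = indicator S 1 * emeasure M ?p + indicator S (- 1) * emeasure M ?n"
    by (simp add: nn_integral_add nn_integral_cmult)
  also have "\<dots> = (indicator S 1 + indicator S (- 1)) / 2"
  proof -
    have half: "ennreal (1 / 2) = 1 / 2" using ennreal_divide_numeral[of 1 "Num.Bit0 Num.One"] by simp
    show ?thesis
      unfolding emeasure_eq_measure assms half by (simp add: divide_ennreal_def distrib_right)
  qed
  finally have "emeasure (distr M borel X) S = (\<integral>\<^sup>+x. indicator S x \<partial>fair_sign)"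
    by (subst nn_integral_fair_sign) (simp_all add: nn_integral_indicator[symmetric] nn_integral_distr del: nn_integral_indicator)
  then show "emeasure (distr M borel X) S = emeasure fair_sign S" by simp
qed simp

lemma nn_integral_finite_signs:
  assumes "finite J" "f \<in> borel_measurable (Pi\<^sub>M J (\<lambda>_. fair_sign))"
  shows "(\<integral>\<^sup>+s. f s \<partial>Pi\<^sub>M J (\<lambda>_. fair_sign)) = (\<Sum>s\<in>signs J. f s) / 2 ^ card J"
  using assms
proof (induction J arbitrary: f rule: finite_induct)
  case empty
  then show ?case by (simp add: signs_def PiM_empty nn_integral_count_space_finite divide_ennreal_def)
next
  case (insert j J)
  interpret prob_space fair_sign by (rule prob_space_fair_sign)
  interpret product_prob_space "\<lambda>_. fair_sign" UNIV by unfold_locales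
  have up: "(\<lambda>s. f (s(j := c))) \<in> borel_measurable (Pi\<^sub>M J (\<lambda>_. fair_sign))" for c
    by (rule measurable_compose[OF _ insert.prems], rule measurable_fun_upd[where J=J]) auto
  have inv: "inverse (2 * 2 ^ card J :: ennreal) = inverse 2 * inverse (2 ^ card J)"
    by (rule ennreal_inverse_mult') simp
  have "(\<integral>\<^sup>+s. f s \<partial>Pi\<^sub>M (insert j J) (\<lambda>_. fair_sign))
      = (\<integral>\<^sup>+s. (\<integral>\<^sup>+y. f (s(j := y)) \<partial>fair_sign) \<partial>Pi\<^sub>M J (\<lambda>_. fair_sign))"
    using insert by (intro product_nn_integral_insert) auto
  also have "\<dots> = (\<integral>\<^sup>+s. (f (s(j := 1)) + f (s(j := - 1))) / 2 \<partial>Pi\<^sub>M J (\<lambda>_. fair_sign))"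
  proof (intro nn_integral_cong nn_integral_fair_sign)
    fix s :: "'a \<Rightarrow> real" assume s: "s \<in> space (Pi\<^sub>M J (\<lambda>_. fair_sign))"
    have "(\<lambda>y. s(j := y)) \<in> fair_sign \<rightarrow>\<^sub>M Pi\<^sub>M (insert j J) (\<lambda>_. fair_sign)"
      by (rule measurable_fun_upd[where J=J]) (use s in auto)
    then show "(\<lambda>y. f (s(j := y))) \<in> borel_measurable borel"
      using measurable_compose[OF _ insert.prems] by (metis measurable_cong_sets sets_fair_sign)
  qed
  also have "\<dots> = (\<Sum>s\<in>signs J. (f (s(j := 1)) + f (s(j := - 1))) / 2) / 2 ^ card J"
    using up[of 1] up[of "- 1"] by (intro insert.IH) (simp del: fun_upd_apply)
  also have "\<dots> = (\<Sum>s\<in>signs (insert j J). f s) / 2 ^ card (insert j J)"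
    using insert.hyps inv
    by (simp add: sum_signs_insert sum_divide_distrib[symmetric] ennreal_divide_times divide_ennreal_def
        mult_ac sum_distrib_left[symmetric])
  finally show ?case .
qed

lemma nn_integral_signs:
  assumes "finite J" "J \<subseteq> V" "f \<in> borel_measurable (Pi\<^sub>M J (\<lambda>_. fair_sign))"
  shows "(\<integral>\<^sup>+e. f (restrict e J) \<partial>Pi\<^sub>M V (\<lambda>_. fair_sign)) = (\<Sum>s\<in>signs J. f s) / 2 ^ card J"
  using nn_integral_reindex[OF prob_space_fair_sign, of id J V f] assms nn_integral_finite_signs[OF assms(1,3)]
  by (simp add: restrict_def)

lemma walsh_measurable [measurable]:
  assumes "\<T> \<subseteq> Pow J"
  shows "walsh a \<T> \<in> borel_measurable (Pi\<^sub>M J (\<lambda>_. fair_sign))"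
  unfolding walsh_def[abs_def]
proof (intro borel_measurable_sum borel_measurable_times borel_measurable_prod borel_measurable_const)
  fix T j assume "T \<in> \<T>" "j \<in> T"
  then have "j \<in> J" using assms by auto
  from measurable_component_singleton[OF this, of "\<lambda>_. fair_sign"]
  show "(\<lambda>s. s j) \<in> borel_measurable (Pi\<^sub>M J (\<lambda>_. fair_sign))"
    by (simp add: measurable_cong_sets[OF refl sets_fair_sign])
qed

lemma measure_tendsto_zero:
  assumes "prob_space M" and E: "\<And>n::nat. E n \<in> sets M" and "AE x in M. eventually (\<lambda>n. x \<notin> E n) sequentially"
  shows "(\<lambda>n. measure M (E n)) \<longlonglongrightarrow> 0"
proof -
  interpret prob_space M by fact
  have "(\<lambda>n. \<integral>x. indicator (E n) x \<partial>M) \<longlonglongrightarrow> (\<integral>x. (0::real) \<partial>M)"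
  proof (rule integral_dominated_convergence[where w="\<lambda>_. 1"])
    show "AE x in M. (\<lambda>n. indicator (E n) x :: real) \<longlonglongrightarrow> 0"
      using assms(3)
    proof eventually_elim
      case (elim x)
      then have "eventually (\<lambda>n. indicator (E n) x = (0::real)) sequentially"
        by eventually_elim simp
      then show ?case by (rule tendsto_eventually)
    qed
  qed (use E in \<open>auto simp: indicator_def\<close>)
  then show ?thesis using E by simp
qed

context kernel
begin

abbreviation R :: "'w set \<Rightarrow> ('w \<Rightarrow> real) measure" where "R W \<equiv> Pi\<^sub>M W (\<lambda>_. fair_sign)"

definition signed_sum :: "(nat \<Rightarrow> 'v) set \<Rightarrow> ((nat \<Rightarrow> 'e) \<Rightarrow> real) \<Rightarrow> ('v \<Rightarrow> 'e) \<Rightarrow> ('v \<Rightarrow> real) \<Rightarrow> real" where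
  "signed_sum U g x e = (\<Sum>u\<in>U. (\<Prod>r\<in>D. e (u r)) * g (pick u x))"

end

text \<open>What the signed sums over increasing multiindices and over decoupled multiindices have in common: \<open>J n\<close>
  is the set of sites available at time \<open>n\<close>, and a multiindex is in \<open>U n\<close> as soon as its sites are.
  Different multiindices have different sets of sites, so the signed sum is a polynomial in the signs with
  one coefficient per multiindex.\<close>

locale sign_system = kernel \<mu> d h \<gamma> C
  for \<mu> :: "'e measure" and d h \<gamma> C +
  fixes V :: "'v set" and U :: "nat \<Rightarrow> (nat \<Rightarrow> 'v) set" and J :: "nat \<Rightarrow> 'v set"
  assumes finite_U: "finite (U n)" and finite_J: "finite (J n)" and J_V: "J n \<subseteq> V"
    and J_mono: "m \<le> n \<Longrightarrow> J m \<subseteq> J n"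
    and U_inj: "u \<in> U n \<Longrightarrow> inj_on u {1..d}"
    and U_J: "u \<in> U n \<Longrightarrow> u ` {1..d} \<subseteq> J n"
    and U_mono: "m \<le> n \<Longrightarrow> U m \<subseteq> U n"
    and U_restrict: "m \<le> n \<Longrightarrow> u \<in> U n \<Longrightarrow> u ` {1..d} \<subseteq> J m \<Longrightarrow> u \<in> U m"
    and U_image_inj: "inj_on (\<lambda>u. u ` {1..d}) (U n)"
    and card_U: "card (U n) \<le> n ^ d"
begin

abbreviation chaos :: "((nat \<Rightarrow> 'e) \<Rightarrow> real) \<Rightarrow> nat \<Rightarrow> ('v \<Rightarrow> 'e) \<Rightarrow> ('v \<Rightarrow> real) \<Rightarrow> real" where
  "chaos g n \<equiv> signed_sum (U n) g"

text \<open>The multiindex is recovered from its set of sites; outside the image of \<open>U N\<close> the value is arbitrary.\<close>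

definition coef :: "((nat \<Rightarrow> 'e) \<Rightarrow> real) \<Rightarrow> nat \<Rightarrow> ('v \<Rightarrow> 'e) \<Rightarrow> 'v set \<Rightarrow> real" where
  "coef g N x T = g (pick (the_inv_into (U N) (\<lambda>u. u ` D) T) x)"

definition supp :: "nat \<Rightarrow> 'v set set" where "supp n = (\<lambda>u. u ` D) ` U n"

lemma U_V: "u \<in> U n \<Longrightarrow> u ` D \<subseteq> V"
  using U_J J_V by blast

lemma prob_R: "prob_space (R W)"
  by (intro prob_space_PiM prob_space_fair_sign)

lemma supp_restrict: "n \<le> N \<Longrightarrow> {T\<in>supp N. T \<subseteq> J n} = supp n"
  unfolding supp_def using U_mono[where m=n and n=N] U_restrict[where m=n and n=N] U_J[where n=n] by blast

lemma supp_Pow: "supp n \<subseteq> Pow (J n)"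
  using U_J by (auto simp: supp_def)

lemma coef_image:
  assumes "u \<in> U N"
  shows "coef g N x (u ` D) = g (pick u x)"
  using the_inv_into_f_f[OF U_image_inj assms] by (simp add: coef_def)

lemma chaos_eq_walsh:
  assumes "n \<le> N"
  shows "chaos g n x e = walsh (coef g N x) {T\<in>supp N. T \<subseteq> J n} (restrict e (J N))"
proof -
  have "walsh (coef g N x) (supp n) (restrict e (J N))
      = (\<Sum>u\<in>U n. coef g N x (u ` D) * (\<Prod>j\<in>u ` D. restrict e (J N) j))"
    unfolding walsh_def supp_def by (simp add: sum.reindex[OF U_image_inj])
  also have "\<dots> = chaos g n x e"
    unfolding signed_sum_def
  proof (intro sum.cong refl)
    fix u assume u: "u \<in> U n"
    have uN: "u \<in> U N" using u U_mono[OF assms] by auto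
    have "(\<Prod>j\<in>u ` D. restrict e (J N) j) = (\<Prod>j\<in>u ` D. e j)"
      using U_J[OF uN] by (intro prod.cong) auto
    also have "\<dots> = (\<Prod>r\<in>D. e (u r))" by (simp add: prod.reindex[OF U_inj[OF u]])
    finally show "coef g N x (u ` D) * (\<Prod>j\<in>u ` D. restrict e (J N) j) = (\<Prod>r\<in>D. e (u r)) * g (pick u x)"
      by (simp only: coef_image[OF uN] mult.commute)
  qed
  finally show ?thesis unfolding supp_restrict[OF assms] by simp
qed

lemma coef_square_sum: "(\<Sum>T\<in>supp N. (coef g N x T)\<^sup>2) = (\<Sum>u\<in>U N. (g (pick u x))\<^sup>2)"
  unfolding supp_def by (simp add: sum.reindex[OF U_image_inj] coef_image)

lemma chaos_maximal_inequality:
  assumes t: "t > 0"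
  shows "emeasure (R V) {e\<in>space (R V). \<exists>n\<le>N. \<bar>chaos g n x e\<bar> \<ge> t}
    \<le> ennreal ((\<Sum>u\<in>U N. (g (pick u x))\<^sup>2) / t\<^sup>2)"
proof -
  define S where "S = {s\<in>space (R (J N)). \<exists>n\<le>N. \<bar>walsh (coef g N x) {T\<in>supp N. T \<subseteq> J n} s\<bar> \<ge> t}"
  have [measurable]: "walsh (coef g N x) {T\<in>supp N. T \<subseteq> J n} \<in> borel_measurable (R (J N))" for n
    using supp_Pow by (intro walsh_measurable) auto
  have S [measurable]: "S \<in> sets (R (J N))" unfolding S_def by measurable
  have restr: "(\<lambda>e. restrict e (J N)) \<in> R V \<rightarrow>\<^sub>M R (J N)"
    by (intro measurable_restrict_subset J_V)
  have ev: "{e\<in>space (R V). \<exists>n\<le>N. \<bar>chaos g n x e\<bar> \<ge> t} = (\<lambda>e. restrict e (J N)) -` S \<inter> space (R V)"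
    using measurable_space[OF restr] by (auto simp: S_def chaos_eq_walsh[of _ N])
  have sub: "s \<in> space (R (J N))" if "s \<in> signs (J N)" for s
    using that by (auto simp: signs_def space_PiM PiE_def)
  have "emeasure (R V) {e\<in>space (R V). \<exists>n\<le>N. \<bar>chaos g n x e\<bar> \<ge> t}
      = (\<integral>\<^sup>+e. indicator ((\<lambda>e. restrict e (J N)) -` S \<inter> space (R V)) e \<partial>R V)"
    unfolding ev using restr by (subst nn_integral_indicator) auto
  also have "\<dots> = (\<integral>\<^sup>+e. indicator S (restrict e (J N)) \<partial>R V)"
    by (intro nn_integral_cong) (auto simp: indicator_def)
  also have "\<dots> = (\<Sum>s\<in>signs (J N). indicator S s) / 2 ^ card (J N)"
    by (intro nn_integral_signs finite_J J_V) measurable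
  also have "(\<Sum>s\<in>signs (J N). indicator S s :: ennreal) = of_nat (card (signs (J N) \<inter> S))"
    using finite_J by (simp add: indicator_def sum.If_cases Int_def)
  also have "of_nat (card (signs (J N) \<inter> S)) / 2 ^ card (J N) = ennreal (real (card (signs (J N) \<inter> S)) / 2 ^ card (J N))"
    unfolding ennreal_two_power ennreal_of_nat_eq_real_of_nat by (rule divide_ennreal) auto
  also have "\<dots> \<le> ennreal ((\<Sum>u\<in>U N. (g (pick u x))\<^sup>2) / t\<^sup>2)"
  proof (rule ennreal_leI)
    have "t\<^sup>2 * real (card {s\<in>signs (J N). \<exists>n\<le>N. \<bar>walsh (coef g N x) {T\<in>supp N. T \<subseteq> J n} s\<bar> \<ge> t})
        \<le> 2 ^ card (J N) * (\<Sum>T\<in>supp N. (coef g N x T)\<^sup>2)"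
      by (rule walsh_maximal_inequality) (use finite_J J_mono supp_Pow t in auto)
    also have "{s\<in>signs (J N). \<exists>n\<le>N. \<bar>walsh (coef g N x) {T\<in>supp N. T \<subseteq> J n} s\<bar> \<ge> t} = signs (J N) \<inter> S"
      using sub by (auto simp: S_def)
    finally show "real (card (signs (J N) \<inter> S)) / 2 ^ card (J N) \<le> (\<Sum>u\<in>U N. (g (pick u x))\<^sup>2) / t\<^sup>2"
      unfolding coef_square_sum using t by (simp add: field_simps)
  qed
  finally show ?thesis .
qed

text \<open>The square of the signed sum has mean \<open>\<sigma>\<close> and second moment at most \<open>9 ^ d * \<sigma>\<^sup>2\<close>, so the Paley-Zygmund
  inequality gives a bound that does not depend on the coefficients.\<close>

lemma chaos_lower_tail:
  assumes "\<sigma> = (\<Sum>u\<in>U N. (g (pick u x))\<^sup>2)" "\<sigma> > 0"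
  shows "1 / (4 * 9 ^ d) \<le> measure (R V) {e\<in>space (R V). \<sigma> / 2 \<le> (chaos g N x e)\<^sup>2}"
proof -
  let ?a = "\<lambda>T. if T \<in> supp N then coef g N x T else 0"
  define W where "W = walsh ?a (Pow (J N))"
  have W: "W s = walsh (coef g N x) (supp N) s" for s
    unfolding W_def walsh_def using supp_Pow finite_J
    by (intro sum.mono_neutral_cong_right) auto
  have chaosW: "chaos g N x e = W (restrict e (J N))" for e
    using chaos_eq_walsh[OF order_refl, of N g x e] unfolding W supp_restrict[OF order_refl] .
  have [measurable]: "W \<in> borel_measurable (R (J N))" unfolding W_def by (rule walsh_measurable) simp
  have restr [measurable]: "(\<lambda>e. restrict e (J N)) \<in> R V \<rightarrow>\<^sub>M R (J N)"
    by (intro measurable_restrict_subset J_V)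
  have coefs: "(\<Sum>T\<in>Pow (J N). (?a T)\<^sup>2) = \<sigma>"
    unfolding assms(1) coef_square_sum[symmetric] using supp_Pow finite_J
    by (intro sum.mono_neutral_cong_right) auto
  have avg: "(\<integral>\<^sup>+e. ennreal (f (W (restrict e (J N)))) \<partial>R V) = ennreal ((\<Sum>s\<in>signs (J N). f (W s)) / 2 ^ card (J N))"
    if [measurable]: "f \<in> borel_measurable borel" and f0: "\<And>w. f w \<ge> 0" for f
  proof -
    have "(\<integral>\<^sup>+e. ennreal (f (W (restrict e (J N)))) \<partial>R V) = (\<Sum>s\<in>signs (J N). ennreal (f (W s))) / 2 ^ card (J N)"
      by (rule nn_integral_signs[OF finite_J J_V]) measurable
    also have "\<dots> = ennreal (\<Sum>s\<in>signs (J N). f (W s)) / ennreal (2 ^ card (J N))"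
      unfolding ennreal_two_power using f0 by (simp add: sum_ennreal)
    also have "\<dots> = ennreal ((\<Sum>s\<in>signs (J N). f (W s)) / 2 ^ card (J N))"
      using f0 by (intro divide_ennreal sum_nonneg) auto
    finally show ?thesis .
  qed
  have E2: "(\<integral>\<^sup>+e. ennreal ((W (restrict e (J N)))\<^sup>2) \<partial>R V) = ennreal \<sigma>"
  proof -
    have "(\<Sum>s\<in>signs (J N). (W s)\<^sup>2) = 2 ^ card (J N) * \<sigma>"
      unfolding W_def coefs[symmetric] using finite_J by (intro walsh_square_sum) auto
    then show ?thesis using avg[of "\<lambda>w. w\<^sup>2"] by simp
  qed
  have E4: "(\<integral>\<^sup>+e. (ennreal ((W (restrict e (J N)))\<^sup>2))\<^sup>2 \<partial>R V) \<le> ennreal (\<sigma> * (9 ^ d * \<sigma>))"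
  proof -
    have "(\<Sum>s\<in>signs (J N). (W s) ^ 4) \<le> 2 ^ card (J N) * 9 ^ d * (\<Sum>T\<in>Pow (J N). (?a T)\<^sup>2)\<^sup>2"
      unfolding W_def
    proof (rule walsh_fourth_moment[OF finite_J])
      fix T assume "T \<subseteq> J N" "d < card T"
      moreover have "card T \<le> d" if "T \<in> supp N"
        using that card_image_le[of D] by (fastforce simp: supp_def)
      ultimately show "?a T = 0" by auto
    qed
    then have "(\<Sum>s\<in>signs (J N). ((W s)\<^sup>2)\<^sup>2) / 2 ^ card (J N) \<le> \<sigma> * (9 ^ d * \<sigma>)"
      unfolding coefs by (simp add: field_simps power2_eq_square power4_eq_xxxx)
    moreover have "(ennreal ((W (restrict e (J N)))\<^sup>2))\<^sup>2 = ennreal (((W (restrict e (J N)))\<^sup>2)\<^sup>2)" for e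
      by (rule ennreal_power) simp
    ultimately show ?thesis using avg[of "\<lambda>w. (w\<^sup>2)\<^sup>2"] by (simp add: ennreal_leI del: power2_eq_square)
  qed
  have "\<sigma> \<le> 4 * (9 ^ d * \<sigma>) * measure (R V) {e\<in>space (R V). ennreal (\<sigma> / 2) \<le> ennreal ((W (restrict e (J N)))\<^sup>2)}"
    by (rule paley_zygmund[OF prob_R _ E2 _ _ E4]) (use assms(2) in auto)
  then have "\<sigma> * 1 \<le> \<sigma> * (4 * 9 ^ d * measure (R V) {e\<in>space (R V). \<sigma> / 2 \<le> (chaos g N x e)\<^sup>2})"
    using assms(2) by (simp add: chaosW mult_ac)
  then have "1 \<le> 4 * 9 ^ d * measure (R V) {e\<in>space (R V). \<sigma> / 2 \<le> (chaos g N x e)\<^sup>2}"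
    using assms(2) by (subst (asm) mult_le_cancel_left_pos) auto
  then show ?thesis by (simp add: field_simps)
qed

lemma chaos_measurable_e: "chaos g n x \<in> borel_measurable (R V)"
proof -
  have "chaos g n x = (\<lambda>e. walsh (coef g n x) (supp n) (restrict e (J n)))"
    using chaos_eq_walsh[OF order_refl, of n g x] unfolding supp_restrict[OF order_refl] by (intro ext)
  also have "\<dots> \<in> borel_measurable (R V)"
    by (rule measurable_compose[OF measurable_restrict_subset[OF J_V] walsh_measurable[OF supp_Pow]])
  finally show ?thesis .
qed

text \<open>If the normalised sums of squares exceeded \<open>\<eta>\<close> infinitely often, the lower tail bound would keep the
  signed sums away from zero with a fixed probability infinitely often.\<close>

lemma chaos_imp_squares_fixed:
  assumes "AE e in R V. (\<lambda>n. 1 / \<gamma> n * chaos h n x e) \<longlonglongrightarrow> 0"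
  shows "(\<lambda>n. 1 / (\<gamma> n)\<^sup>2 * sqsum (U n) x) \<longlonglongrightarrow> 0"
proof (rule order_tendstoI)
  fix a :: real assume "a < 0"
  moreover have "0 \<le> 1 / (\<gamma> n)\<^sup>2 * sqsum (U n) x" for n by (simp add: sqsum_def sum_nonneg)
  ultimately show "\<forall>\<^sub>F n in sequentially. a < 1 / (\<gamma> n)\<^sup>2 * sqsum (U n) x"
    by (intro always_eventually allI) (rule less_le_trans)
next
  fix \<eta> :: real assume \<eta>: "\<eta> > 0"
  define E where "E n = {e\<in>space (R V). \<eta> / 2 \<le> (1 / \<gamma> n * chaos h n x e)\<^sup>2}" for n
  have E_sets: "E n \<in> sets (R V)" for n
    unfolding E_def using chaos_measurable_e[of n h x] by measurable
  have "(\<lambda>n. measure (R V) (E n)) \<longlonglongrightarrow> 0"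
  proof (rule measure_tendsto_zero[OF prob_R E_sets])
    show "AE e in R V. \<forall>\<^sub>F n in sequentially. e \<notin> E n"
      using assms
    proof eventually_elim
      case (elim e)
      have "(\<lambda>n. (1 / \<gamma> n * chaos h n x e)\<^sup>2) \<longlonglongrightarrow> 0" using tendsto_power[OF elim, of 2] by simp
      then have "\<forall>\<^sub>F n in sequentially. (1 / \<gamma> n * chaos h n x e)\<^sup>2 < \<eta> / 2"
        by (rule order_tendstoD(2)) (use \<eta> in simp)
      then show ?case by eventually_elim (auto simp: E_def)
    qed
  qed
  then have "\<forall>\<^sub>F n in sequentially. measure (R V) (E n) < 1 / (4 * 9 ^ d)"
    by (rule order_tendstoD) simp
  then show "\<forall>\<^sub>F n in sequentially. 1 / (\<gamma> n)\<^sup>2 * sqsum (U n) x < \<eta>"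
    using eventually_ge_at_top[of 1]
  proof eventually_elim
    case (elim n)
    show ?case
    proof (rule ccontr)
      assume "\<not> ?thesis"
      then have big: "\<eta> * (\<gamma> n)\<^sup>2 \<le> sqsum (U n) x" using \<gamma>_pos[OF elim(2)] by (simp add: field_simps not_less)
      moreover have "0 < \<eta> * (\<gamma> n)\<^sup>2" using \<gamma>_pos[OF elim(2)] \<eta> by simp
      ultimately have pos: "0 < sqsum (U n) x" by linarith
      have "1 / (4 * 9 ^ d) \<le> measure (R V) {e\<in>space (R V). sqsum (U n) x / 2 \<le> (chaos h n x e)\<^sup>2}"
        using pos by (intro chaos_lower_tail) (auto simp: sqsum_def)
      also have "\<dots> \<le> measure (R V) (E n)"
      proof (intro finite_measure.finite_measure_mono prob_space.finite_measure prob_R E_sets)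
        show "{e\<in>space (R V). sqsum (U n) x / 2 \<le> (chaos h n x e)\<^sup>2} \<subseteq> E n"
        proof safe
          fix e assume e: "e \<in> space (R V)" "sqsum (U n) x / 2 \<le> (chaos h n x e)\<^sup>2"
          then have "\<eta> * (\<gamma> n)\<^sup>2 / 2 \<le> (chaos h n x e)\<^sup>2" using big by linarith
          then have "\<eta> / 2 \<le> (1 / \<gamma> n * chaos h n x e)\<^sup>2"
            using \<gamma>_pos[OF elim(2)] by (simp add: field_simps power_mult_distrib power_divide)
          then show "e \<in> E n" using e by (simp add: E_def)
        qed
      qed
      finally show False using elim(1) by simp
    qed
  qed
qed

text \<open>The points and the signs are independent, so Fubini's theorem allows the points to be fixed.\<close>

lemma chaos_imp_squares:
  assumes "AE (x, e) in P V \<Otimes>\<^sub>M R V. (\<lambda>n. 1 / \<gamma> n * chaos h n x e) \<longlonglongrightarrow> 0"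
  shows "AE x in P V. (\<lambda>n. 1 / (\<gamma> n)\<^sup>2 * sqsum (U n) x) \<longlonglongrightarrow> 0"
proof -
  interpret p: prob_space "P V" by (rule prob_P)
  interpret r: prob_space "R V" by (rule prob_R)
  interpret pair_sigma_finite "P V" "R V" by unfold_locales
  have "AE x in P V. AE e in R V. (\<lambda>n. 1 / \<gamma> n * chaos h n x e) \<longlonglongrightarrow> 0"
    using AE_pair[OF assms] by simp
  then show ?thesis by eventually_elim (rule chaos_imp_squares_fixed)
qed

lemma chaos_measurable_pair:
  assumes [measurable]: "g \<in> borel_measurable (P D)"
  shows "(\<lambda>p. chaos g n (fst p) (snd p)) \<in> borel_measurable (P V \<Otimes>\<^sub>M R V)"
  unfolding signed_sum_def
proof (intro borel_measurable_sum borel_measurable_times borel_measurable_prod)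
  fix u assume u: "u \<in> U n"
  have [measurable]: "pick u \<in> P V \<rightarrow>\<^sub>M P D" by (rule pick_measurable[OF U_V[OF u]])
  show "(\<lambda>p. g (pick u (fst p))) \<in> borel_measurable (P V \<Otimes>\<^sub>M R V)" by measurable
  fix r assume "r \<in> D"
  then have "u r \<in> V" using U_V[OF u] by auto
  then have "(\<lambda>p. snd p (u r)) \<in> P V \<Otimes>\<^sub>M R V \<rightarrow>\<^sub>M fair_sign"
    by (intro measurable_compose[OF measurable_snd] measurable_component_singleton)
  then show "(\<lambda>p. snd p (u r)) \<in> borel_measurable (P V \<Otimes>\<^sub>M R V)"
    by (simp add: measurable_cong_sets[OF refl sets_fair_sign])
qed

lemma truncated_chaos_exceeds:
  fixes k :: nat
  assumes \<delta>: "\<delta> > 0"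
  defines "g \<equiv> \<lambda>y. h y * indicator (A k d) y"
  shows "emeasure (P V \<Otimes>\<^sub>M R V) {p\<in>space (P V \<Otimes>\<^sub>M R V). \<exists>n\<le>2 ^ k. \<delta> * \<Gamma> k \<le> \<bar>chaos g n (fst p) (snd p)\<bar>}
    \<le> ennreal (1 / \<delta>\<^sup>2) * (2 ^ (d * k) * (\<integral>\<^sup>+x. G k (A k d) x \<partial>P D))" (is "emeasure _ ?F \<le> _")
proof -
  interpret r: prob_space "R V" by (rule prob_R)
  have g [measurable]: "g \<in> borel_measurable (P D)" unfolding g_def by measurable
  have [measurable]: "(\<lambda>p. chaos g n (fst p) (snd p)) \<in> borel_measurable (P V \<Otimes>\<^sub>M R V)" for n
    by (rule chaos_measurable_pair[OF g])
  have F: "?F \<in> sets (P V \<Otimes>\<^sub>M R V)" by measurable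
  have Gpick: "(\<lambda>x. G k (A k d) (pick u x)) \<in> borel_measurable (P V)" if "u \<in> U (2 ^ k)" for u
    by (rule measurable_compose[OF pick_measurable[OF U_V[OF that]] measurable_G[OF sets_A]])
  have "emeasure (P V \<Otimes>\<^sub>M R V) ?F = (\<integral>\<^sup>+x. emeasure (R V) (Pair x -` ?F) \<partial>P V)"
    by (rule r.emeasure_pair_measure_alt[OF F])
  also have "\<dots> \<le> (\<integral>\<^sup>+x. ennreal (1 / \<delta>\<^sup>2) * (\<Sum>u\<in>U (2 ^ k). G k (A k d) (pick u x)) \<partial>P V)"
  proof (rule nn_integral_mono)
    fix x assume x: "x \<in> space (P V)"
    have "Pair x -` ?F = {e\<in>space (R V). \<exists>n\<le>2 ^ k. \<bar>chaos g n x e\<bar> \<ge> \<delta> * \<Gamma> k}"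
      using x by (auto simp: space_pair_measure)
    then have "emeasure (R V) (Pair x -` ?F) \<le> ennreal ((\<Sum>u\<in>U (2 ^ k). (g (pick u x))\<^sup>2) / (\<delta> * \<Gamma> k)\<^sup>2)"
      using chaos_maximal_inequality[of "\<delta> * \<Gamma> k" "2 ^ k" g x] \<delta> \<Gamma>_pos[of k] by simp
    also have "(\<Sum>u\<in>U (2 ^ k). (g (pick u x))\<^sup>2) / (\<delta> * \<Gamma> k)\<^sup>2 = 1 / \<delta>\<^sup>2 * (\<Sum>u\<in>U (2 ^ k). (g (pick u x))\<^sup>2 / (\<Gamma> k)\<^sup>2)"
      by (simp add: sum_divide_distrib[symmetric] power_mult_distrib)
    also have "ennreal \<dots> = ennreal (1 / \<delta>\<^sup>2) * (\<Sum>u\<in>U (2 ^ k). ennreal ((g (pick u x))\<^sup>2 / (\<Gamma> k)\<^sup>2))"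
      by (subst ennreal_mult) (auto intro!: sum_nonneg simp: sum_ennreal)
    also have "(\<Sum>u\<in>U (2 ^ k). ennreal ((g (pick u x))\<^sup>2 / (\<Gamma> k)\<^sup>2)) = (\<Sum>u\<in>U (2 ^ k). G k (A k d) (pick u x))"
      by (intro sum.cong refl) (auto simp: G_def g_def indicator_def)
    finally show "emeasure (R V) (Pair x -` ?F) \<le> ennreal (1 / \<delta>\<^sup>2) * (\<Sum>u\<in>U (2 ^ k). G k (A k d) (pick u x))" .
  qed
  also have "\<dots> = ennreal (1 / \<delta>\<^sup>2) * (\<Sum>u\<in>U (2 ^ k). \<integral>\<^sup>+x. G k (A k d) (pick u x) \<partial>P V)"
    using Gpick by (subst nn_integral_cmult) (auto simp: nn_integral_sum)
  also have "(\<Sum>u\<in>U (2 ^ k). \<integral>\<^sup>+x. G k (A k d) (pick u x) \<partial>P V) = (\<Sum>u\<in>U (2 ^ k). \<integral>\<^sup>+x. G k (A k d) x \<partial>P D)"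
    unfolding pick_def
    by (intro sum.cong refl nn_integral_reindex prob_\<mu> measurable_G sets_A U_inj U_V)
  also have "\<dots> = of_nat (card (U (2 ^ k))) * (\<integral>\<^sup>+x. G k (A k d) x \<partial>P D)" by simp
  also have "ennreal (1 / \<delta>\<^sup>2) * \<dots> \<le> ennreal (1 / \<delta>\<^sup>2) * (2 ^ (d * k) * (\<integral>\<^sup>+x. G k (A k d) x \<partial>P D))"
  proof (intro mult_left_mono mult_right_mono)
    have "(of_nat (card (U (2 ^ k))) :: ennreal) \<le> of_nat ((2 ^ k) ^ d)"
      by (rule of_nat_mono) (rule card_U)
    then show "(of_nat (card (U (2 ^ k))) :: ennreal) \<le> 2 ^ (d * k)"
      by (simp add: power_mult[symmetric] mult.commute)
  qed auto
  finally show ?thesis .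
qed

text \<open>Almost surely, for all large \<open>k\<close>, no point of the sample leaves the truncation of step \<open>k + 1\<close> and the
  truncated sums up to time \<open>2 ^ (k + 1)\<close> stay below \<open>\<gamma> (2 ^ (k + 1)) / (j + 1)\<close>.  For \<open>n\<close> between
  \<open>2 ^ k\<close> and \<open>2 ^ (k + 1)\<close> the doubling condition replaces this value of \<open>\<gamma>\<close> by \<open>C * \<gamma> n\<close>.\<close>

lemma truncated_imp_chaos:
  assumes mass: "(\<Sum>k. 2 ^ (d * Suc k) * (\<integral>\<^sup>+x. G (Suc k) (A (Suc k) d) x \<partial>P D)) < \<top>"
    and hits: "summable (\<lambda>k. hit V (U (2 ^ Suc k)) (space (P D) - A (Suc k) d))"
  shows "AE (x, e) in P V \<Otimes>\<^sub>M R V. (\<lambda>n. 1 / \<gamma> n * chaos h n x e) \<longlonglongrightarrow> 0"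
proof -
  interpret p: prob_space "P V" by (rule prob_P)
  interpret r: prob_space "R V" by (rule prob_R)
  interpret pr: pair_prob_space "P V" "R V" by unfold_locales
  let ?Q = "P V \<Otimes>\<^sub>M R V"
  define g where "g k y = h y * indicator (A (Suc k) d) y" for k y
  define F where "F j k = {p\<in>space ?Q. \<exists>n\<le>2 ^ Suc k. 1 / real (Suc j) * \<Gamma> (Suc k) \<le> \<bar>chaos (g k) n (fst p) (snd p)\<bar>}" for j k
  define Hx where "Hx k = {x\<in>space (P V). \<exists>u\<in>U (2 ^ Suc k). pick u x \<in> space (P D) - A (Suc k) d}" for k
  have g_meas: "g k \<in> borel_measurable (P D)" for k unfolding g_def by measurable
  have F_sets: "F j k \<in> sets ?Q" for j k
  proof -
    have [measurable]: "(\<lambda>p. chaos (g k) n (fst p) (snd p)) \<in> borel_measurable ?Q" for n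
      by (rule chaos_measurable_pair[OF g_meas])
    show ?thesis unfolding F_def by measurable
  qed
  have Hx_sets: "Hx k \<in> sets (P V)" for k
    unfolding Hx_def by (rule hit_event[OF finite_U U_V]) auto
  have "AE p in ?Q. \<forall>\<^sub>F k in sequentially. p \<in> space ?Q - F j k" for j
  proof (rule borel_cantelli_AE1[OF F_sets])
    show "emeasure ?Q (F j k) < \<infinity>" for k by (simp add: less_top[symmetric])
    let ?c = "ennreal (1 / (1 / real (Suc j))\<^sup>2)"
    have "(\<Sum>k. ennreal (pr.prob (F j k))) \<le> (\<Sum>k. ?c * (2 ^ (d * Suc k) * (\<integral>\<^sup>+x. G (Suc k) (A (Suc k) d) x \<partial>P D)))"
      unfolding pr.emeasure_eq_measure[symmetric] F_def g_def
      by (intro suminf_le truncated_chaos_exceeds) auto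
    also have "\<dots> = ?c * (\<Sum>k. 2 ^ (d * Suc k) * (\<integral>\<^sup>+x. G (Suc k) (A (Suc k) d) x \<partial>P D))" by (rule ennreal_suminf_cmult)
    also have "\<dots> < \<top>" by (intro ennreal_mult_less_top[THEN iffD2] disjI1 disjI2 conjI mass ennreal_less_top)
    finally show "summable (\<lambda>k. pr.prob (F j k))"
      by (intro summable_suminf_not_top) auto
  qed
  then have noF: "AE p in ?Q. \<forall>j. \<forall>\<^sub>F k in sequentially. p \<in> space ?Q - F j k"
    by (simp add: AE_all_countable)
  have noH: "AE p in ?Q. \<forall>\<^sub>F k in sequentially. p \<in> space ?Q - Hx k \<times> space (R V)"
  proof (rule borel_cantelli_AE1)
    show "Hx k \<times> space (R V) \<in> sets ?Q" for k using Hx_sets by simp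
    show "emeasure ?Q (Hx k \<times> space (R V)) < \<infinity>" for k by (simp add: less_top[symmetric])
    have "pr.prob (Hx k \<times> space (R V)) = hit V (U (2 ^ Suc k)) (space (P D) - A (Suc k) d)" for k
      using r.emeasure_pair_measure_Times[OF Hx_sets[of k] sets.top]
      by (simp add: r.emeasure_space_1 measure_def hit_def Hx_def)
    then show "summable (\<lambda>k. pr.prob (Hx k \<times> space (R V)))" using hits by simp
  qed
  have C0: "C > 0"
  proof -
    have "0 < C * \<gamma> 1" using \<gamma>_doubling[of 1] \<gamma>_pos[of "2 * 1"] by linarith
    then show ?thesis using \<gamma>_pos[of 1] by (simp add: zero_less_mult_iff)
  qed
  have "AE p in ?Q. (\<lambda>n. 1 / \<gamma> n * chaos h n (fst p) (snd p)) \<longlonglongrightarrow> 0"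
    using noF noH AE_space
  proof eventually_elim
    case (elim p)
    show ?case
    proof (rule LIMSEQ_I)
      fix \<epsilon> :: real assume \<epsilon>: "\<epsilon> > 0"
      obtain j where j: "C / \<epsilon> < real (Suc j)" using reals_Archimedean2[of "C / \<epsilon>"] by (metis less_Suc_eq of_nat_less_iff less_trans)
      have "\<forall>\<^sub>F k in sequentially. p \<in> space ?Q - F j k \<and> p \<in> space ?Q - Hx k \<times> space (R V)"
        using elim(1,2) by (intro eventually_conj) auto
      then obtain k0 where k0: "\<And>k. k \<ge> k0 \<Longrightarrow> p \<notin> F j k \<and> p \<notin> Hx k \<times> space (R V)"
        by (auto simp: eventually_sequentially)
      show "\<exists>n0. \<forall>n\<ge>n0. norm (1 / \<gamma> n * chaos h n (fst p) (snd p) - 0) < \<epsilon>"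
      proof (intro exI allI impI)
        fix n :: nat assume n: "2 ^ k0 \<le> n"
        have n1: "n \<ge> 1" using n by (meson le_trans one_le_numeral one_le_power)
        obtain k where k: "2 ^ k \<le> n" "n < 2 ^ (k + 1)" using ex_power_ivl1[of 2 n] n1 by auto
        have kk: "k \<ge> k0"
        proof (rule ccontr)
          assume "\<not> ?thesis"
          then have "(2::nat) ^ (k + 1) \<le> 2 ^ k0" by (intro power_increasing) auto
          then show False using k n by linarith
        qed
        have nk: "n \<le> 2 ^ Suc k" using k(2) by (simp only: Suc_eq_plus1 less_imp_le)
        have good: "pick u (fst p) \<in> A (Suc k) d" if u: "u \<in> U n" for u
        proof (rule ccontr)
          assume "pick u (fst p) \<notin> A (Suc k) d"
          moreover have "fst p \<in> space (P V)" "snd p \<in> space (R V)" using elim(3) by (auto simp: space_pair_measure)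
          moreover have "u \<in> U (2 ^ Suc k)" using u U_mono[OF nk] by auto
          ultimately have "fst p \<in> Hx k" using pick_space[OF U_V[OF u]] unfolding Hx_def by auto
          then have "p \<in> Hx k \<times> space (R V)" using \<open>snd p \<in> _\<close> by (simp add: mem_Times_iff)
          then show False using k0[OF kk] by blast
        qed
        have "chaos h n (fst p) (snd p) = chaos (g k) n (fst p) (snd p)"
          unfolding signed_sum_def g_def using good by (intro sum.cong refl) simp
        moreover have "\<bar>chaos (g k) n (fst p) (snd p)\<bar> < 1 / real (Suc j) * \<Gamma> (Suc k)"
        proof (rule ccontr)
          assume "\<not> ?thesis"
          then have "1 / real (Suc j) * \<Gamma> (Suc k) \<le> \<bar>chaos (g k) n (fst p) (snd p)\<bar>" by simp
          then have "p \<in> F j k" unfolding F_def using elim(3) nk by blast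
          then show False using k0[OF kk] by blast
        qed
        moreover have "\<Gamma> (Suc k) \<le> C * \<gamma> n"
        proof -
          have "\<Gamma> (Suc k) \<le> C * \<Gamma> k" using \<gamma>_doubling[of "2 ^ k"] by simp
          also have "\<Gamma> k \<le> \<gamma> n" using \<gamma>_mono k(1) n1 by (intro monotone_onD[OF \<gamma>_mono]) auto
          finally show ?thesis using C0 by simp
        qed
        ultimately have "\<bar>chaos h n (fst p) (snd p)\<bar> < 1 / real (Suc j) * (C * \<gamma> n)"
          by (smt (verit) mult_left_mono of_nat_0_le_iff zero_le_divide_1_iff)
        also have "1 / real (Suc j) * (C * \<gamma> n) = C / real (Suc j) * \<gamma> n" by simp
        finally have "\<bar>chaos h n (fst p) (snd p)\<bar> / \<gamma> n < C / real (Suc j)"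
          using \<gamma>_pos[OF n1] by (simp only: pos_divide_less_eq)
        also have "C / real (Suc j) < \<epsilon>" using j \<epsilon> by (simp add: field_simps del: of_nat_Suc)
        finally show "norm (1 / \<gamma> n * chaos h n (fst p) (snd p) - 0) < \<epsilon>"
          using \<gamma>_pos[OF n1] by (simp add: abs_mult)
      qed
    qed
  qed
  then show ?thesis by (simp add: case_prod_unfold)
qed

end

section \<open>The six conditions on product spaces\<close>

lemma sets_tendsto_zero:
  fixes f :: "nat \<Rightarrow> 'a \<Rightarrow> real"
  assumes [measurable]: "\<And>n. f n \<in> borel_measurable M"
  shows "{x\<in>space M. (\<lambda>n. f n x) \<longlonglongrightarrow> 0} \<in> sets M"
proof -
  have "(\<lambda>n. f n x) \<longlonglongrightarrow> 0 \<longleftrightarrow> (\<forall>m::nat. \<exists>N. \<forall>n\<ge>N. \<bar>f n x\<bar> < 1 / real (Suc m))" for x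
  proof
    assume "(\<lambda>n. f n x) \<longlonglongrightarrow> 0"
    then have "\<exists>N. \<forall>n\<ge>N. norm (f n x - 0) < 1 / real (Suc m)" for m by (rule LIMSEQ_D) simp
    then show "\<forall>m::nat. \<exists>N. \<forall>n\<ge>N. \<bar>f n x\<bar> < 1 / real (Suc m)" by simp
  next
    assume *: "\<forall>m::nat. \<exists>N. \<forall>n\<ge>N. \<bar>f n x\<bar> < 1 / real (Suc m)"
    show "(\<lambda>n. f n x) \<longlonglongrightarrow> 0"
    proof (rule LIMSEQ_I)
      fix r :: real assume "r > 0"
      then obtain m where m: "1 / real (Suc m) < r" by (rule nat_approx_posE)
      obtain N where "\<forall>n\<ge>N. \<bar>f n x\<bar> < 1 / real (Suc m)" using * by blast
      then have "\<forall>n\<ge>N. norm (f n x - 0) < r" using m by auto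
      then show "\<exists>N. \<forall>n\<ge>N. norm (f n x - 0) < r" by blast
    qed
  qed
  then have "{x\<in>space M. (\<lambda>n. f n x) \<longlonglongrightarrow> 0} = {x\<in>space M. \<forall>m::nat. \<exists>N. \<forall>n\<ge>N. \<bar>f n x\<bar> < 1 / real (Suc m)}"
    by simp
  also have "\<dots> \<in> sets M" by measurable
  finally show ?thesis .
qed

text \<open>An increasing multiindex lists its set of values in increasing order, hence is determined by it.\<close>

lemma incr_idx_eqI:
  assumes "i \<in> incr_idx d n" "i' \<in> incr_idx d n'" "i ` {1..d} = i' ` {1..d}"
  shows "i = i'"
proof -
  have sorted: "sorted_wrt (<) (map j [1..<Suc d])" if "strict_mono_on {1..d} j" for j :: "nat \<Rightarrow> nat"
    unfolding sorted_wrt_map sorted_wrt_iff_nth_less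
    using that by (auto simp: strict_mono_on_def nth_append simp del: upt_Suc)
  have "map i [1..<Suc d] = map i' [1..<Suc d]"
    using assms sorted[of i] sorted[of i']
    by (intro strict_sorted_equal) (auto simp: incr_idx_def atLeastLessThanSuc_atLeastAtMost simp del: upt_Suc)
  then have "\<forall>r\<in>{1..d}. i r = i' r" by (auto simp del: upt_Suc)
  then show ?thesis using assms(1,2) unfolding incr_idx_def by (auto intro: PiE_ext)
qed

lemma increasing_enumeration:
  assumes T: "T \<subseteq> {1..n}" "card T = d"
  shows "\<exists>i\<in>incr_idx d n. i ` {1..d} = T"
proof -
  let ?L = "sorted_list_of_set T"
  have fin: "finite T" using T finite_subset by blast
  have L: "set ?L = T" "length ?L = d" "sorted_wrt (<) ?L" using fin T by simp_all
  define i where "i = (\<lambda>r\<in>{1..d}. ?L ! (r - 1))"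
  have img: "i ` {1..d} = T"
  proof -
    have "i ` {1..d} = (\<lambda>k. ?L ! k) ` {..<d}"
    proof -
      have "(\<lambda>r. r - 1) ` {1..d} = {..<d}"
        by (auto simp: image_iff intro!: bexI[of _ "Suc _"])
      moreover have "i ` {1..d} = (\<lambda>k. ?L ! k) ` ((\<lambda>r. r - 1) ` {1..d})"
        unfolding image_image i_def by (intro image_cong) auto
      ultimately show ?thesis by simp
    qed
    also have "\<dots> = set ?L" using L(2) by (auto simp: set_conv_nth)
    finally show ?thesis using L(1) by simp
  qed
  have "strict_mono_on {1..d} i"
    using sorted_wrt_nth_less[OF L(3)] L(2) by (auto simp: strict_mono_on_def i_def)
  then have "i \<in> incr_idx d n" unfolding incr_idx_def using img T by (auto simp: i_def)
  then show ?thesis using img by blast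
qed

context kernel
begin

lemma h_pick_same_image:
  assumes sym: "symmetric_on_power d \<mu> h" and x: "x \<in> space (P V)"
    and w: "inj_on w D" "w ` D \<subseteq> V" and i: "inj_on i D" "i ` D = w ` D"
  shows "h (pick i x) = h (pick w x)"
proof -
  \<comment> \<open>the permutation that sorts \<open>w\<close> into \<open>i\<close>\<close>
  define p where "p r = (if r \<in> D then inv_into D w (i r) else r)" for r
  have wp: "w (p r) = i r" "p r \<in> D" if "r \<in> D" for r
  proof -
    have "i r \<in> w ` D" using that i by blast
    from f_inv_into_f[OF this] inv_into_into[OF this] that
    show "w (p r) = i r" "p r \<in> D" by (simp_all only: p_def if_True)
  qed
  have "inj_on p D"
  proof (rule inj_onI)
    fix r s assume a: "r \<in> D" "s \<in> D" "p r = p s"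
    then have "i r = i s" using wp(1)[of r] wp(1)[of s] by simp
    then show "r = s" using i(1) a by (auto dest: inj_onD)
  qed
  moreover from this have "p ` D = D" using wp(2) by (intro endo_inj_surj) auto
  ultimately have "p permutes D" by (intro bij_imp_permutes) (auto simp: bij_betw_def p_def)
  moreover have "pick w x \<in> space (P D)" by (rule pick_space[OF w(2) x])
  ultimately have "h (pick w x \<circ> p) = h (pick w x)"
    using sym unfolding symmetric_on_power_def by blast
  moreover have "pick w x \<circ> p = pick i x"
    using wp by (auto simp: pick_def fun_eq_iff p_def)
  ultimately show ?thesis by simp
qed

lemma \<gamma>_multiple_le: "n \<ge> 1 \<Longrightarrow> \<gamma> (d * n) \<le> C ^ d * \<gamma> n"
proof -
  assume n: "n \<ge> 1"
  have C0: "C \<ge> 0"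
  proof -
    have "0 < C * \<gamma> 1" using \<gamma>_doubling[of 1] \<gamma>_pos[of "2 * 1"] by linarith
    then show ?thesis using \<gamma>_pos[of 1] by (simp add: zero_less_mult_iff)
  qed
  have "\<gamma> (2 ^ a * n) \<le> C ^ a * \<gamma> n" for a
  proof (induction a)
    case (Suc a)
    have "\<gamma> (2 ^ Suc a * n) \<le> C * \<gamma> (2 ^ a * n)"
      using \<gamma>_doubling[of "2 ^ a * n"] mult_le_mono[of 1 "2 ^ a" 1 n] n by (simp add: mult.assoc)
    also have "\<dots> \<le> C * (C ^ a * \<gamma> n)" using Suc C0 by (rule mult_left_mono)
    finally show ?case by (simp add: mult.assoc)
  qed simp
  moreover have "\<gamma> (d * n) \<le> \<gamma> (2 ^ d * n)"
    using mult_le_mono[OF d_pos n] mult_le_mono[of 1 "2 ^ d" 1 n] n less_imp_le[OF less_exp[of d]]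
    by (intro monotone_onD[OF \<gamma>_mono] mult_right_mono) simp_all
  ultimately show ?thesis using order_trans by blast
qed

text \<open>The \<open>r\<close>-th decoupled copy is the residue class of \<open>r\<close> mod \<open>d\<close>.  Sorting a decoupled multiindex
  leaves \<open>h\<close> unchanged by symmetry, and no two of them are sorted into the same one, because the residue
  of an index tells its coordinate.\<close>

lemma decoupled_sqsum_le:
  assumes sym: "symmetric_on_power d \<mu> h" and x: "x \<in> space (P {1..})"
  defines "\<phi> \<equiv> \<lambda>(r, j). d * (j - 1) + r"
  shows "sqsum (dec n) (\<lambda>v\<in>D \<times> {1..}. x (\<phi> v)) \<le> sqsum (incr_idx d (d * n)) x"
proof -
  define w where "w i r = d * (i r - 1) + r" for i :: "nat \<Rightarrow> nat" and r
  have w_range: "w i r \<in> {1..d * n}" if "i \<in> all_idx d n" "r \<in> D" for i r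
  proof -
    have "1 \<le> i r" "i r \<le> n" using that by (auto simp: all_idx_def PiE_iff)
    have "d * (i r - 1) + r \<le> d * (n - 1) + d" using \<open>i r \<le> n\<close> that by (intro add_mono mult_left_mono) auto
    also have "\<dots> = d * n" using \<open>1 \<le> i r\<close> \<open>i r \<le> n\<close> by (cases n) auto
    finally show ?thesis using that by (auto simp: w_def)
  qed
  have residue: "r = s \<and> i r = i' s"
    if "r \<in> D" "s \<in> D" "w i r = w i' s" "i \<in> all_idx d n" "i' \<in> all_idx d n" for i i' r s
  proof -
    have pos: "1 \<le> i r" "1 \<le> i' s" using that by (auto simp: all_idx_def PiE_iff)
    have shift: "w j q - 1 = (q - 1) + d * (j q - 1)" if "q \<in> D" for j q using that by (auto simp: w_def)
    have eq: "(r - 1) + d * (i r - 1) = (s - 1) + d * (i' s - 1)"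
      using that shift[of r i] shift[of s i'] by simp
    have small: "r - 1 < d" "s - 1 < d" using that by auto
    have "r - 1 = s - 1"
      using arg_cong[OF eq, of "\<lambda>t. t mod d"] small by simp
    moreover have "i r - 1 = i' s - 1"
      using arg_cong[OF eq, of "\<lambda>t. t div d"] small by simp
    ultimately show ?thesis using that pos by auto
  qed
  have w_inj: "inj_on (w i) D" if "i \<in> all_idx d n" for i
    using residue[OF _ _ _ that that] by (intro inj_onI) blast
  have "\<exists>s\<in>incr_idx d (d * n). s ` D = w i ` D" if "i \<in> all_idx d n" for i
    using w_range[OF that] card_image[OF w_inj[OF that]] by (intro increasing_enumeration) auto
  then obtain s where s: "\<And>i. i \<in> all_idx d n \<Longrightarrow> s i \<in> incr_idx d (d * n) \<and> s i ` D = w i ` D" by metis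
  have s_inj: "inj_on s (all_idx d n)"
  proof (rule inj_onI)
    fix i i' assume i: "i \<in> all_idx d n" "i' \<in> all_idx d n" "s i = s i'"
    have same: "w i ` D = w i' ` D" using s[OF i(1)] s[OF i(2)] i(3) by simp
    have "i r = i' r" if r: "r \<in> D" for r
    proof -
      have "w i r \<in> w i' ` D" using same r by blast
      then obtain q where "q \<in> D" "w i r = w i' q" by blast
      then show ?thesis using residue[of r q i i'] r i by auto
    qed
    then show "i = i'" using i unfolding all_idx_def by (intro PiE_ext) auto
  qed
  have "sqsum (dec n) (\<lambda>v\<in>D \<times> {1..}. x (\<phi> v))
      = (\<Sum>i\<in>all_idx d n. (h (pick (\<lambda>r. (r, i r)) (\<lambda>v\<in>D \<times> {1..}. x (\<phi> v))))\<^sup>2)"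
  proof -
    have "inj_on (\<lambda>i r. (r, i r)) (all_idx d n)" by (auto simp: inj_on_def fun_eq_iff)
    then show ?thesis unfolding sqsum_def dec_def by (simp add: sum.reindex)
  qed
  also have "\<dots> = (\<Sum>i\<in>all_idx d n. (h (pick (s i) x))\<^sup>2)"
  proof (intro sum.cong refl)
    fix i assume i: "i \<in> all_idx d n"
    have "pick (\<lambda>r. (r, i r)) (\<lambda>v\<in>D \<times> {1..}. x (\<phi> v)) = pick (w i) x"
      using i by (auto simp: pick_def fun_eq_iff w_def \<phi>_def all_idx_def PiE_iff)
    moreover have "h (pick (s i) x) = h (pick (w i) x)"
      using s[OF i] w_range[OF i] w_inj[OF i] incr_inj[of "s i" "d * n"]
      by (intro h_pick_same_image[OF sym x]) auto
    ultimately show "(h (pick (\<lambda>r. (r, i r)) (\<lambda>v\<in>D \<times> {1..}. x (\<phi> v))))\<^sup>2 = (h (pick (s i) x))\<^sup>2" by simp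
  qed
  also have "\<dots> = (\<Sum>u\<in>s ` all_idx d n. (h (pick u x))\<^sup>2)"
    by (simp add: sum.reindex[OF s_inj])
  also have "\<dots> \<le> sqsum (incr_idx d (d * n)) x"
    unfolding sqsum_def using s by (intro sum_mono2) auto
  finally show ?thesis .
qed

text \<open>Enlarging the sample by the factor \<open>d\<close> costs, by the doubling condition, only the factor \<open>C ^ d\<close>
  in \<open>\<gamma>\<close>.\<close>

lemma squares_imp_decoupled_squares:
  assumes sym: "symmetric_on_power d \<mu> h"
    and conv: "AE x in P {1..}. (\<lambda>n. 1 / (\<gamma> n)\<^sup>2 * sqsum (incr_idx d n) x) \<longlonglongrightarrow> 0"
  shows "AE y in P (D \<times> {1..}). (\<lambda>n. 1 / (\<gamma> n)\<^sup>2 * sqsum (dec n) y) \<longlonglongrightarrow> 0"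
proof -
  define \<phi> where "\<phi> = (\<lambda>(r, j). d * (j - 1) + r :: nat)"
  have inj: "inj_on \<phi> (D \<times> {1..})"
  proof (rule inj_onI)
    fix v v' assume v: "v \<in> D \<times> {1..}" "v' \<in> D \<times> {1..}" "\<phi> v = \<phi> v'"
    obtain r j r' j' where vv: "v = (r, j)" "v' = (r', j')" by (cases v, cases v')
    then have a: "r \<in> D" "r' \<in> D" "j \<in> {1..}" "j' \<in> {1..}" "\<phi> (r, j) = \<phi> (r', j')"
      using v by auto
    then have eq: "(r - 1) + d * (j - 1) = (r' - 1) + d * (j' - 1)" by (simp add: \<phi>_def)
    have small: "r - 1 < d" "r' - 1 < d" using a by auto
    have "r - 1 = r' - 1" using arg_cong[OF eq, of "\<lambda>t. t mod d"] small by simp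
    moreover have "j - 1 = j' - 1" using arg_cong[OF eq, of "\<lambda>t. t div d"] small by simp
    ultimately show "v = v'" using a by (auto simp: vv)
  qed
  have range: "\<phi> ` (D \<times> {1..}) \<subseteq> {1..}" by (auto simp: \<phi>_def)
  let ?f = "\<lambda>x. \<lambda>v\<in>D \<times> {1..}. x (\<phi> v)"
  have [measurable]: "sqsum (dec n) \<in> borel_measurable (P (D \<times> {1..}))" for n
    by (intro sqsum_measurable dec_sites')
  have "AE x in P {1..}. (\<lambda>n. 1 / (\<gamma> n)\<^sup>2 * sqsum (dec n) (?f x)) \<longlonglongrightarrow> 0"
    using conv AE_space
  proof eventually_elim
    case (elim x)
    have "strict_mono (\<lambda>n. d * n)" using d_pos by (intro strict_monoI) auto
    from LIMSEQ_subseq_LIMSEQ[OF elim(1) this]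
    have "(\<lambda>n. 1 / (\<gamma> (d * n))\<^sup>2 * sqsum (incr_idx d (d * n)) x) \<longlonglongrightarrow> 0" by (simp add: o_def)
    then have lim: "(\<lambda>n. (C ^ d)\<^sup>2 * (1 / (\<gamma> (d * n))\<^sup>2 * sqsum (incr_idx d (d * n)) x)) \<longlonglongrightarrow> 0"
      by (rule tendsto_mult_right_zero)
    show ?case
    proof (rule tendsto_sandwich[OF _ _ tendsto_const lim])
      show "\<forall>\<^sub>F n in sequentially. 0 \<le> 1 / (\<gamma> n)\<^sup>2 * sqsum (dec n) (?f x)"
        by (simp add: sqsum_def sum_nonneg)
      show "\<forall>\<^sub>F n in sequentially. 1 / (\<gamma> n)\<^sup>2 * sqsum (dec n) (?f x)
          \<le> (C ^ d)\<^sup>2 * (1 / (\<gamma> (d * n))\<^sup>2 * sqsum (incr_idx d (d * n)) x)"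
        using eventually_ge_at_top[of 1]
      proof eventually_elim
        case (elim n)
        have pos: "0 < \<gamma> n" "0 < \<gamma> (d * n)" using \<gamma>_pos elim mult_le_mono[OF d_pos elim] by auto
        have "(\<gamma> (d * n))\<^sup>2 \<le> (C ^ d * \<gamma> n)\<^sup>2"
          using \<gamma>_multiple_le[OF elim] pos by (intro power_mono) auto
        then have "1 / (\<gamma> n)\<^sup>2 \<le> (C ^ d)\<^sup>2 * (1 / (\<gamma> (d * n))\<^sup>2)"
          using pos by (simp add: field_simps power_mult_distrib)
        moreover have "sqsum (dec n) (?f x) \<le> sqsum (incr_idx d (d * n)) x"
          unfolding \<phi>_def by (rule decoupled_sqsum_le[OF sym \<open>x \<in> space _\<close>])
        ultimately have "1 / (\<gamma> n)\<^sup>2 * sqsum (dec n) (?f x)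
            \<le> ((C ^ d)\<^sup>2 * (1 / (\<gamma> (d * n))\<^sup>2)) * sqsum (incr_idx d (d * n)) x"
          by (intro mult_mono) (auto simp: sqsum_def sum_nonneg)
        then show ?case by (simp only: mult.assoc)
      qed
    qed
  qed
  then have "AE y in distr (P {1..}) (P (D \<times> {1..})) ?f. (\<lambda>n. 1 / (\<gamma> n)\<^sup>2 * sqsum (dec n) y) \<longlonglongrightarrow> 0"
    by (subst AE_distr_iff) (auto intro!: measurable_reindex range sets_tendsto_zero)
  then show ?thesis unfolding PiM_reindex[OF prob_\<mu> inj range] .
qed

lemma incr_sign_system: "sign_system \<mu> d h \<gamma> C {1..} (incr_idx d) (\<lambda>n. {1..n})"
proof (intro sign_system.intro sign_system_axioms.intro)
  show "kernel \<mu> d h \<gamma> C" by unfold_locales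
  show "finite (incr_idx d n)" for n by simp
  show "u \<in> incr_idx d n \<Longrightarrow> inj_on u D" for u n by (rule incr_inj)
  show "u \<in> incr_idx d n \<Longrightarrow> u ` D \<subseteq> {1..n}" for u n by (rule incr_sites)
  show "incr_idx d m \<subseteq> incr_idx d n" if "m \<le> n" for m n
    using that by (fastforce simp: incr_idx_def PiE_iff)
  show "u \<in> incr_idx d m" if "u \<in> incr_idx d n" "u ` D \<subseteq> {1..m}" for u m n
    using that by (auto simp: incr_idx_def PiE_iff image_subset_iff)
  show "inj_on (\<lambda>u. u ` D) (incr_idx d n)" for n
    by (intro inj_onI) (rule incr_idx_eqI)
  show "card (incr_idx d n) \<le> n ^ d" for n
  proof -
    have "card (incr_idx d n) \<le> card (all_idx d n)"
      by (intro card_mono finite_all_idx) (auto simp: incr_idx_def all_idx_def)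
    also have "\<dots> = n ^ d" by (simp add: all_idx_def card_funcsetE)
    finally show ?thesis .
  qed
qed auto

lemma dec_sign_system: "sign_system \<mu> d h \<gamma> C (D \<times> {1..}) dec (\<lambda>n. D \<times> {1..n})"
proof (intro sign_system.intro sign_system_axioms.intro)
  show "kernel \<mu> d h \<gamma> C" by unfold_locales
  show "finite (dec n)" for n by simp
  show "u \<in> dec n \<Longrightarrow> inj_on u D" for u n by (auto simp: dec_def inj_on_def)
  show "u \<in> dec n \<Longrightarrow> u ` D \<subseteq> D \<times> {1..n}" for u n by (rule dec_sites)
  show "dec m \<subseteq> dec n" if "m \<le> n" for m n
    using that unfolding dec_def all_idx_def by (intro image_mono PiE_mono) auto
  show "u \<in> dec m" if "u \<in> dec n" "u ` D \<subseteq> D \<times> {1..m}" for u m n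
    using that unfolding dec_def all_idx_def by (auto simp: PiE_iff image_subset_iff)
  show "inj_on (\<lambda>u. u ` D) (dec n)" for n
  proof (rule inj_onI)
    fix u u' assume u: "u \<in> dec n" "u' \<in> dec n" "u ` D = u' ` D"
    then obtain i i' where i: "i \<in> all_idx d n" "u = (\<lambda>r. (r, i r))" "i' \<in> all_idx d n" "u' = (\<lambda>r. (r, i' r))"
      by (auto simp: dec_def)
    have "i r = i' r" if r: "r \<in> D" for r
    proof -
      have "u r \<in> u' ` D" using r unfolding u(3)[symmetric] by (rule imageI)
      then show ?thesis using i by auto
    qed
    then have "i = i'" using i unfolding all_idx_def by (intro PiE_ext) auto
    then show "u = u'" using i by simp
  qed
  show "card (dec n) \<le> n ^ d" for n
  proof -
    have "card (dec n) \<le> card (all_idx d n)" unfolding dec_def by (intro card_image_le) simp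
    also have "\<dots> = n ^ d" by (simp add: all_idx_def card_funcsetE)
    finally show ?thesis .
  qed
qed auto

theorem canonical_equivalences:
  assumes sym: "symmetric_on_power d \<mu> h"
  defines "a \<equiv> AE (x, e) in P {1..} \<Otimes>\<^sub>M R {1..}. (\<lambda>n. 1 / \<gamma> n * signed_sum (incr_idx d n) h x e) \<longlonglongrightarrow> 0"
    and "b \<equiv> AE (x, e) in P (D \<times> {1..}) \<Otimes>\<^sub>M R (D \<times> {1..}). (\<lambda>n. 1 / \<gamma> n * signed_sum (dec n) h x e) \<longlonglongrightarrow> 0"
    and "c \<equiv> AE x in P {1..}. (\<lambda>n. 1 / (\<gamma> n)\<^sup>2 * sqsum (incr_idx d n) x) \<longlonglongrightarrow> 0"
    and "d' \<equiv> AE x in P (D \<times> {1..}). (\<lambda>n. 1 / (\<gamma> n)\<^sup>2 * sqsum (dec n) x) \<longlonglongrightarrow> 0"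
    and "e \<equiv> summable (\<lambda>k. hit {1..} (incr_idx d (2 ^ Suc k)) (space (P D) - A (Suc k) d))"
    and "f \<equiv> summable (\<lambda>k. hit (D \<times> {1..}) (dec (2 ^ Suc k)) (space (P D) - A (Suc k) d))"
  shows "(a \<longleftrightarrow> b) \<and> (b \<longleftrightarrow> c) \<and> (c \<longleftrightarrow> d') \<and> (d' \<longleftrightarrow> e) \<and> (e \<longleftrightarrow> f)"
proof -
  interpret inc: sign_system \<mu> d h \<gamma> C "{1..}" "incr_idx d" "\<lambda>n. {1..n}" by (rule incr_sign_system)
  interpret dcp: sign_system \<mu> d h \<gamma> C "D \<times> {1..}" dec "\<lambda>n. D \<times> {1..n}" by (rule dec_sign_system)
  have ac: "a \<Longrightarrow> c" unfolding a_def c_def by (rule inc.chaos_imp_squares)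
  have bd: "b \<Longrightarrow> d'" unfolding b_def d'_def by (rule dcp.chaos_imp_squares)
  have cd: "c \<Longrightarrow> d'" unfolding c_def d'_def by (rule squares_imp_decoupled_squares[OF sym])
  have df: "d' \<Longrightarrow> f" unfolding d'_def f_def by (rule squares_imp_summable_hit)
  have ef: "e \<longleftrightarrow> f" unfolding e_def f_def by (rule summable_hit_iff) auto
  have fb: "f \<Longrightarrow> b" unfolding f_def b_def
    by (rule dcp.truncated_imp_chaos[OF truncated_mass_summable])
  have efa: "f \<Longrightarrow> e \<Longrightarrow> a" unfolding a_def e_def f_def
    by (rule inc.truncated_imp_chaos[OF truncated_mass_summable])
  show ?thesis using ac bd cd df ef fb efa by blast
qed

end

section \<open>Transfer to the given random variables\<close>

text \<open>The reference space enters the definition of the truncation sets only through its underlying set.\<close>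

lemma trunc_set_cong_space:
  "space E = space E' \<Longrightarrow> trunc_set d E \<mu> h \<gamma> k l = trunc_set d E' \<mu> h \<gamma> k l"
proof (induction l rule: less_induct)
  case (less l)
  have sp: "space (power_space d E) = space (power_space d E')" using less.prems by (simp add: space_PiM)
  consider "l = 0" | "l = Suc 0" | m where "l = Suc (Suc m)" by (metis not0_implies_Suc)
  then show ?case
  proof cases
    case 3
    then have "trunc_set d E \<mu> h \<gamma> k (Suc m) = trunc_set d E' \<mu> h \<gamma> k (Suc m)"
      using less by simp
    then show ?thesis using 3 by simp
  qed (simp_all only: trunc_set.simps sp)
qed

text \<open>For \<open>Y\<close> a sign family and \<open>Y'\<close> the tuple of all the other families, with \<open>f\<close> the projection to the
  points that go with these signs.\<close>

lemma distr_indep_pair: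
  assumes "prob_space M" and ind: "indep_rv M N Y N' Y'" and f: "f \<in> N' \<rightarrow>\<^sub>M L"
  shows "distr M (L \<Otimes>\<^sub>M N) (\<lambda>\<omega>. (f (Y' \<omega>), Y \<omega>)) = distr M L (\<lambda>\<omega>. f (Y' \<omega>)) \<Otimes>\<^sub>M distr M N Y"
proof -
  interpret prob_space M by fact
  have Y [measurable]: "Y \<in> M \<rightarrow>\<^sub>M N" and Y' [measurable]: "Y' \<in> M \<rightarrow>\<^sub>M N'"
    and set: "indep_set {Y -` S \<inter> space M |S. S \<in> sets N} {Y' -` S \<inter> space M |S. S \<in> sets N'}"
    using ind by (auto simp: indep_rv_def)
  note [measurable] = f
  have fY': "(\<lambda>\<omega>. f (Y' \<omega>)) \<in> M \<rightarrow>\<^sub>M L" by measurable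
  interpret a: prob_space "distr M L (\<lambda>\<omega>. f (Y' \<omega>))" by (rule prob_space_distr[OF fY'])
  interpret b: prob_space "distr M N Y" by (rule prob_space_distr[OF Y])
  show ?thesis
  proof (rule pair_measure_eqI[symmetric])
    show "sigma_finite_measure (distr M L (\<lambda>\<omega>. f (Y' \<omega>)))" by unfold_locales
    show "sigma_finite_measure (distr M N Y)" by unfold_locales
    show "sets (distr M L (\<lambda>\<omega>. f (Y' \<omega>)) \<Otimes>\<^sub>M distr M N Y) = sets (distr M (L \<Otimes>\<^sub>M N) (\<lambda>\<omega>. (f (Y' \<omega>), Y \<omega>)))"
      by (simp cong: sets_pair_measure_cong)
    fix S T assume "S \<in> sets (distr M L (\<lambda>\<omega>. f (Y' \<omega>)))" "T \<in> sets (distr M N Y)"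
    then have S [measurable]: "S \<in> sets L" and T [measurable]: "T \<in> sets N" by auto
    have fS: "f -` S \<inter> space N' \<in> sets N'" by measurable
    have eq: "(\<lambda>\<omega>. f (Y' \<omega>)) -` S \<inter> space M = Y' -` (f -` S \<inter> space N') \<inter> space M"
      using measurable_space[OF Y'] by auto
    have "emeasure (distr M (L \<Otimes>\<^sub>M N) (\<lambda>\<omega>. (f (Y' \<omega>), Y \<omega>))) (S \<times> T)
        = emeasure M ((\<lambda>\<omega>. (f (Y' \<omega>), Y \<omega>)) -` (S \<times> T) \<inter> space M)"
      by (rule emeasure_distr) measurable
    also have "(\<lambda>\<omega>. (f (Y' \<omega>), Y \<omega>)) -` (S \<times> T) \<inter> space M
        = (Y -` T \<inter> space M) \<inter> (Y' -` (f -` S \<inter> space N') \<inter> space M)"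
      using eq by auto
    also have "emeasure M \<dots> = ennreal (prob (Y -` T \<inter> space M) * prob (Y' -` (f -` S \<inter> space N') \<inter> space M))"
    proof -
      have "Y -` T \<inter> space M \<in> {Y -` S \<inter> space M |S. S \<in> sets N}" using T by blast
      moreover have "Y' -` (f -` S \<inter> space N') \<inter> space M \<in> {Y' -` S \<inter> space M |S. S \<in> sets N'}"
        using fS by blast
      ultimately show ?thesis unfolding emeasure_eq_measure by (intro arg_cong[where f=ennreal] indep_setD[OF set])
    qed
    also have "\<dots> = emeasure M (Y' -` (f -` S \<inter> space N') \<inter> space M) * emeasure M (Y -` T \<inter> space M)"
      by (simp add: emeasure_eq_measure ennreal_mult mult.commute)
    also have "\<dots> = emeasure (distr M L (\<lambda>\<omega>. f (Y' \<omega>))) S * emeasure (distr M N Y) T"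
      unfolding eq[symmetric] using fY' by (simp add: emeasure_distr)
    finally show "emeasure (distr M L (\<lambda>\<omega>. f (Y' \<omega>))) S * emeasure (distr M N Y) T
        = emeasure (distr M (L \<Otimes>\<^sub>M N) (\<lambda>\<omega>. (f (Y' \<omega>), Y \<omega>))) (S \<times> T)" by simp
  qed
qed

lemma distr_joint_iid:
  fixes X :: "'i \<Rightarrow> 'a \<Rightarrow> 'e"
  assumes "prob_space M" "I \<noteq> {}" and ind: "prob_space.indep_vars M (\<lambda>_. E) X I"
    and law: "\<And>i. i \<in> I \<Longrightarrow> distr M E (X i) = \<mu>"
  shows "distr M (Pi\<^sub>M I (\<lambda>_. E)) (joint_rv I X) = Pi\<^sub>M I (\<lambda>_. \<mu>)"
proof -
  interpret prob_space M by fact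
  have rv: "random_variable E (X i)" if "i \<in> I" for i
    using ind that by (auto simp: indep_vars_def)
  have "distr M (Pi\<^sub>M I (\<lambda>_. E)) (joint_rv I X) = Pi\<^sub>M I (\<lambda>i. distr M E (X i))"
    unfolding joint_rv_def[abs_def]
    using indep_vars_iff_distr_eq_PiM'[OF assms(2), where M'="\<lambda>_. E" and X=X] rv ind by simp
  also have "\<dots> = Pi\<^sub>M I (\<lambda>_. \<mu>)" by (intro PiM_cong refl law)
  finally show ?thesis .
qed

text \<open>The hypotheses give independence of whole sequences and the law of each sequence; the two are combined
  into the law of the doubly indexed family by comparing both measures on finite cylinders.\<close>

lemma distr_joint_iterated:
  fixes X' :: "'i \<Rightarrow> 'j \<Rightarrow> 'a \<Rightarrow> 'e"
  assumes M: "prob_space M" and I: "finite I" "I \<noteq> {}" and \<mu>: "prob_space \<mu>" "sets \<mu> = sets E"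
    and ind: "prob_space.indep_vars M (\<lambda>_. Pi\<^sub>M K (\<lambda>_. E)) (\<lambda>r. joint_rv K (X' r)) I"
    and law: "\<And>r. r \<in> I \<Longrightarrow> distr M (Pi\<^sub>M K (\<lambda>_. E)) (joint_rv K (X' r)) = Pi\<^sub>M K (\<lambda>_. \<mu>)"
  shows "distr M (Pi\<^sub>M (I \<times> K) (\<lambda>_. E)) (joint_rv (I \<times> K) (case_prod X')) = Pi\<^sub>M (I \<times> K) (\<lambda>_. \<mu>)"
proof -
  interpret prob_space M by fact
  let ?Y = "\<lambda>r. joint_rv K (X' r)" and ?Z = "joint_rv (I \<times> K) (case_prod X')"
  have setsK: "sets (Pi\<^sub>M K (\<lambda>_. E)) = sets (Pi\<^sub>M K (\<lambda>_. \<mu>))" using \<mu> by (intro sets_PiM_cong) auto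
  have setsIK: "sets (Pi\<^sub>M (I \<times> K) (\<lambda>_. E)) = sets (Pi\<^sub>M (I \<times> K) (\<lambda>_. \<mu>))" using \<mu> by (intro sets_PiM_cong) auto
  have Y: "?Y r \<in> M \<rightarrow>\<^sub>M Pi\<^sub>M K (\<lambda>_. E)" if "r \<in> I" for r
    using ind that by (auto simp: indep_vars_def)
  have Z: "?Z \<in> M \<rightarrow>\<^sub>M Pi\<^sub>M (I \<times> K) (\<lambda>_. E)"
    unfolding joint_rv_def[abs_def]
  proof (rule measurable_restrict)
    fix v assume "v \<in> I \<times> K"
    then obtain r j where rj: "v = (r, j)" "r \<in> I" "j \<in> K" by blast
    from measurable_compose[OF Y[OF rj(2)] measurable_component_singleton[OF rj(3)]]
    show "case_prod X' v \<in> M \<rightarrow>\<^sub>M E" using rj by (simp add: joint_rv_def)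
  qed
  show ?thesis
  proof (rule measure_eqI_PiM_infinite[where M="\<lambda>_. \<mu>"])
    show "sets (distr M (Pi\<^sub>M (I \<times> K) (\<lambda>_. E)) ?Z) = sets (Pi\<^sub>M (I \<times> K) (\<lambda>_. \<mu>))" by (simp add: setsIK)
    show "sets (Pi\<^sub>M (I \<times> K) (\<lambda>_. \<mu>)) = sets (Pi\<^sub>M (I \<times> K) (\<lambda>_. \<mu>))" ..
    show "finite_measure (distr M (Pi\<^sub>M (I \<times> K) (\<lambda>_. E)) ?Z)"
      by (intro prob_space.finite_measure prob_space_distr Z)
    fix A :: "'i \<times> 'j \<Rightarrow> 'e set" and J assume J: "finite J" "J \<subseteq> I \<times> K" and A: "\<And>v. v \<in> J \<Longrightarrow> A v \<in> sets \<mu>"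
    define Jr where "Jr r = {j. (r, j) \<in> J}" for r
    define B where "B r = prod_emb K (\<lambda>_. \<mu>) (Jr r) (\<Pi>\<^sub>E j\<in>Jr r. A (r, j))" for r
    have Jr: "finite (Jr r)" "Jr r \<subseteq> K" for r
    proof -
      have "Jr r \<subseteq> snd ` J" by (force simp: Jr_def)
      then show "finite (Jr r)" using J(1) finite_subset by blast
      show "Jr r \<subseteq> K" using J(2) by (auto simp: Jr_def)
    qed
    have B: "B r \<in> sets (Pi\<^sub>M K (\<lambda>_. E))" for r
      unfolding setsK B_def using Jr A by (intro sets_PiM_I) (auto simp: Jr_def)
    have JS: "J = (SIGMA r:I. Jr r)" using J(2) by (auto simp: Jr_def)
    have pre: "?Z -` prod_emb (I \<times> K) (\<lambda>_. \<mu>) J (Pi\<^sub>E J A) \<inter> space M = (\<Inter>r\<in>I. ?Y r -` B r \<inter> space M)"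
    proof (intro set_eqI iffI)
      fix \<omega> assume \<omega>: "\<omega> \<in> ?Z -` prod_emb (I \<times> K) (\<lambda>_. \<mu>) J (Pi\<^sub>E J A) \<inter> space M"
      have "?Y r \<omega> \<in> B r" if r: "r \<in> I" for r
      proof -
        have "?Y r \<omega> \<in> space (Pi\<^sub>M K (\<lambda>_. \<mu>))"
          using measurable_space[OF Y[OF r]] \<omega> sets_eq_imp_space_eq[OF setsK] by auto
        moreover have "X' r j \<omega> \<in> A (r, j)" if "j \<in> Jr r" for j
          using \<omega> that r Jr(2)[of r] by (auto simp: prod_emb_def joint_rv_def Jr_def PiE_iff split: if_splits)
        ultimately show ?thesis using Jr(2)[of r]
          by (auto simp: B_def prod_emb_def space_PiM joint_rv_def PiE_iff)
      qed
      then show "\<omega> \<in> (\<Inter>r\<in>I. ?Y r -` B r \<inter> space M)" using \<omega> by auto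
    next
      fix \<omega> assume \<omega>: "\<omega> \<in> (\<Inter>r\<in>I. ?Y r -` B r \<inter> space M)"
      have sp: "\<omega> \<in> space M" using \<omega> I(2) by auto
      have "?Z \<omega> \<in> space (Pi\<^sub>M (I \<times> K) (\<lambda>_. \<mu>))"
        using measurable_space[OF Z sp] sets_eq_imp_space_eq[OF setsIK] by auto
      moreover have "?Z \<omega> v \<in> A v" if v: "v \<in> J" for v
      proof -
        obtain r j where rj: "v = (r, j)" "r \<in> I" "j \<in> K" "j \<in> Jr r" using v J(2) by (auto simp: Jr_def)
        have "?Y r \<omega> \<in> B r" using INT_D[OF \<omega> rj(2)] by simp
        then have "restrict (?Y r \<omega>) (Jr r) j \<in> A (r, j)"
          using rj(4) unfolding B_def prod_emb_def by (auto dest: PiE_mem)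
        then show ?thesis using rj by (simp add: joint_rv_def)
      qed
      ultimately show "\<omega> \<in> ?Z -` prod_emb (I \<times> K) (\<lambda>_. \<mu>) J (Pi\<^sub>E J A) \<inter> space M"
        using sp J(2) by (auto simp: prod_emb_def space_PiM PiE_iff)
    qed
    have "emeasure (distr M (Pi\<^sub>M (I \<times> K) (\<lambda>_. E)) ?Z) (prod_emb (I \<times> K) (\<lambda>_. \<mu>) J (Pi\<^sub>E J A))
        = emeasure M (?Z -` prod_emb (I \<times> K) (\<lambda>_. \<mu>) J (Pi\<^sub>E J A) \<inter> space M)"
      using Z J A by (intro emeasure_distr) (auto simp: setsIK intro!: sets_PiM_I)
    also have "\<dots> = ennreal (prob (\<Inter>r\<in>I. ?Y r -` B r \<inter> space M))"
      unfolding pre by (rule emeasure_eq_measure)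
    also have "prob (\<Inter>r\<in>I. ?Y r -` B r \<inter> space M) = (\<Prod>r\<in>I. prob (?Y r -` B r \<inter> space M))"
      using B by (intro indep_varsD[OF ind I(2,1)]) auto
    also have "ennreal \<dots> = (\<Prod>r\<in>I. emeasure M (?Y r -` B r \<inter> space M))"
      by (simp add: emeasure_eq_measure prod_ennreal)
    also have "\<dots> = (\<Prod>r\<in>I. emeasure (Pi\<^sub>M K (\<lambda>_. \<mu>)) (B r))"
    proof (intro prod.cong refl)
      fix r assume r: "r \<in> I"
      show "emeasure M (?Y r -` B r \<inter> space M) = emeasure (Pi\<^sub>M K (\<lambda>_. \<mu>)) (B r)"
        unfolding law[OF r, symmetric] using Y[OF r] B by (simp add: emeasure_distr)
    qed
    also have "\<dots> = (\<Prod>r\<in>I. \<Prod>j\<in>Jr r. emeasure \<mu> (A (r, j)))"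
      unfolding B_def using Jr A \<mu>(1) by (intro prod.cong refl emeasure_PiM_emb) (auto simp: Jr_def)
    also have "\<dots> = (\<Prod>v\<in>J. emeasure \<mu> (A v))"
      by (subst JS, subst prod.Sigma) (use I Jr in \<open>auto simp: case_prod_unfold\<close>)
    also have "\<dots> = emeasure (Pi\<^sub>M (I \<times> K) (\<lambda>_. \<mu>)) (prod_emb (I \<times> K) (\<lambda>_. \<mu>) J (Pi\<^sub>E J A))"
      using J A \<mu>(1) by (intro emeasure_PiM_emb[symmetric]) auto
    finally show "emeasure (distr M (Pi\<^sub>M (I \<times> K) (\<lambda>_. E)) ?Z) (prod_emb (I \<times> K) (\<lambda>_. \<mu>) J (Pi\<^sub>E J A))
        = emeasure (Pi\<^sub>M (I \<times> K) (\<lambda>_. \<mu>)) (prod_emb (I \<times> K) (\<lambda>_. \<mu>) J (Pi\<^sub>E J A))" .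
  qed
qed

lemma distr_joint_rademacher:
  fixes \<epsilon> :: "'i \<Rightarrow> 'a \<Rightarrow> real"
  assumes "prob_space M" "I \<noteq> {}" "rademacher_family M I \<epsilon>"
  shows "distr M (Pi\<^sub>M I (\<lambda>_. borel)) (joint_rv I \<epsilon>) = Pi\<^sub>M I (\<lambda>_. fair_sign)"
proof (rule distr_joint_iid[OF assms(1,2)])
  interpret prob_space M by fact
  show ind: "indep_vars (\<lambda>_. borel) \<epsilon> I" using assms(3) by (simp add: rademacher_family_def)
  fix i assume i: "i \<in> I"
  have "\<epsilon> i \<in> borel_measurable M" using ind i by (auto simp: indep_vars_def)
  then show "distr M borel (\<epsilon> i) = fair_sign"
    using assms(3) i by (intro distr_eq_fair_sign assms(1)) (auto simp: rademacher_family_def)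
qed

context kernel
begin

lemma AE_signed_sum_transfer:
  assumes Z: "Z \<in> M \<rightarrow>\<^sub>M P V \<Otimes>\<^sub>M R V" and law: "distr M (P V \<Otimes>\<^sub>M R V) Z = P V \<Otimes>\<^sub>M R V"
    and sys: "sign_system \<mu> d h \<gamma> C V U J"
    and eq: "\<And>n \<omega>. n \<ge> 1 \<Longrightarrow> F n \<omega> = 1 / \<gamma> n * signed_sum (U n) h (fst (Z \<omega>)) (snd (Z \<omega>))"
  shows "(AE \<omega> in M. (\<lambda>n. F n \<omega>) \<longlonglongrightarrow> 0)
    \<longleftrightarrow> (AE (x, e) in P V \<Otimes>\<^sub>M R V. (\<lambda>n. 1 / \<gamma> n * signed_sum (U n) h x e) \<longlonglongrightarrow> 0)"
proof -
  interpret sign_system \<mu> d h \<gamma> C V U J by (rule sys)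
  let ?Q = "\<lambda>p. (\<lambda>n. 1 / \<gamma> n * signed_sum (U n) h (fst p) (snd p)) \<longlonglongrightarrow> 0"
  have "{p\<in>space (P V \<Otimes>\<^sub>M R V). ?Q p} \<in> sets (P V \<Otimes>\<^sub>M R V)"
    using chaos_measurable_pair[OF h_meas] by (intro sets_tendsto_zero borel_measurable_times) auto
  then have "(AE p in P V \<Otimes>\<^sub>M R V. ?Q p) \<longleftrightarrow> (AE \<omega> in M. ?Q (Z \<omega>))"
    using AE_distr_iff[OF Z, of ?Q, unfolded law] by blast
  also have "\<dots> \<longleftrightarrow> (AE \<omega> in M. (\<lambda>n. F n \<omega>) \<longlonglongrightarrow> 0)"
  proof -
    have "?Q (Z \<omega>) \<longleftrightarrow> (\<lambda>n. F n \<omega>) \<longlonglongrightarrow> 0" for \<omega>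
      by (intro filterlim_cong refl eventually_mono[OF eventually_ge_at_top[of 1]]) (simp add: eq)
    then show ?thesis by simp
  qed
  finally show ?thesis by (simp add: case_prod_unfold)
qed

lemma AE_sqsum_transfer:
  assumes Z: "Z \<in> M \<rightarrow>\<^sub>M P V" and law: "distr M (P V) Z = P V"
    and U: "\<And>n u. u \<in> U n \<Longrightarrow> u ` D \<subseteq> V"
    and eq: "\<And>n \<omega>. n \<ge> 1 \<Longrightarrow> F n \<omega> = 1 / (\<gamma> n)\<^sup>2 * sqsum (U n) (Z \<omega>)"
  shows "(AE \<omega> in M. (\<lambda>n. F n \<omega>) \<longlonglongrightarrow> 0)
    \<longleftrightarrow> (AE x in P V. (\<lambda>n. 1 / (\<gamma> n)\<^sup>2 * sqsum (U n) x) \<longlonglongrightarrow> 0)"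
proof -
  let ?Q = "\<lambda>x. (\<lambda>n. 1 / (\<gamma> n)\<^sup>2 * sqsum (U n) x) \<longlonglongrightarrow> 0"
  have "{x\<in>space (P V). ?Q x} \<in> sets (P V)"
    using sqsum_measurable[OF U] by (intro sets_tendsto_zero borel_measurable_times) auto
  then have "(AE x in P V. ?Q x) \<longleftrightarrow> (AE \<omega> in M. ?Q (Z \<omega>))"
    using AE_distr_iff[OF Z, of ?Q, unfolded law] by blast
  also have "\<dots> \<longleftrightarrow> (AE \<omega> in M. (\<lambda>n. F n \<omega>) \<longlonglongrightarrow> 0)"
  proof -
    have "?Q (Z \<omega>) \<longleftrightarrow> (\<lambda>n. F n \<omega>) \<longlonglongrightarrow> 0" for \<omega>
      by (intro filterlim_cong refl eventually_mono[OF eventually_ge_at_top[of 1]]) (simp add: eq)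
    then show ?thesis by simp
  qed
  finally show ?thesis by simp
qed

lemma hit_transfer:
  assumes Z: "Z \<in> M \<rightarrow>\<^sub>M P V" and law: "distr M (P V) Z = P V"
    and U: "finite U" "\<And>u. u \<in> U \<Longrightarrow> u ` D \<subseteq> V" and S: "S \<in> sets (P D)"
  shows "measure M {\<omega>\<in>space M. \<exists>u\<in>U. pick u (Z \<omega>) \<notin> S} = hit V U (space (P D) - S)"
proof -
  have "hit V U (space (P D) - S) = measure (distr M (P V) Z) {x\<in>space (P V). \<exists>u\<in>U. pick u x \<in> space (P D) - S}"
    by (simp add: hit_def law)
  also have "\<dots> = measure M (Z -` {x\<in>space (P V). \<exists>u\<in>U. pick u x \<in> space (P D) - S} \<inter> space M)"
    using Z U S by (intro measure_distr hit_event) auto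
  also have "Z -` {x\<in>space (P V). \<exists>u\<in>U. pick u x \<in> space (P D) - S} \<inter> space M = {\<omega>\<in>space M. \<exists>u\<in>U. pick u (Z \<omega>) \<notin> S}"
    using measurable_space[OF Z] pick_space[OF U(2)] by auto
  finally show ?thesis by simp
qed

end

theorem theorem2:
  fixes M :: "'a measure" and E \<mu> :: "'e measure"
    and d :: nat and h :: "(nat \<Rightarrow> 'e) \<Rightarrow> real" and \<gamma> :: "nat \<Rightarrow> real" and C :: real
    and X :: "nat \<Rightarrow> 'a \<Rightarrow> 'e" and X' :: "nat \<Rightarrow> nat \<Rightarrow> 'a \<Rightarrow> 'e"
    and \<epsilon> :: "nat \<Rightarrow> 'a \<Rightarrow> real" and \<epsilon>' :: "nat \<Rightarrow> nat \<Rightarrow> 'a \<Rightarrow> real"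
  assumes "prob_space M"
    and "d \<ge> 1"
    and X_indep: "prob_space.indep_vars M (\<lambda>_. E) X {1..}"
    and X_law: "\<And>j. j \<ge> 1 \<Longrightarrow> distr M E (X j) = \<mu>"
    and X'_indep: "prob_space.indep_vars M (\<lambda>_. Pi\<^sub>M {1..} (\<lambda>_. E)) (\<lambda>k. joint_rv {1..} (X' k)) {1..d}"
    and X'_copies: "\<And>k. k \<in> {1..d} \<Longrightarrow>
          distr M (Pi\<^sub>M {1..} (\<lambda>_. E)) (joint_rv {1..} (X' k)) =
          distr M (Pi\<^sub>M {1..} (\<lambda>_. E)) (joint_rv {1..} X)"
    and rademacher: "rademacher_family M {1..} \<epsilon>"
    and rademacher': "rademacher_family M ({1..d} \<times> {1..}) (case_prod \<epsilon>')"
    and \<epsilon>_indep: "indep_rv M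
          (Pi\<^sub>M {1..} (\<lambda>_. borel)) (joint_rv {1..} \<epsilon>)
          (Pi\<^sub>M {1..} (\<lambda>_. E) \<Otimes>\<^sub>M Pi\<^sub>M ({1..d} \<times> {1..}) (\<lambda>_. E) \<Otimes>\<^sub>M Pi\<^sub>M ({1..d} \<times> {1..}) (\<lambda>_. borel))
          (\<lambda>\<omega>. (joint_rv {1..} X \<omega>, joint_rv ({1..d} \<times> {1..}) (case_prod X') \<omega>,
                 joint_rv ({1..d} \<times> {1..}) (case_prod \<epsilon>') \<omega>))"
    and \<epsilon>'_indep: "indep_rv M
          (Pi\<^sub>M ({1..d} \<times> {1..}) (\<lambda>_. borel)) (joint_rv ({1..d} \<times> {1..}) (case_prod \<epsilon>'))
          (Pi\<^sub>M {1..} (\<lambda>_. E) \<Otimes>\<^sub>M Pi\<^sub>M ({1..d} \<times> {1..}) (\<lambda>_. E) \<Otimes>\<^sub>M Pi\<^sub>M {1..} (\<lambda>_. borel))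
          (\<lambda>\<omega>. (joint_rv {1..} X \<omega>, joint_rv ({1..d} \<times> {1..}) (case_prod X') \<omega>, joint_rv {1..} \<epsilon> \<omega>))"
    and h_meas: "h \<in> borel_measurable (power_space d E)"
    and h_sym: "symmetric_on_power d E h"
    and \<gamma>_pos: "\<And>n. n \<ge> 1 \<Longrightarrow> \<gamma> n > 0"
    and \<gamma>_mono: "mono_on {1..} \<gamma>"
    and \<gamma>_doubling: "\<And>n. n \<ge> 1 \<Longrightarrow> \<gamma> (2 * n) \<le> C * \<gamma> n"
    and \<gamma>_tail: "\<And>l. l \<ge> 1 \<Longrightarrow>
          summable (\<lambda>k. 2 ^ (d * (l + k)) / (\<gamma> (2 ^ (l + k)))\<^sup>2) \<and>
          (\<Sum>k. 2 ^ (d * (l + k)) / (\<gamma> (2 ^ (l + k)))\<^sup>2) \<le> C * (2 ^ (d * l) / (\<gamma> (2 ^ l))\<^sup>2)"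
  shows "let
      a = (AE \<omega> in M. (\<lambda>n. 1 / \<gamma> n * (\<Sum>i\<in>incr_idx d n. sgn_prod d \<epsilon> i \<omega> * h (pt d X i \<omega>))) \<longlonglongrightarrow> 0);
      b = (AE \<omega> in M. (\<lambda>n. 1 / \<gamma> n * (\<Sum>i\<in>all_idx d n. sgn_prod_dec d \<epsilon>' i \<omega> * h (pt_dec d X' i \<omega>))) \<longlonglongrightarrow> 0);
      c = (AE \<omega> in M. (\<lambda>n. 1 / (\<gamma> n)\<^sup>2 * (\<Sum>i\<in>incr_idx d n. (h (pt d X i \<omega>))\<^sup>2)) \<longlonglongrightarrow> 0);
      d' = (AE \<omega> in M. (\<lambda>n. 1 / (\<gamma> n)\<^sup>2 * (\<Sum>i\<in>all_idx d n. (h (pt_dec d X' i \<omega>))\<^sup>2)) \<longlonglongrightarrow> 0);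
      e = summable (\<lambda>k. measure M {\<omega> \<in> space M.
            \<exists>i\<in>incr_idx d (2 ^ Suc k). pt d X i \<omega> \<notin> trunc_set d E \<mu> h \<gamma> (Suc k) d});
      f = summable (\<lambda>k. measure M {\<omega> \<in> space M.
            \<exists>i\<in>all_idx d (2 ^ Suc k). pt_dec d X' i \<omega> \<notin> trunc_set d E \<mu> h \<gamma> (Suc k) d})
    in (a \<longleftrightarrow> b) \<and> (b \<longleftrightarrow> c) \<and> (c \<longleftrightarrow> d') \<and> (d' \<longleftrightarrow> e) \<and> (e \<longleftrightarrow> f)"
proof -
  interpret prob_space M by fact
  have X_rv: "X j \<in> M \<rightarrow>\<^sub>M E" if "j \<ge> 1" for j using X_indep that by (auto simp: indep_vars_def)
  have prob_\<mu>: "prob_space \<mu>"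
    unfolding X_law[of 1, OF order_refl, symmetric] by (rule prob_space_distr) (rule X_rv, simp)
  have sets_\<mu>: "sets \<mu> = sets E" unfolding X_law[of 1, OF order_refl, symmetric] by simp
  have space_\<mu>: "space \<mu> = space E" by (rule sets_eq_imp_space_eq[OF sets_\<mu>])
  \<comment> \<open>the measurable structure of \<open>E\<close> is that of its law \<open>\<mu>\<close>, so \<open>\<mu>\<close> can stand for \<open>E\<close>\<close>
  have sets_PiM: "sets (Pi\<^sub>M I (\<lambda>_. E)) = sets (Pi\<^sub>M I (\<lambda>_. \<mu>))" for I :: "'i set"
    by (rule sets_PiM_cong) (simp_all add: sets_\<mu>)
  interpret kernel \<mu> d h \<gamma> C
  proof (rule kernel.intro)
    show "h \<in> borel_measurable (Pi\<^sub>M {1..d} (\<lambda>_. \<mu>))"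
      using h_meas measurable_cong_sets[OF sets_PiM refl] by blast
  qed (fact prob_\<mu> \<open>d \<ge> 1\<close> \<gamma>_pos \<gamma>_mono \<gamma>_doubling \<gamma>_tail)+
  have sym: "symmetric_on_power d \<mu> h"
    using h_sym by (simp add: symmetric_on_power_def space_PiM space_\<mu>)
  let ?N = "{1::nat..}" and ?V = "D \<times> {1::nat..}"
  have N_ne: "?N \<noteq> {}" and V_ne: "?V \<noteq> {}" and D_ne: "D \<noteq> {}" using \<open>d \<ge> 1\<close> by auto
  have law_X: "distr M (Pi\<^sub>M ?N (\<lambda>_. E)) (joint_rv ?N X) = P ?N"
    by (rule distr_joint_iid[OF \<open>prob_space M\<close> N_ne X_indep]) (simp add: X_law)
  have law_X': "distr M (Pi\<^sub>M ?V (\<lambda>_. E)) (joint_rv ?V (case_prod X')) = P ?V"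
    by (rule distr_joint_iterated[OF \<open>prob_space M\<close> _ D_ne prob_\<mu> sets_\<mu> X'_indep]) (simp_all add: X'_copies law_X)
  have law_\<epsilon>: "distr M (Pi\<^sub>M ?N (\<lambda>_. borel)) (joint_rv ?N \<epsilon>) = R ?N"
    by (rule distr_joint_rademacher[OF \<open>prob_space M\<close> N_ne rademacher])
  have law_\<epsilon>': "distr M (Pi\<^sub>M ?V (\<lambda>_. borel)) (joint_rv ?V (case_prod \<epsilon>')) = R ?V"
    by (rule distr_joint_rademacher[OF \<open>prob_space M\<close> V_ne rademacher'])
  have sets_R: "sets (Pi\<^sub>M I (\<lambda>_. borel)) = sets (R I)" for I :: "'i set"
    by (rule sets_PiM_cong) simp_all
  define Z where "Z \<omega> = (joint_rv ?N X \<omega>, joint_rv ?N \<epsilon> \<omega>)" for \<omega>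
  define Z' where "Z' \<omega> = (joint_rv ?V (case_prod X') \<omega>, joint_rv ?V (case_prod \<epsilon>') \<omega>)" for \<omega>
  let ?T = "Pi\<^sub>M ?N (\<lambda>_. E) \<Otimes>\<^sub>M Pi\<^sub>M ?V (\<lambda>_. E) \<Otimes>\<^sub>M Pi\<^sub>M ?V (\<lambda>_. (borel :: real measure))"
  let ?T' = "Pi\<^sub>M ?N (\<lambda>_. E) \<Otimes>\<^sub>M Pi\<^sub>M ?V (\<lambda>_. E) \<Otimes>\<^sub>M Pi\<^sub>M ?N (\<lambda>_. (borel :: real measure))"
  have sets_Z: "sets (Pi\<^sub>M ?N (\<lambda>_. E) \<Otimes>\<^sub>M Pi\<^sub>M ?N (\<lambda>_. borel)) = sets (P ?N \<Otimes>\<^sub>M R ?N)"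
    by (intro sets_pair_measure_cong sets_PiM sets_R)
  have sets_Z': "sets (Pi\<^sub>M ?V (\<lambda>_. E) \<Otimes>\<^sub>M Pi\<^sub>M ?V (\<lambda>_. borel)) = sets (P ?V \<Otimes>\<^sub>M R ?V)"
    by (intro sets_pair_measure_cong sets_PiM sets_R)
  have law_Z: "distr M (P ?N \<Otimes>\<^sub>M R ?N) Z = P ?N \<Otimes>\<^sub>M R ?N"
  proof -
    have "distr M (P ?N \<Otimes>\<^sub>M R ?N) Z = distr M (Pi\<^sub>M ?N (\<lambda>_. E) \<Otimes>\<^sub>M Pi\<^sub>M ?N (\<lambda>_. borel)) Z"
      by (rule distr_cong) (simp_all add: sets_Z)
    also have "\<dots> = P ?N \<Otimes>\<^sub>M R ?N"
      using distr_indep_pair[OF \<open>prob_space M\<close> \<epsilon>_indep measurable_fst] by (simp add: law_X law_\<epsilon> Z_def[abs_def])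
    finally show ?thesis .
  qed
  have law_Z': "distr M (P ?V \<Otimes>\<^sub>M R ?V) Z' = P ?V \<Otimes>\<^sub>M R ?V"
  proof -
    have "distr M (P ?V \<Otimes>\<^sub>M R ?V) Z' = distr M (Pi\<^sub>M ?V (\<lambda>_. E) \<Otimes>\<^sub>M Pi\<^sub>M ?V (\<lambda>_. borel)) Z'"
      by (rule distr_cong) (simp_all add: sets_Z')
    also have "\<dots> = P ?V \<Otimes>\<^sub>M R ?V"
      using distr_indep_pair[OF \<open>prob_space M\<close> \<epsilon>'_indep measurable_compose[OF measurable_snd measurable_fst]]
      by (simp add: law_X' law_\<epsilon>' Z'_def[abs_def])
    finally show ?thesis .
  qed
  have rv_\<epsilon>: "joint_rv ?N \<epsilon> \<in> M \<rightarrow>\<^sub>M R ?N" and rv_\<epsilon>': "joint_rv ?V (case_prod \<epsilon>') \<in> M \<rightarrow>\<^sub>M R ?V"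
    using \<epsilon>_indep \<epsilon>'_indep unfolding indep_rv_def
    by (simp_all add: measurable_cong_sets[OF refl sets_R])
  have "(\<lambda>\<omega>. fst (joint_rv ?N X \<omega>, joint_rv ?V (case_prod X') \<omega>, joint_rv ?V (case_prod \<epsilon>') \<omega>)) \<in> M \<rightarrow>\<^sub>M Pi\<^sub>M ?N (\<lambda>_. E)"
    using \<epsilon>_indep unfolding indep_rv_def by (intro measurable_compose[OF _ measurable_fst]) auto
  then have rv_X: "joint_rv ?N X \<in> M \<rightarrow>\<^sub>M P ?N" by (simp add: measurable_cong_sets[OF refl sets_PiM])
  have "(\<lambda>\<omega>. fst (snd (joint_rv ?N X \<omega>, joint_rv ?V (case_prod X') \<omega>, joint_rv ?V (case_prod \<epsilon>') \<omega>))) \<in> M \<rightarrow>\<^sub>M Pi\<^sub>M ?V (\<lambda>_. E)"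
    using \<epsilon>_indep unfolding indep_rv_def
    by (intro measurable_compose[OF _ measurable_fst] measurable_compose[OF _ measurable_snd]) auto
  then have rv_X': "joint_rv ?V (case_prod X') \<in> M \<rightarrow>\<^sub>M P ?V" by (simp add: measurable_cong_sets[OF refl sets_PiM])
  have law_X\<mu>: "distr M (P ?N) (joint_rv ?N X) = P ?N"
    by (subst law_X[symmetric]) (rule distr_cong, simp_all add: sets_PiM)
  have law_X'\<mu>: "distr M (P ?V) (joint_rv ?V (case_prod X')) = P ?V"
    by (subst law_X'[symmetric]) (rule distr_cong, simp_all add: sets_PiM)
  have Z: "Z \<in> M \<rightarrow>\<^sub>M P ?N \<Otimes>\<^sub>M R ?N" and Z': "Z' \<in> M \<rightarrow>\<^sub>M P ?V \<Otimes>\<^sub>M R ?V"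
    unfolding Z_def[abs_def] Z'_def[abs_def] using rv_X rv_\<epsilon> rv_X' rv_\<epsilon>' by measurable
  have pt: "pt d X i \<omega> = pick i (joint_rv ?N X \<omega>)" if "i \<in> incr_idx d n" for i n \<omega>
    using incr_sites[OF that] by (auto simp: pt_def pick_def joint_rv_def fun_eq_iff image_subset_iff)
  have sgn: "sgn_prod d \<epsilon> i \<omega> = (\<Prod>r\<in>D. joint_rv ?N \<epsilon> \<omega> (i r))" if "i \<in> incr_idx d n" for i n \<omega>
    unfolding sgn_prod_def using incr_sites[OF that]
    by (intro prod.cong) (auto simp: joint_rv_def image_subset_iff)
  have all_ge: "1 \<le> i r" if "i \<in> all_idx d n" "r \<in> D" for i n r
    using that by (auto simp: all_idx_def PiE_iff)
  have pt': "pt_dec d X' i \<omega> = pick (\<lambda>r. (r, i r)) (joint_rv ?V (case_prod X') \<omega>)" if "i \<in> all_idx d n" for i n \<omega>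
    using all_ge[OF that] by (auto simp: pt_dec_def pick_def joint_rv_def fun_eq_iff)
  have sgn': "sgn_prod_dec d \<epsilon>' i \<omega> = (\<Prod>r\<in>D. joint_rv ?V (case_prod \<epsilon>') \<omega> (r, i r))" if "i \<in> all_idx d n" for i n \<omega>
    unfolding sgn_prod_dec_def using all_ge[OF that] by (intro prod.cong) (auto simp: joint_rv_def)
  have dec_inj: "inj_on (\<lambda>i r. (r, i r)) (all_idx d n)" for n by (auto simp: inj_on_def fun_eq_iff)
  have a_iff: "(AE \<omega> in M. (\<lambda>n. 1 / \<gamma> n * (\<Sum>i\<in>incr_idx d n. sgn_prod d \<epsilon> i \<omega> * h (pt d X i \<omega>))) \<longlonglongrightarrow> 0)
      \<longleftrightarrow> (AE (x, e) in P ?N \<Otimes>\<^sub>M R ?N. (\<lambda>n. 1 / \<gamma> n * signed_sum (incr_idx d n) h x e) \<longlonglongrightarrow> 0)"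
    by (rule AE_signed_sum_transfer[OF Z law_Z incr_sign_system]) (simp add: signed_sum_def Z_def pt sgn)
  have b_iff: "(AE \<omega> in M. (\<lambda>n. 1 / \<gamma> n * (\<Sum>i\<in>all_idx d n. sgn_prod_dec d \<epsilon>' i \<omega> * h (pt_dec d X' i \<omega>))) \<longlonglongrightarrow> 0)
      \<longleftrightarrow> (AE (x, e) in P ?V \<Otimes>\<^sub>M R ?V. (\<lambda>n. 1 / \<gamma> n * signed_sum (dec n) h x e) \<longlonglongrightarrow> 0)"
    by (rule AE_signed_sum_transfer[OF Z' law_Z' dec_sign_system])
       (simp add: signed_sum_def Z'_def pt' sgn' dec_def sum.reindex[OF dec_inj])
  have c_iff: "(AE \<omega> in M. (\<lambda>n. 1 / (\<gamma> n)\<^sup>2 * (\<Sum>i\<in>incr_idx d n. (h (pt d X i \<omega>))\<^sup>2)) \<longlonglongrightarrow> 0)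
      \<longleftrightarrow> (AE x in P ?N. (\<lambda>n. 1 / (\<gamma> n)\<^sup>2 * sqsum (incr_idx d n) x) \<longlonglongrightarrow> 0)"
    by (rule AE_sqsum_transfer[OF rv_X law_X\<mu>]) (use incr_sites in \<open>fastforce simp: sqsum_def pt\<close>)+
  have d_iff: "(AE \<omega> in M. (\<lambda>n. 1 / (\<gamma> n)\<^sup>2 * (\<Sum>i\<in>all_idx d n. (h (pt_dec d X' i \<omega>))\<^sup>2)) \<longlonglongrightarrow> 0)
      \<longleftrightarrow> (AE x in P ?V. (\<lambda>n. 1 / (\<gamma> n)\<^sup>2 * sqsum (dec n) x) \<longlonglongrightarrow> 0)"
    by (rule AE_sqsum_transfer[OF rv_X' law_X'\<mu> dec_sites'])
       (simp_all add: sqsum_def pt' dec_def sum.reindex[OF dec_inj])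
  have trunc: "trunc_set d E \<mu> h \<gamma> k l = A k l" for k l
    by (rule trunc_set_cong_space) (simp add: space_\<mu>)
  have e_eq: "measure M {\<omega> \<in> space M. \<exists>i\<in>incr_idx d n. pt d X i \<omega> \<notin> trunc_set d E \<mu> h \<gamma> k d}
      = hit ?N (incr_idx d n) (space (P D) - A k d)" for n k
  proof -
    have "{\<omega> \<in> space M. \<exists>i\<in>incr_idx d n. pt d X i \<omega> \<notin> A k d}
        = {\<omega> \<in> space M. \<exists>u\<in>incr_idx d n. pick u (joint_rv ?N X \<omega>) \<notin> A k d}"
      by (intro Collect_cong conj_cong bex_cong refl) (simp add: pt)
    then show ?thesis
      unfolding trunc using hit_transfer[OF rv_X law_X\<mu> finite_incr_idx incr_sites' sets_A] by simp
  qed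
  have f_eq: "measure M {\<omega> \<in> space M. \<exists>i\<in>all_idx d n. pt_dec d X' i \<omega> \<notin> trunc_set d E \<mu> h \<gamma> k d}
      = hit ?V (dec n) (space (P D) - A k d)" for n k
  proof -
    have "{\<omega> \<in> space M. \<exists>i\<in>all_idx d n. pt_dec d X' i \<omega> \<notin> A k d}
        = {\<omega> \<in> space M. \<exists>u\<in>dec n. pick u (joint_rv ?V (case_prod X') \<omega>) \<notin> A k d}"
      unfolding dec_def bex_simps by (intro Collect_cong conj_cong bex_cong refl) (simp add: pt')
    then show ?thesis
      unfolding trunc using hit_transfer[OF rv_X' law_X'\<mu> finite_dec dec_sites' sets_A] by simp
  qed
  show ?thesis
    unfolding Let_def a_iff b_iff c_iff d_iff e_eq f_eq by (rule canonical_equivalences[OF sym])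
qed

end
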